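(* For $\tau>\sqrt2$ let $\widetilde\Sigma_\tau=\mathbb{S}^1(a(\tau))\times\mathbb{S}^1(b(\tau))\subset\mathbb{S}^3_\tau$, where $$a(\tau)=\sqrt{\tfrac12+c(\tau)},\qquad b(\tau)=\sqrt{\tfrac12-c(\tau)},\qquad c(\tau)=\tfrac12\sqrt{\tfrac{\tau^2-2}{\tau^2-1}},$$ which is a Willmore surface of the Berger sphere $\mathbb{S}^3_\tau$. Then $\widetilde\Sigma_\tau$ is unstable as a Willmore surface for every $\tau>\sqrt2$. Moreover, its index tends to infinity as $\tau\nearrow+\infty$.
   Context: Berger spheres: $\mathbb{S}^3=\{(z,w)\in\mathbb{C}^2:|z|^2+|w|^2=1\}$ with canonical round metric $\langle\cdot,\cdot\rangle$. For $\tau>0$, the Berger sphere $\mathbb{S}^3_\tau$ is $\mathbb{S}^3$ with the metric $g_\tau(X,Y)=\langle X,Y\rangle+(\tau^2-1)\langle X,V\rangle\langle Y,V\rangle$, where $V(z,w)=(iz,iw)$. $\widetilde\Sigma_\tau$ carries the metric induced from $\mathbb{S}^3_\tau$. Willmore energy: for a compact two-sided isometrically immersed surface $\Sigma$ without boundary in a Riemannian 3-manifold, with unit normal $N$, second fundamental form $A(X,Y)=\langle\overline\nabla_XN,Y\rangle$, mean curvature $H=\operatorname{tr}A$ and $\mathring{A}=A-\frac12Hg$, set $\mathcal{W}(\Sigma)=\int_\Sigma|\mathring{A}|^2\,d\Sigma$. A Willmore surface is a critical point of $\mathcal{W}$. For a Willmore surface $\Sigma\subset\mathbb{S}^3_\tau$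 and $f\in C^\infty(\Sigma)$ let $Q(f)=\frac{d^2}{dt^2}\big|_{t=0}\mathcal{W}(\Sigma_t)$ for a variation $\Sigma_t$ of $\Sigma$ with normal velocity $f_tN_t$, $f_0=f$. The index of $\Sigma$ is the maximal dimension of a subspace of functions on which the quadratic form $Q$ is negative definite. $\Sigma$ is stable if its index is $0$ and unstable otherwise. *)

theory Defs
  imports "HOL-Analysis.Analysis" "HOL-Library.Function_Algebras"
begin

section \<open>Smooth maps on open sets\<close>

primrec Ck_on :: "nat \<Rightarrow> 'a::euclidean_space set \<Rightarrow> ('a \<Rightarrow> 'b::real_normed_vector) \<Rightarrow> bool" where
  "Ck_on 0 S f \<longleftrightarrow> continuous_on S f"
| "Ck_on (Suc k) S f \<longleftrightarrow> (\<forall>x\<in>S. f differentiable (at x)) \<and>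
     (\<forall>v. Ck_on k S (\<lambda>x. frechet_derivative f (at x) v))"

text \<open>Only meaningful for open \<open>S\<close>, and only used for such \<open>S\<close>.\<close>
definition smooth_on :: "'a::euclidean_space set \<Rightarrow> ('a \<Rightarrow> 'b::real_normed_vector) \<Rightarrow> bool" where
  "smooth_on S f \<longleftrightarrow> (\<forall>k. Ck_on k S f)"

section \<open>Berger spheres\<close>

type_synonym C2 = "complex \<times> complex"

text \<open>The inner product of the real vector space \<open>C2\<close> is
  \<open>Re (z1 * cnj z2) + Re (w1 * cnj w2)\<close>, so its restriction to the tangent spaces of the sphere
  is the round metric.\<close>

definition S3 :: "C2 set" where
  "S3 = {(z, w). (cmod z)\<^sup>2 + (cmod w)\<^sup>2 = 1}"

definition tangent_S3 :: "C2 \<Rightarrow> C2 set" where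
  "tangent_S3 p = {X. X \<bullet> p = 0}"

definition hopf_field :: "C2 \<Rightarrow> C2" where
  "hopf_field p = (\<i> * fst p, \<i> * snd p)"

definition berger_metric :: "real \<Rightarrow> C2 \<Rightarrow> C2 \<Rightarrow> C2 \<Rightarrow> real" where
  "berger_metric \<tau> p X Y = X \<bullet> Y + (\<tau>\<^sup>2 - 1) * (X \<bullet> hopf_field p) * (Y \<bullet> hopf_field p)"

text \<open>The derivative of the metric coefficients in direction \<open>Z\<close>; the formula defining the metric
  makes sense for every point of \<open>C2\<close>.\<close>
definition berger_metric_deriv :: "real \<Rightarrow> C2 \<Rightarrow> C2 \<Rightarrow> C2 \<Rightarrow> C2 \<Rightarrow> real" where
  "berger_metric_deriv \<tau> p Z X Y = frechet_derivative (\<lambda>q. berger_metric \<tau> q X Y) (at p) Z"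

text \<open>The Levi-Civita connection of the Berger sphere, given by the Koszul formula: the covariant
  derivative at \<open>p\<close>, in direction \<open>X\<close>, of a tangent field (possibly only defined along a curve or a
  surface) with value \<open>Y\<close> at \<open>p\<close> whose derivative in direction \<open>X\<close>, as a \<open>C2\<close>-valued map, is \<open>Y'\<close>.
  That it is well-defined, metric and torsion-free is proved below.\<close>
definition koszul :: "real \<Rightarrow> C2 \<Rightarrow> C2 \<Rightarrow> C2 \<Rightarrow> C2 \<Rightarrow> C2 \<Rightarrow> bool" where
  "koszul \<tau> p X Y Y' W \<longleftrightarrow> W \<in> tangent_S3 p \<and> (\<forall>Z\<in>tangent_S3 p.
     berger_metric \<tau> p W Z = berger_metric \<tau> p Y' Z +
       (berger_metric_deriv \<tau> p X Y Z + berger_metric_deriv \<tau> p Y X Z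
         - berger_metric_deriv \<tau> p Z X Y) / 2)"

definition levi_civita :: "real \<Rightarrow> C2 \<Rightarrow> C2 \<Rightarrow> C2 \<Rightarrow> C2 \<Rightarrow> C2" where
  "levi_civita \<tau> p X Y Y' = (THE W. koszul \<tau> p X Y Y' W)"

section \<open>Immersed tori and the Willmore energy\<close>

text \<open>The torus is the quotient of the plane by the lattice generated by \<open>(2 * pi, 0)\<close> and
  \<open>(0, 2 * pi)\<close>; maps on it are doubly periodic maps on the plane.\<close>

definition doubly_periodic :: "(real \<times> real \<Rightarrow> 'a) \<Rightarrow> bool" where
  "doubly_periodic F \<longleftrightarrow> (\<forall>u v. F (u + 2 * pi, v) = F (u, v) \<and> F (u, v + 2 * pi) = F (u, v))"

definition coord_dir :: "2 \<Rightarrow> real \<times> real" where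
  "coord_dir i = (if i = 1 then (1, 0) else (0, 1))"

definition pd :: "2 \<Rightarrow> (real \<times> real \<Rightarrow> 'a::real_normed_vector) \<Rightarrow> real \<times> real \<Rightarrow> 'a" where
  "pd i F x = frechet_derivative F (at x) (coord_dir i)"

definition immersed_torus :: "(real \<times> real \<Rightarrow> C2) \<Rightarrow> bool" where
  "immersed_torus X \<longleftrightarrow> smooth_on UNIV X \<and> doubly_periodic X \<and>
     (\<forall>x. X x \<in> S3 \<and> inj (frechet_derivative X (at x)))"

definition unit_normal :: "real \<Rightarrow> (real \<times> real \<Rightarrow> C2) \<Rightarrow> (real \<times> real \<Rightarrow> C2) \<Rightarrow> bool" where
  "unit_normal \<tau> X N \<longleftrightarrow> smooth_on UNIV N \<and> doubly_periodic N \<and>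
     (\<forall>x. N x \<in> tangent_S3 (X x) \<and> berger_metric \<tau> (X x) (N x) (N x) = 1 \<and>
       (\<forall>i. berger_metric \<tau> (X x) (N x) (pd i X x) = 0))"

definition first_form :: "real \<Rightarrow> (real \<times> real \<Rightarrow> C2) \<Rightarrow> real \<times> real \<Rightarrow> real^2^2" where
  "first_form \<tau> X x = (\<chi> i j. berger_metric \<tau> (X x) (pd i X x) (pd j X x))"

definition second_form ::
    "real \<Rightarrow> (real \<times> real \<Rightarrow> C2) \<Rightarrow> (real \<times> real \<Rightarrow> C2) \<Rightarrow> real \<times> real \<Rightarrow> real^2^2" where
  "second_form \<tau> X N x =
     (\<chi> i j. berger_metric \<tau> (X x) (levi_civita \<tau> (X x) (pd i X x) (N x) (pd i N x)) (pd j X x))"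

definition mean_curvature ::
    "real \<Rightarrow> (real \<times> real \<Rightarrow> C2) \<Rightarrow> (real \<times> real \<Rightarrow> C2) \<Rightarrow> real \<times> real \<Rightarrow> real" where
  "mean_curvature \<tau> X N x = trace (matrix_inv (first_form \<tau> X x) ** second_form \<tau> X N x)"

definition traceless_form ::
    "real \<Rightarrow> (real \<times> real \<Rightarrow> C2) \<Rightarrow> (real \<times> real \<Rightarrow> C2) \<Rightarrow> real \<times> real \<Rightarrow> real^2^2" where
  "traceless_form \<tau> X N x =
     second_form \<tau> X N x - (mean_curvature \<tau> X N x / 2) *\<^sub>R first_form \<tau> X x"

text \<open>The squared norm, with respect to the metric with Gram matrix \<open>G\<close>, of the bilinear form with
  matrix \<open>B\<close>: in index notation, \<open>G^ik G^jl B_ij B_kl\<close>.\<close>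
definition form_norm_sq :: "real^2^2 \<Rightarrow> real^2^2 \<Rightarrow> real" where
  "form_norm_sq G B = trace (matrix_inv G ** B ** matrix_inv G ** transpose B)"

definition willmore_energy ::
    "real \<Rightarrow> (real \<times> real \<Rightarrow> C2) \<Rightarrow> (real \<times> real \<Rightarrow> C2) \<Rightarrow> real" where
  "willmore_energy \<tau> X N = integral (cbox (0, 0) (2 * pi, 2 * pi))
     (\<lambda>x. form_norm_sq (first_form \<tau> X x) (traceless_form \<tau> X N x) * sqrt (det (first_form \<tau> X x)))"

section \<open>Variations, Willmore surfaces, second variation and index\<close>

text \<open>A variation of the immersed torus \<open>X\<^sub>0\<close>: a smooth family of immersed tori \<open>X t\<close>, for \<open>t\<close> near
  \<open>0\<close>, together with a smooth family of unit normals \<open>N t\<close>.\<close>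
definition variation ::
    "real \<Rightarrow> (real \<times> real \<Rightarrow> C2) \<Rightarrow> (real \<Rightarrow> real \<times> real \<Rightarrow> C2) \<Rightarrow> (real \<Rightarrow> real \<times> real \<Rightarrow> C2) \<Rightarrow> bool"
  where
  "variation \<tau> X\<^sub>0 X N \<longleftrightarrow> X 0 = X\<^sub>0 \<and>
     (\<exists>\<epsilon>>0. smooth_on ({-\<epsilon><..<\<epsilon>} \<times> UNIV) (\<lambda>(t, x). X t x) \<and>
            smooth_on ({-\<epsilon><..<\<epsilon>} \<times> UNIV) (\<lambda>(t, x). N t x) \<and>
            (\<forall>t\<in>{-\<epsilon><..<\<epsilon>}. immersed_torus (X t) \<and> unit_normal \<tau> (X t) (N t)))"

definition willmore_surface :: "real \<Rightarrow> (real \<times> real \<Rightarrow> C2) \<Rightarrow> bool" where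
  "willmore_surface \<tau> X\<^sub>0 \<longleftrightarrow> immersed_torus X\<^sub>0 \<and> (\<exists>N. unit_normal \<tau> X\<^sub>0 N) \<and>
     (\<forall>X N. variation \<tau> X\<^sub>0 X N \<longrightarrow>
       ((\<lambda>t. willmore_energy \<tau> (X t) (N t)) has_real_derivative 0) (at 0))"

text \<open>The velocity at time \<open>0\<close> is \<open>f\<close> times the unit normal. When \<open>X\<^sub>0\<close> is critical, the second
  derivative of the energy at \<open>0\<close> depends on nothing else; hence later velocities are left free.\<close>
definition initial_normal_velocity ::
    "(real \<Rightarrow> real \<times> real \<Rightarrow> C2) \<Rightarrow> (real \<Rightarrow> real \<times> real \<Rightarrow> C2) \<Rightarrow> (real \<times> real \<Rightarrow> real) \<Rightarrow> bool" where
  "initial_normal_velocity X N f \<longleftrightarrow>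
     (\<forall>x. ((\<lambda>t. X t x) has_vector_derivative f x *\<^sub>R N 0 x) (at 0))"

definition second_variation :: "real \<Rightarrow> (real \<times> real \<Rightarrow> C2) \<Rightarrow> (real \<times> real \<Rightarrow> real) \<Rightarrow> real" where
  "second_variation \<tau> X\<^sub>0 f = (THE q. \<exists>X N. variation \<tau> X\<^sub>0 X N \<and> initial_normal_velocity X N f \<and>
     q = (deriv ^^ 2) (\<lambda>t. willmore_energy \<tau> (X t) (N t)) 0)"

definition torus_functions :: "(real \<times> real \<Rightarrow> real) set" where
  "torus_functions = {f. smooth_on UNIV f \<and> doubly_periodic f}"

interpretation plane_fun: vector_space "\<lambda>c (f :: real \<times> real \<Rightarrow> real) x. c * f x"
  by unfold_locales (simp_all add: fun_eq_iff algebra_simps)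

text \<open>The finiteness condition is needed because \<open>dim\<close> is \<open>0\<close> for infinite-dimensional spaces. The
  supremum is \<open>\<infinity>\<close> if an infinite-dimensional subspace of negative functions exists.\<close>
definition willmore_index :: "real \<Rightarrow> (real \<times> real \<Rightarrow> C2) \<Rightarrow> enat" where
  "willmore_index \<tau> X\<^sub>0 = (SUP U \<in> {U. plane_fun.subspace U \<and> (\<exists>B. finite B \<and> U \<subseteq> plane_fun.span B) \<and>
       U \<subseteq> torus_functions \<and> (\<forall>f\<in>U. f \<noteq> 0 \<longrightarrow> second_variation \<tau> X\<^sub>0 f < 0)}.
     enat (plane_fun.dim U))"

definition willmore_stable :: "real \<Rightarrow> (real \<times> real \<Rightarrow> C2) \<Rightarrow> bool" where
  "willmore_stable \<tau> X\<^sub>0 \<longleftrightarrow> willmore_index \<tau> X\<^sub>0 = 0"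

abbreviation willmore_unstable :: "real \<Rightarrow> (real \<times> real \<Rightarrow> C2) \<Rightarrow> bool" where
  "willmore_unstable \<tau> X\<^sub>0 \<equiv> \<not> willmore_stable \<tau> X\<^sub>0"

section \<open>The tori\<close>

definition clifford_torus :: "real \<Rightarrow> real \<Rightarrow> real \<times> real \<Rightarrow> C2" where
  "clifford_torus a b = (\<lambda>(u, v). (of_real a * cis u, of_real b * cis v))"

definition c_par :: "real \<Rightarrow> real" where
  "c_par \<tau> = sqrt ((\<tau>\<^sup>2 - 2) / (\<tau>\<^sup>2 - 1)) / 2"

definition a_par :: "real \<Rightarrow> real" where
  "a_par \<tau> = sqrt (1/2 + c_par \<tau>)"

definition b_par :: "real \<Rightarrow> real" where
  "b_par \<tau> = sqrt (1/2 - c_par \<tau>)"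

definition willmore_torus :: "real \<Rightarrow> real \<times> real \<Rightarrow> C2" where
  "willmore_torus \<tau> = clifford_torus (a_par \<tau>) (b_par \<tau>)"

section \<open>Sanity checks\<close>

text \<open>\<open>clifford_torus a b\<close> induces a bijection from the quotient torus to the product of the circles.\<close>

lemma range_clifford_torus:
  assumes "a > 0" "b > 0"
  shows "range (clifford_torus a b) = sphere 0 a \<times> sphere 0 b"
proof -
  have *: "\<exists>u. z = of_real (cmod z) * cis u" for z
    by (metis rcis_def rcis_cmod_Arg)
  show ?thesis
  proof (intro equalityI subsetI)
    fix p :: C2 assume "p \<in> range (clifford_torus a b)"
    then show "p \<in> sphere 0 a \<times> sphere 0 b"
      using assms by (auto simp: clifford_torus_def norm_mult)
  next
    fix p :: C2 assume p: "p \<in> sphere 0 a \<times> sphere 0 b"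
    then have ab: "cmod (fst p) = a" "cmod (snd p) = b"
      by auto
    obtain u v where "fst p = of_real a * cis u" "snd p = of_real b * cis v"
      using *[of "fst p"] *[of "snd p"] unfolding ab by blast
    then have "p = clifford_torus a b (u, v)"
      by (simp add: clifford_torus_def prod_eq_iff)
    then show "p \<in> range (clifford_torus a b)" by blast
  qed
qed

lemma clifford_torus_eq_iff:
  assumes "a > 0" "b > 0"
  shows "clifford_torus a b (u, v) = clifford_torus a b (u', v') \<longleftrightarrow>
    (\<exists>m::int. u = u' + 2 * pi * m) \<and> (\<exists>n::int. v = v' + 2 * pi * n)"
proof -
  have "cis x = cis y \<longleftrightarrow> (\<exists>n::int. x = y + 2 * pi * n)" for x y
    using sin_cos_eq_iff[of x y] by (auto simp: complex_eq_iff)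
  then show ?thesis
    using assms by (simp add: clifford_torus_def)
qed

lemma inner_hopf_field: "X \<bullet> hopf_field Y = - (hopf_field X \<bullet> Y)"
  by (simp add: hopf_field_def inner_prod_def inner_complex_def)

lemma berger_metric_deriv_eq:
  "berger_metric_deriv \<tau> p Z X Y =
     (\<tau>\<^sup>2 - 1) * ((X \<bullet> hopf_field Z) * (Y \<bullet> hopf_field p) + (X \<bullet> hopf_field p) * (Y \<bullet> hopf_field Z))"
proof -
  have lin: "bounded_linear hopf_field"
    unfolding hopf_field_def
    by (intro bounded_linear_Pair bounded_linear_const_mult bounded_linear_fst bounded_linear_snd)
  note [derivative_intros] = bounded_linear.has_derivative[OF lin]
  have "((\<lambda>q. berger_metric \<tau> q X Y) has_derivative
     (\<lambda>Z. (\<tau>\<^sup>2 - 1) * ((X \<bullet> hopf_field Z) * (Y \<bullet> hopf_field p) + (X \<bullet> hopf_field p) * (Y \<bullet> hopf_field Z))))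
     (at p)"
    unfolding berger_metric_def
    by (auto intro!: derivative_eq_intros simp: algebra_simps fun_eq_iff)
  from frechet_derivative_at[OF this, symmetric] show ?thesis
    by (simp add: berger_metric_deriv_def)
qed

lemma levi_civita_ex1:
  assumes "\<tau> > 0" "p \<in> S3"
  shows "\<exists>!W. koszul \<tau> p X Y Y' W"
proof -
  define k where "k = \<tau>\<^sup>2 - 1"
  define V where "V = hopf_field p"
  define l where "l = Y' + (k * (Y' \<bullet> V)) *\<^sub>R V
    + (k / 2) *\<^sub>R ((Y \<bullet> hopf_field X) *\<^sub>R V + (Y \<bullet> V) *\<^sub>R hopf_field X
      + (X \<bullet> hopf_field Y) *\<^sub>R V + (X \<bullet> V) *\<^sub>R hopf_field Y
      + (Y \<bullet> V) *\<^sub>R hopf_field X + (X \<bullet> V) *\<^sub>R hopf_field Y)"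
  define l' where "l' = l - (l \<bullet> p) *\<^sub>R p"
  define W where "W = l' - (k / \<tau>\<^sup>2 * (l' \<bullet> V)) *\<^sub>R V"
  have pp: "p \<bullet> p = 1"
    using assms(2) by (cases p) (auto simp: S3_def inner_prod_def dot_square_norm)
  have VV: "V \<bullet> V = 1"
    using pp by (simp add: V_def hopf_field_def inner_prod_def inner_complex_def)
  have Vp: "V \<bullet> p = 0"
    by (simp add: V_def hopf_field_def inner_prod_def inner_complex_def)
  have tau: "1 + k = \<tau>\<^sup>2" "\<tau>\<^sup>2 > 0" using assms(1) by (simp_all add: k_def)
  have rhs: "berger_metric \<tau> p Y' Z +
       (berger_metric_deriv \<tau> p X Y Z + berger_metric_deriv \<tau> p Y X Z
         - berger_metric_deriv \<tau> p Z X Y) / 2 = l \<bullet> Z" for Z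
  proof -
    have "l \<bullet> Z = Y' \<bullet> Z + k * (Y' \<bullet> V) * (V \<bullet> Z) + k / 2 *
        ((Y \<bullet> hopf_field X) * (V \<bullet> Z) + (Y \<bullet> V) * (hopf_field X \<bullet> Z)
        + (X \<bullet> hopf_field Y) * (V \<bullet> Z) + (X \<bullet> V) * (hopf_field Y \<bullet> Z)
        + (Y \<bullet> V) * (hopf_field X \<bullet> Z) + (X \<bullet> V) * (hopf_field Y \<bullet> Z))"
      unfolding l_def inner_add_left inner_scaleR_left by (simp add: algebra_simps)
    then show ?thesis
      unfolding berger_metric_deriv_eq berger_metric_def k_def[symmetric] V_def[symmetric]
        inner_hopf_field[of X Z] inner_hopf_field[of Y Z] inner_commute[of Z]
      by algebra
  qed
  have W: "W \<in> tangent_S3 p"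
    using pp Vp by (simp add: tangent_S3_def W_def l'_def inner_diff_left)
  have WZ: "berger_metric \<tau> p W Z = l \<bullet> Z" if "Z \<in> tangent_S3 p" for Z
  proof -
    have Zp: "p \<bullet> Z = 0" using that by (simp add: tangent_S3_def inner_commute)
    have "W \<bullet> V = (l' \<bullet> V) * (1 - k / \<tau>\<^sup>2)"
      by (simp add: W_def inner_diff_left VV algebra_simps)
    also have "1 - k / \<tau>\<^sup>2 = 1 / \<tau>\<^sup>2" using tau by (simp add: field_simps)
    finally have WV: "W \<bullet> V = (l' \<bullet> V) / \<tau>\<^sup>2" by simp
    have "W \<bullet> Z = l \<bullet> Z - k / \<tau>\<^sup>2 * (l' \<bullet> V) * (Z \<bullet> V)"
    proof -
      have "l' \<bullet> Z = l \<bullet> Z"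
        by (simp add: l'_def inner_diff_left Zp)
      then show ?thesis
        by (simp add: W_def inner_diff_left inner_commute[of V Z])
    qed
    with WV show ?thesis
      by (simp add: berger_metric_def k_def[symmetric] V_def[symmetric])
  qed
  show ?thesis
  proof (rule ex1I)
    show "koszul \<tau> p X Y Y' W" using W WZ rhs by (simp add: koszul_def)
  next
    fix W' assume "koszul \<tau> p X Y Y' W'"
    then have W': "W' \<in> tangent_S3 p" "\<And>Z. Z \<in> tangent_S3 p \<Longrightarrow> berger_metric \<tau> p W' Z = l \<bullet> Z"
      using rhs by (simp_all add: koszul_def)
    define D where "D = W' - W"
    have D: "D \<in> tangent_S3 p"
      using W W' by (simp add: D_def tangent_S3_def inner_diff_left)
    have "berger_metric \<tau> p D D = berger_metric \<tau> p W' D - berger_metric \<tau> p W D"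
      by (simp add: D_def berger_metric_def inner_diff_left inner_diff_right algebra_simps)
    also have "\<dots> = 0" using W' D WZ by simp
    finally have z: "D \<bullet> D + k * (D \<bullet> V)\<^sup>2 = 0"
      by (simp add: berger_metric_def k_def V_def power2_eq_square)
    have CS: "(D \<bullet> V)\<^sup>2 \<le> D \<bullet> D"
      using Cauchy_Schwarz_ineq[of D V] VV by simp
    have "D \<bullet> D = 0"
    proof (rule ccontr)
      assume "D \<bullet> D \<noteq> 0"
      then have pos: "D \<bullet> D > 0" by simp
      have "D \<bullet> D + k * (D \<bullet> V)\<^sup>2 = (D \<bullet> D - (D \<bullet> V)\<^sup>2) + \<tau>\<^sup>2 * (D \<bullet> V)\<^sup>2"
        by (simp add: tau(1)[symmetric] algebra_simps)
      with z CS tau(2) have "D \<bullet> D - (D \<bullet> V)\<^sup>2 = 0" "\<tau>\<^sup>2 * (D \<bullet> V)\<^sup>2 = 0"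
        by (smt (verit) mult_nonneg_nonneg zero_le_power2)+
      with tau(2) pos show False by simp
    qed
    then show "W' = W" by (simp add: D_def)
  qed
qed

lemma koszul_levi_civita:
  assumes "\<tau> > 0" "p \<in> S3"
  shows "koszul \<tau> p X Y Y' (levi_civita \<tau> p X Y Y')"
  unfolding levi_civita_def by (rule theI'[OF levi_civita_ex1[OF assms]])

lemma levi_civita_tangent:
  assumes "\<tau> > 0" "p \<in> S3"
  shows "levi_civita \<tau> p X Y Y' \<in> tangent_S3 p"
  using koszul_levi_civita[OF assms] by (simp add: koszul_def)

lemma levi_civita_koszul:
  assumes "\<tau> > 0" "p \<in> S3" "Z \<in> tangent_S3 p"
  shows "berger_metric \<tau> p (levi_civita \<tau> p X Y Y') Z = berger_metric \<tau> p Y' Z +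
       (berger_metric_deriv \<tau> p X Y Z + berger_metric_deriv \<tau> p Y X Z
         - berger_metric_deriv \<tau> p Z X Y) / 2"
  using koszul_levi_civita[OF assms(1,2), of X Y Y'] assms(3) by (simp add: koszul_def)

lemma berger_metric_commute: "berger_metric \<tau> p X Y = berger_metric \<tau> p Y X"
  by (simp add: berger_metric_def inner_commute)

lemma levi_civita_metric:
  assumes "\<tau> > 0" "p \<in> S3" "Y \<in> tangent_S3 p" "Z \<in> tangent_S3 p"
  shows "berger_metric \<tau> p (levi_civita \<tau> p X Y Y') Z + berger_metric \<tau> p Y (levi_civita \<tau> p X Z Z') =
    berger_metric_deriv \<tau> p X Y Z + berger_metric \<tau> p Y' Z + berger_metric \<tau> p Y Z'"
proof -
  have "berger_metric_deriv \<tau> p X Y Z = berger_metric_deriv \<tau> p X Z Y"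
    "berger_metric_deriv \<tau> p Y X Z = berger_metric_deriv \<tau> p Y Z X"
    "berger_metric_deriv \<tau> p Z X Y = berger_metric_deriv \<tau> p Z Y X"
    unfolding berger_metric_deriv_eq by algebra+
  then show ?thesis
    using levi_civita_koszul[OF assms(1,2,4), of X Y Y'] levi_civita_koszul[OF assms(1,2,3), of X Z Z']
      berger_metric_commute[of \<tau> p Y "levi_civita \<tau> p X Z Z'"] berger_metric_commute[of \<tau> p Y Z']
    by argo
qed

lemma levi_civita_torsion_free:
  assumes "\<tau> > 0" "p \<in> S3" "Y' - X' \<in> tangent_S3 p"
  shows "levi_civita \<tau> p X Y Y' - levi_civita \<tau> p Y X X' = Y' - X'"
proof -
  have "koszul \<tau> p X Y Y' (levi_civita \<tau> p Y X X' + (Y' - X'))"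
    unfolding koszul_def
  proof (intro conjI ballI)
    show "levi_civita \<tau> p Y X X' + (Y' - X') \<in> tangent_S3 p"
      using levi_civita_tangent[OF assms(1,2), of Y X X'] assms(3)
      by (simp add: tangent_S3_def inner_add_left)
  next
    fix Z assume Z: "Z \<in> tangent_S3 p"
    have "berger_metric \<tau> p (levi_civita \<tau> p Y X X' + (Y' - X')) Z =
        berger_metric \<tau> p (levi_civita \<tau> p Y X X') Z + berger_metric \<tau> p Y' Z - berger_metric \<tau> p X' Z"
      unfolding berger_metric_def inner_add_left inner_diff_left by algebra
    moreover have "berger_metric_deriv \<tau> p Z X Y = berger_metric_deriv \<tau> p Z Y X"
      unfolding berger_metric_deriv_eq by algebra
    ultimately show "berger_metric \<tau> p (levi_civita \<tau> p Y X X' + (Y' - X')) Z = berger_metric \<tau> p Y' Z +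
       (berger_metric_deriv \<tau> p X Y Z + berger_metric_deriv \<tau> p Y X Z
         - berger_metric_deriv \<tau> p Z X Y) / 2"
      using levi_civita_koszul[OF assms(1,2) Z, of Y X X'] by simp
  qed
  then have "levi_civita \<tau> p X Y Y' = levi_civita \<tau> p Y X X' + (Y' - X')"
    using levi_civita_ex1[OF assms(1,2)] koszul_levi_civita[OF assms(1,2)] by blast
  then show ?thesis by simp
qed

end

theory Submission
  imports Defs
begin

text \<open>
  The second variation of the Willmore energy at these tori is computed explicitly; on a suitable
  family of Fourier modes it is diagonal, and the number of negative entries grows with \<open>\<tau>\<close>.

  \<^emph>\<open>Polar coordinates.\<close> Near the torus both coordinates of \<open>(z, w)\<close> are nonzero. With
  \<open>\<rho> = |z|\<^sup>2\<close>, \<open>q = \<rho> (1 - \<rho>)\<close>, the differentials \<open>d\<phi> = Im (dz / z)\<close> and \<open>d\<theta> = Im (dw / w)\<close> of the two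
  arguments, \<open>\<psi> = d\<phi> - d\<theta>\<close> and \<open>\<eta> = \<rho> d\<phi> + (1 - \<rho>) d\<theta>\<close>, the Berger metric is
  \<open>d\<rho>\<^sup>2 / (4 q) + q \<psi>\<^sup>2 + \<tau>\<^sup>2 \<eta>\<^sup>2\<close>. Its coefficients depend on \<open>\<rho>\<close> alone and only differentials of the
  arguments occur, so no branch of the argument has to be chosen. The integrand of the Willmore
  energy becomes an explicit algebraic function of first and second derivatives
  (\<open>willmore_integrand\<close>).

  \<^emph>\<open>First variation.\<close> A Clifford torus is an orbit of isometries, so the time derivative of the
  integrand at time \<open>0\<close> is a linear expression with constant coefficients in the velocities of these
  quantities. Up to multiples of the velocity of \<open>\<rho>\<close> these are exact derivatives of periodic functions,
  which integrate to zero, and the total coefficient of the velocity of \<open>\<rho>\<close> vanishes because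
  \<open>4 a\<^sup>2 b\<^sup>2 (\<tau>\<^sup>2 - 1) = 1\<close>. Hence the torus is critical
  (\<open>first_variation\<close>).

  \<^emph>\<open>Second variation.\<close> For an initial velocity \<open>f\<close> times the normal only \<open>\<rho>\<close> moves to first order.
  The accelerations enter through the same linear expression and drop out, and the second derivative
  of the energy is the integral of a quadratic form with constant coefficients in \<open>f\<close> and its
  derivatives of order at most two (\<open>second_variation_eq\<close>). Every smooth periodic \<open>f\<close> is the normal
  velocity of some variation (\<open>variation_exists\<close>), so this is the second variation.

  \<^emph>\<open>Negative modes.\<close> On \<open>cos (m u + v)\<close> the form takes, up to a positive factor, the value computed in
  \<open>symbol_eq\<close>, where \<open>x = b\<^sup>2 m - a\<^sup>2\<close> and \<open>y = m + 1\<close> are the frequencies in the horizontal and in the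
  Hopf direction. For \<open>m = 0\<close> it is negative whenever \<open>a\<^sup>2 > 1 / 2\<close>, which gives instability. For fixed
  \<open>m\<close> and \<open>\<tau> \<rightarrow> \<infinity>\<close> one has \<open>b \<rightarrow> 0\<close> and \<open>x \<rightarrow> -1\<close>, and a term of order \<open>- q \<tau>\<^sup>4 y\<close>
  dominates; the first \<open>M\<close> modes are negative as soon as \<open>\<tau>\<^sup>2 \<ge> 16 M\<^sup>3\<close>. Geometrically the torus
  becomes a thin tube around a Hopf fibre, and these modes displace its cross-sections slowly along
  the fibre.
\<close>

section \<open>Smooth maps and directional derivatives\<close>

text \<open>The direction comes first, so that \<open>dird v\<close> is an operator on functions and can be iterated.\<close>
definition dird :: "'a::euclidean_space \<Rightarrow> ('a \<Rightarrow> 'b::real_normed_vector) \<Rightarrow> 'a \<Rightarrow> 'b" where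
  "dird v f = (\<lambda>y. frechet_derivative f (at y) v)"

lemma dirdI: "(f has_derivative f') (at y) \<Longrightarrow> dird v f y = f' v"
  unfolding dird_def using frechet_derivative_at by metis

lemma dird_cong:
  assumes "open S" "y \<in> S" "\<And>x. x \<in> S \<Longrightarrow> f x = g x"
  shows "dird v f y = dird v g y"
proof -
  have "(f has_derivative h) (at y) \<longleftrightarrow> (g has_derivative h) (at y)" for h
    using has_derivative_transform_within_open[of f h y UNIV S g]
      has_derivative_transform_within_open[of g h y UNIV S f] assms by auto
  then show ?thesis by (simp add: dird_def frechet_derivative_def)
qed

lemma Ck_on_Suc: "Ck_on (Suc k) S f \<longleftrightarrow> (\<forall>x\<in>S. f differentiable (at x)) \<and> (\<forall>v. Ck_on k S (dird v f))"
  by (simp add: dird_def)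

declare Ck_on.simps(2) [simp del]

lemma Ck_on_cong:
  assumes "open S" "\<And>x. x \<in> S \<Longrightarrow> f x = g x"
  shows "Ck_on k S f \<longleftrightarrow> Ck_on k S g"
  using assms(2)
proof (induction k arbitrary: f g)
  case 0
  then show ?case by (simp cong: continuous_on_cong)
next
  case (Suc k)
  have "dird v f x = dird v g x" if "x \<in> S" for v x
    using dird_cong[OF assms(1) that Suc.prems] .
  then have "Ck_on k S (dird v f) \<longleftrightarrow> Ck_on k S (dird v g)" for v
    by (rule Suc.IH)
  moreover have "f differentiable (at x) \<longleftrightarrow> g differentiable (at x)" if "x \<in> S" for x
    unfolding differentiable_def
    using has_derivative_transform_within_open[of f _ x UNIV S g]
      has_derivative_transform_within_open[of g _ x UNIV S f] assms(1) Suc.prems that by metis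
  ultimately show ?case by (simp add: Ck_on_Suc)
qed

lemma Ck_on_decr: "Ck_on (Suc k) S f \<Longrightarrow> Ck_on k S f"
proof (induction k arbitrary: f)
  case 0
  then show ?case
    by (auto simp: Ck_on_Suc intro!: differentiable_imp_continuous_on
        intro: differentiable_at_imp_differentiable_on)
next
  case (Suc k)
  then show ?case unfolding Ck_on_Suc[of _ S f] by blast
qed

text \<open>The induction step in all closure properties below: they hold because the derivative of the new
  function is built, by operations already covered, from the old functions and their derivatives.\<close>
lemma Ck_on_SucI:
  assumes "open S" "\<And>x. x \<in> S \<Longrightarrow> (f has_derivative f' x) (at x)"
    and "\<And>v. Ck_on k S (\<lambda>x. f' x v)"
  shows "Ck_on (Suc k) S f"
  unfolding Ck_on_Suc
proof (intro conjI allI ballI)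
  fix v
  have "Ck_on k S (dird v f) \<longleftrightarrow> Ck_on k S (\<lambda>x. f' x v)"
    by (rule Ck_on_cong[OF assms(1)]) (rule dirdI[OF assms(2)])
  then show "Ck_on k S (dird v f)" using assms(3) by simp
next
  fix x assume "x \<in> S" then show "f differentiable at x"
    using assms(2) by (auto simp: differentiable_def)
qed

lemma Ck_on_has_derivative:
  assumes "Ck_on (Suc k) S f" "x \<in> S"
  shows "(f has_derivative (\<lambda>v. dird v f x)) (at x)"
  using assms unfolding Ck_on_Suc dird_def by (metis frechet_derivative_works)

lemma Ck_on_const: "open S \<Longrightarrow> Ck_on k S (\<lambda>x. c)"
proof (induction k arbitrary: c)
  case (Suc k)
  show ?case by (rule Ck_on_SucI[where f' = "\<lambda>_ _. 0"]) (use Suc in \<open>auto simp: continuous_on_const\<close>)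
qed (simp add: continuous_on_const)

lemma Ck_on_bounded_linear:
  assumes "open S" "bounded_linear L" "Ck_on k S f"
  shows "Ck_on k S (\<lambda>x. L (f x))"
  using assms(3)
proof (induction k arbitrary: f)
  case 0
  then show ?case using bounded_linear.continuous_on[OF assms(2)] by simp
next
  case (Suc k)
  show ?case
    by (rule Ck_on_SucI[OF assms(1) bounded_linear.has_derivative[OF assms(2) Ck_on_has_derivative[OF Suc.prems]]])
       (use Suc in \<open>auto simp: Ck_on_Suc\<close>)
qed

lemma Ck_on_ident: "open S \<Longrightarrow> Ck_on k S (\<lambda>x. x)"
proof (cases k)
  case (Suc l)
  assume "open S"
  then show ?thesis unfolding Suc
    by (intro Ck_on_SucI[where f' = "\<lambda>_ v. v"]) (auto intro!: Ck_on_const)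
qed simp

lemma Ck_on_add:
  assumes "open S" "Ck_on k S f" "Ck_on k S g"
  shows "Ck_on k S (\<lambda>x. f x + g x)"
  using assms(2,3)
proof (induction k arbitrary: f g)
  case 0
  then show ?case by (simp add: continuous_on_add)
next
  case (Suc k)
  show ?case
    by (rule Ck_on_SucI[OF assms(1) has_derivative_add[OF
          Ck_on_has_derivative[OF Suc.prems(1)] Ck_on_has_derivative[OF Suc.prems(2)]]])
       (use Suc in \<open>auto simp: Ck_on_Suc\<close>)
qed

lemma Ck_on_mult:
  fixes f g :: "'a::euclidean_space \<Rightarrow> real"
  assumes "open S" "Ck_on k S f" "Ck_on k S g"
  shows "Ck_on k S (\<lambda>x. f x * g x)"
  using assms(2,3)
proof (induction k arbitrary: f g)
  case 0
  then show ?case by (simp add: continuous_on_mult)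
next
  case (Suc k)
  show ?case
  proof (rule Ck_on_SucI[OF assms(1) has_derivative_mult[OF
          Ck_on_has_derivative[OF Suc.prems(1)] Ck_on_has_derivative[OF Suc.prems(2)]]])
    fix v
    show "Ck_on k S (\<lambda>x. f x * dird v g x + dird v f x * g x)"
      using Suc.prems Ck_on_decr[OF Suc.prems(1)] Ck_on_decr[OF Suc.prems(2)]
      by (intro Ck_on_add[OF assms(1)] Suc.IH) (auto simp: Ck_on_Suc)
  qed
qed

text \<open>The derivative \<open>- f\<^sup>-\<^sup>1 f' f\<^sup>-\<^sup>1\<close> contains the inverse itself, so the induction on the order
  closes with products alone.\<close>
lemma Ck_on_inverse:
  fixes f :: "'a::euclidean_space \<Rightarrow> real"
  assumes "open S" "Ck_on k S f" "\<And>x. x \<in> S \<Longrightarrow> f x \<noteq> 0"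
  shows "Ck_on k S (\<lambda>x. inverse (f x))"
  using assms(2)
proof (induction k)
  case 0
  then show ?case using assms(3) by (simp add: continuous_on_inverse)
next
  case (Suc k)
  show ?case
  proof (rule Ck_on_SucI[OF assms(1) Deriv.has_derivative_inverse[OF assms(3) Ck_on_has_derivative[OF Suc.prems]]])
    fix v
    have "Ck_on k S (\<lambda>x. inverse (f x))" using Suc Ck_on_decr by blast
    moreover have "Ck_on k S (dird v f)" using Suc.prems by (simp add: Ck_on_Suc)
    ultimately have "Ck_on k S (\<lambda>x. (- 1) * (inverse (f x) * dird v f x * inverse (f x)))"
      by (intro Ck_on_mult Ck_on_const assms(1))
    then show "Ck_on k S (\<lambda>x. - (inverse (f x) * dird v f x * inverse (f x)))" by simp
  qed
qed

text \<open>With \<open>r\<close> the inverse root of \<open>f\<close> the derivative is \<open>- r\<^sup>3 f' / 2\<close>, again a polynomial in \<open>r\<close>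
  and \<open>f'\<close>.\<close>
lemma Ck_on_inverse_sqrt:
  fixes f :: "'a::euclidean_space \<Rightarrow> real"
  assumes "open S" "Ck_on k S f" "\<And>x. x \<in> S \<Longrightarrow> f x > 0"
  shows "Ck_on k S (\<lambda>x. inverse (sqrt (f x)))"
  using assms(2)
proof (induction k)
  case 0
  then have c: "continuous_on S (\<lambda>x. sqrt (f x))" by (simp add: continuous_on_real_sqrt)
  show ?case using continuous_on_inverse[OF c] assms(3) by force
next
  case (Suc k)
  define r where "r = (\<lambda>x. inverse (sqrt (f x)))"
  have d: "((\<lambda>x. inverse (sqrt (f x))) has_derivative
      (\<lambda>v. dird v f x * (- (1/2) * (r x * r x * r x)))) (at x)" if "x \<in> S" for x
  proof (rule DERIV_compose_FDERIV[OF _ Ck_on_has_derivative[OF Suc.prems that]])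
    show "DERIV (\<lambda>x. inverse (sqrt x)) (f x) :> - (1/2) * (r x * r x * r x)"
      using assms(3)[OF that] unfolding r_def
      by (auto intro!: derivative_eq_intros simp: field_simps power2_eq_square)
  qed
  show ?case
  proof (rule Ck_on_SucI[OF assms(1) d])
    fix v
    have "Ck_on k S r" using Suc Ck_on_decr unfolding r_def by blast
    then show "Ck_on k S (\<lambda>x. dird v f x * (- (1/2) * (r x * r x * r x)))"
      using Suc.prems by (intro Ck_on_mult Ck_on_const assms(1)) (auto simp: Ck_on_Suc)
  qed
qed

lemma Ck_on_sin_cos:
  fixes f :: "'a::euclidean_space \<Rightarrow> real"
  assumes "open S" "Ck_on k S f"
  shows "Ck_on k S (\<lambda>x. sin (f x)) \<and> Ck_on k S (\<lambda>x. cos (f x))"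
  using assms(2)
proof (induction k)
  case 0
  then show ?case by (auto intro!: continuous_intros)
next
  case (Suc k)
  then have IH: "Ck_on k S (\<lambda>x. sin (f x))" "Ck_on k S (\<lambda>x. cos (f x))"
    using Ck_on_decr by blast+
  have d: "Ck_on k S (dird v f)" for v using Suc.prems by (simp add: Ck_on_Suc)
  have "Ck_on (Suc k) S (\<lambda>x. sin (f x))"
    by (rule Ck_on_SucI[where f' = "\<lambda>x v. dird v f x * cos (f x)"])
       (auto intro!: assms(1) Ck_on_mult IH d DERIV_compose_FDERIV[OF DERIV_sin Ck_on_has_derivative[OF Suc.prems]])
  moreover have "Ck_on (Suc k) S (\<lambda>x. cos (f x))"
  proof (rule Ck_on_SucI[OF assms(1) DERIV_compose_FDERIV[OF DERIV_cos Ck_on_has_derivative[OF Suc.prems]]])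
    show "Ck_on k S (\<lambda>x. dird v f x * - sin (f x))" for v
      using Ck_on_mult[OF assms(1) d[of v] Ck_on_mult[OF assms(1) Ck_on_const[OF assms(1), of _ "-1"] IH(1)]] by simp
  qed
  ultimately show ?case by blast
qed

named_theorems smooth_intros

lemma smooth_on_cong: "open S \<Longrightarrow> (\<And>x. x \<in> S \<Longrightarrow> f x = g x) \<Longrightarrow> smooth_on S f \<longleftrightarrow> smooth_on S g"
  unfolding smooth_on_def using Ck_on_cong by blast

lemma smooth_on_const [smooth_intros]: "open S \<Longrightarrow> smooth_on S (\<lambda>x. c)"
  by (simp add: smooth_on_def Ck_on_const)

lemma smooth_on_bounded_linear:
  "open S \<Longrightarrow> bounded_linear L \<Longrightarrow> smooth_on S f \<Longrightarrow> smooth_on S (\<lambda>x. L (f x))"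
  by (simp add: smooth_on_def Ck_on_bounded_linear)

lemma smooth_on_linear: "open S \<Longrightarrow> bounded_linear L \<Longrightarrow> smooth_on S L"
  using smooth_on_bounded_linear[of S L "\<lambda>x. x"] by (simp add: smooth_on_def Ck_on_ident)

lemma smooth_on_add [smooth_intros]:
  "open S \<Longrightarrow> smooth_on S f \<Longrightarrow> smooth_on S g \<Longrightarrow> smooth_on S (\<lambda>x. f x + g x)"
  by (simp add: smooth_on_def Ck_on_add)

lemma smooth_on_minus [smooth_intros]:
  "open S \<Longrightarrow> smooth_on S f \<Longrightarrow> smooth_on S (\<lambda>x. - f x)"
  by (rule smooth_on_bounded_linear[OF _ bounded_linear_minus[OF bounded_linear_ident]])

lemma smooth_on_diff [smooth_intros]:
  "open S \<Longrightarrow> smooth_on S f \<Longrightarrow> smooth_on S g \<Longrightarrow> smooth_on S (\<lambda>x. f x - g x)"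
  using smooth_on_add[of S f "\<lambda>x. - g x"] smooth_on_minus[of S g] by simp

lemma smooth_on_scaleR [smooth_intros]:
  "open S \<Longrightarrow> smooth_on S f \<Longrightarrow> smooth_on S (\<lambda>x. f x *\<^sub>R c)"
  by (rule smooth_on_bounded_linear[OF _ bounded_linear_scaleR_left])

lemma smooth_on_mult [smooth_intros]:
  fixes f g :: "'a::euclidean_space \<Rightarrow> real"
  shows "open S \<Longrightarrow> smooth_on S f \<Longrightarrow> smooth_on S g \<Longrightarrow> smooth_on S (\<lambda>x. f x * g x)"
  by (simp add: smooth_on_def Ck_on_mult)

lemma smooth_on_power [smooth_intros]:
  fixes f :: "'a::euclidean_space \<Rightarrow> real"
  shows "open S \<Longrightarrow> smooth_on S f \<Longrightarrow> smooth_on S (\<lambda>x. f x ^ n)"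
  by (induction n) (auto intro!: smooth_intros)

lemma smooth_on_inverse [smooth_intros]:
  fixes f :: "'a::euclidean_space \<Rightarrow> real"
  shows "open S \<Longrightarrow> smooth_on S f \<Longrightarrow> (\<And>x. x \<in> S \<Longrightarrow> f x \<noteq> 0) \<Longrightarrow> smooth_on S (\<lambda>x. inverse (f x))"
  by (simp add: smooth_on_def Ck_on_inverse)

lemma smooth_on_divide [smooth_intros]:
  fixes f g :: "'a::euclidean_space \<Rightarrow> real"
  shows "open S \<Longrightarrow> smooth_on S f \<Longrightarrow> smooth_on S g \<Longrightarrow> (\<And>x. x \<in> S \<Longrightarrow> g x \<noteq> 0) \<Longrightarrow>
    smooth_on S (\<lambda>x. f x / g x)"
  unfolding divide_inverse by (intro smooth_intros)

lemma smooth_on_inverse_sqrt [smooth_intros]: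
  fixes f :: "'a::euclidean_space \<Rightarrow> real"
  shows "open S \<Longrightarrow> smooth_on S f \<Longrightarrow> (\<And>x. x \<in> S \<Longrightarrow> f x > 0) \<Longrightarrow> smooth_on S (\<lambda>x. inverse (sqrt (f x)))"
  by (simp add: smooth_on_def Ck_on_inverse_sqrt)

lemma smooth_on_sin [smooth_intros]:
  fixes f :: "'a::euclidean_space \<Rightarrow> real"
  shows "open S \<Longrightarrow> smooth_on S f \<Longrightarrow> smooth_on S (\<lambda>x. sin (f x))"
  by (simp add: smooth_on_def Ck_on_sin_cos)

lemma smooth_on_cos [smooth_intros]:
  fixes f :: "'a::euclidean_space \<Rightarrow> real"
  shows "open S \<Longrightarrow> smooth_on S f \<Longrightarrow> smooth_on S (\<lambda>x. cos (f x))"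
  by (simp add: smooth_on_def Ck_on_sin_cos)

lemma smooth_on_dird [smooth_intros]: "smooth_on S f \<Longrightarrow> smooth_on S (dird v f)"
  unfolding smooth_on_def using Ck_on_Suc by blast

lemma smooth_on_sum [smooth_intros]:
  "open S \<Longrightarrow> (\<And>i. i \<in> I \<Longrightarrow> smooth_on S (f i)) \<Longrightarrow> smooth_on S (\<lambda>x. \<Sum>i\<in>I. f i x)"
proof (induction I rule: infinite_finite_induct)
  case (insert i F)
  then show ?case by (auto intro!: smooth_intros)
qed (auto intro: smooth_on_const)

lemma smooth_on_subset: "smooth_on S f \<Longrightarrow> T \<subseteq> S \<Longrightarrow> smooth_on T f"
proof -
  have "Ck_on k S f \<Longrightarrow> T \<subseteq> S \<Longrightarrow> Ck_on k T f" for k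
    by (induction k arbitrary: f) (auto simp: Ck_on_Suc intro: continuous_on_subset)
  then show "smooth_on S f \<Longrightarrow> T \<subseteq> S \<Longrightarrow> smooth_on T f" by (auto simp: smooth_on_def)
qed

lemma smooth_on_continuous: "smooth_on S f \<Longrightarrow> continuous_on S f"
  unfolding smooth_on_def by (metis Ck_on.simps(1))

lemma smooth_on_has_derivative:
  "smooth_on S f \<Longrightarrow> x \<in> S \<Longrightarrow> (f has_derivative (\<lambda>v. dird v f x)) (at x)"
  unfolding smooth_on_def using Ck_on_has_derivative by blast

lemma smooth_on_line_derivative:
  fixes f :: "'a::euclidean_space \<Rightarrow> real"
  assumes "smooth_on S f" "y + s *\<^sub>R v \<in> S"
  shows "((\<lambda>s. f (y + s *\<^sub>R v)) has_real_derivative dird v f (y + s *\<^sub>R v)) (at s)"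
proof -
  have "((\<lambda>s. y + s *\<^sub>R v) has_derivative (\<lambda>h. h *\<^sub>R v)) (at s)"
    by (auto intro!: derivative_eq_intros)
  from has_derivative_compose[OF this smooth_on_has_derivative[OF assms]]
  have *: "((\<lambda>s. f (y + s *\<^sub>R v)) has_derivative (\<lambda>h. dird (h *\<^sub>R v) f (y + s *\<^sub>R v))) (at s)" .
  have "linear (\<lambda>v. dird v f (y + s *\<^sub>R v0))" if "y + s *\<^sub>R v0 \<in> S" for v0
    using has_derivative_linear[OF smooth_on_has_derivative[OF assms(1) that]] .
  from linear_scale[OF this[OF assms(2)]] have "dird (h *\<^sub>R v) f (y + s *\<^sub>R v) = dird v f (y + s *\<^sub>R v) * h" for h
    by (simp add: mult.commute)
  then show ?thesis using * by (simp add: has_field_derivative_def)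
qed

text \<open>The mean value theorem is applied in direction \<open>v\<close> to the difference in direction \<open>w\<close>, and then
  in direction \<open>w\<close> to the derivative in direction \<open>v\<close>.\<close>
lemma second_difference:
  fixes f :: "'a::euclidean_space \<Rightarrow> real"
  assumes f: "smooth_on S f" and S: "ball y r \<subseteq> S" and h: "h > 0" "h * (norm v + norm w) < r"
  shows "\<exists>x. norm (x - y) \<le> h * (norm v + norm w) \<and>
    f (y + h *\<^sub>R v + h *\<^sub>R w) - f (y + h *\<^sub>R v) - f (y + h *\<^sub>R w) + f y = h\<^sup>2 * dird w (dird v f) x"
proof -
  have close: "norm (s *\<^sub>R v + t *\<^sub>R w) \<le> h * (norm v + norm w)"
    if "0 \<le> s" "s \<le> h" "0 \<le> t" "t \<le> h" for s t
  proof -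
    have "norm (s *\<^sub>R v + t *\<^sub>R w) \<le> s * norm v + t * norm w"
      using norm_triangle_ineq[of "s *\<^sub>R v" "t *\<^sub>R w"] that by simp
    also have "\<dots> \<le> h * norm v + h * norm w"
      using that by (intro add_mono mult_right_mono) auto
    finally show ?thesis by (simp add: algebra_simps)
  qed
  have inS: "y + s *\<^sub>R v + t *\<^sub>R w \<in> S" if "0 \<le> s" "s \<le> h" "0 \<le> t" "t \<le> h" for s t
  proof -
    have "dist y (y + c) = norm c" for c :: 'a
      unfolding dist_norm by simp
    from this[of "s *\<^sub>R v + t *\<^sub>R w"]
    have "dist y (y + s *\<^sub>R v + t *\<^sub>R w) = norm (s *\<^sub>R v + t *\<^sub>R w)" by (simp only: add.assoc)
    then have "y + s *\<^sub>R v + t *\<^sub>R w \<in> ball y r"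
      using close[OF that] h(2) unfolding mem_ball by linarith
    then show ?thesis using S by (rule subsetD[rotated])
  qed
  have inS': "y + s *\<^sub>R v \<in> S" if "0 \<le> s" "s \<le> h" for s
    using inS[OF that, of 0] h by simp
  define G where "G = (\<lambda>s. f (y + h *\<^sub>R w + s *\<^sub>R v) - f (y + s *\<^sub>R v))"
  have G: "(G has_real_derivative dird v f (y + h *\<^sub>R w + s *\<^sub>R v) - dird v f (y + s *\<^sub>R v)) (at s)"
    if "0 \<le> s" "s \<le> h" for s
    unfolding G_def using inS[OF that, of h] inS'[OF that] h
    by (intro DERIV_diff smooth_on_line_derivative[OF f]) (simp_all add: algebra_simps)
  obtain s where s: "0 < s" "s < h"
    "G h - G 0 = (h - 0) * (dird v f (y + h *\<^sub>R w + s *\<^sub>R v) - dird v f (y + s *\<^sub>R v))"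
    using MVT2[OF h(1) G] by blast
  have F: "((\<lambda>t. dird v f (y + s *\<^sub>R v + t *\<^sub>R w)) has_real_derivative
      dird w (dird v f) (y + s *\<^sub>R v + t *\<^sub>R w)) (at t)" if "0 \<le> t" "t \<le> h" for t
    using inS[of s t] s that by (intro smooth_on_line_derivative[OF smooth_on_dird[OF f]]) auto
  obtain t where t: "0 < t" "t < h"
    "dird v f (y + s *\<^sub>R v + h *\<^sub>R w) - dird v f (y + s *\<^sub>R v + 0 *\<^sub>R w) =
      (h - 0) * dird w (dird v f) (y + s *\<^sub>R v + t *\<^sub>R w)"
    using MVT2[OF h(1) F] by blast
  show ?thesis
  proof (intro exI conjI)
    show "norm (y + s *\<^sub>R v + t *\<^sub>R w - y) \<le> h * (norm v + norm w)"
      using close[of s t] s t by (simp add: add.assoc)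
    show "f (y + h *\<^sub>R v + h *\<^sub>R w) - f (y + h *\<^sub>R v) - f (y + h *\<^sub>R w) + f y =
        h\<^sup>2 * dird w (dird v f) (y + s *\<^sub>R v + t *\<^sub>R w)"
      using s(3) t(3) by (simp add: G_def power2_eq_square algebra_simps)
  qed
qed

text \<open>Schwarz' theorem: the second difference is symmetric in \<open>v\<close> and \<open>w\<close>, so both mixed derivatives
  take the same value at points arbitrarily close to \<open>y\<close>, and they are continuous.\<close>
lemma dird_commute:
  fixes f :: "'a::euclidean_space \<Rightarrow> real"
  assumes "open S" "smooth_on S f" "y \<in> S"
  shows "dird v (dird w f) y = dird w (dird v f) y"
proof -
  obtain r where r: "r > 0" "ball y r \<subseteq> S" using assms(1,3) open_contains_ball by blast
  have cont: "continuous_on S (dird v (dird w f))" "continuous_on S (dird w (dird v f))"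
    using assms(2) by (auto intro!: smooth_on_continuous smooth_on_dird)
  have small: "\<bar>dird v (dird w f) y - dird w (dird v f) y\<bar> < e" if "e > 0" for e
  proof -
    have ct: "\<exists>d>0. \<forall>x. dist x y < d \<longrightarrow> dist (p x) (p y) < e / 2" if "continuous_on S p"
      for p :: "'a \<Rightarrow> real"
    proof -
      have "isCont p y" using that assms(1,3) by (simp add: continuous_on_eq_continuous_at)
      then show ?thesis using half_gt_zero[OF \<open>e > 0\<close>] unfolding continuous_at_eps_delta by blast
    qed
    obtain d1 where d1: "d1 > 0" "\<And>x. dist x y < d1 \<Longrightarrow> dist (dird v (dird w f) x) (dird v (dird w f) y) < e/2"
      using ct[OF cont(1)] by blast
    obtain d2 where d2: "d2 > 0" "\<And>x. dist x y < d2 \<Longrightarrow> dist (dird w (dird v f) x) (dird w (dird v f) y) < e/2"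
      using ct[OF cont(2)] by blast
    define m where "m = min r (min d1 d2)"
    \<comment> \<open>the summand \<open>1\<close> avoids a vanishing denominator\<close>
    define h where "h = m / (2 * (norm v + norm w + 1))"
    have m: "m > 0" using r d1 d2 by (simp add: m_def)
    then have h: "h > 0" unfolding h_def by (intro divide_pos_pos) (auto intro: add_nonneg_pos)
    have "h * (norm v + norm w) \<le> h * (norm v + norm w + 1)" using h by simp
    also have "\<dots> = m / 2"
    proof -
      have "norm v + norm w + 1 \<noteq> 0" by (smt (verit) norm_ge_zero)
      then show ?thesis unfolding h_def by (simp add: divide_simps)
    qed
    also have "\<dots> < m" using m by simp
    finally have hm: "h * (norm v + norm w) < m" .
    obtain x1 where x1: "norm (x1 - y) \<le> h * (norm v + norm w)"
      "f (y + h *\<^sub>R v + h *\<^sub>R w) - f (y + h *\<^sub>R v) - f (y + h *\<^sub>R w) + f y = h\<^sup>2 * dird w (dird v f) x1"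
      using second_difference[OF assms(2) r(2) h] hm by (auto simp: m_def)
    obtain x2 where x2: "norm (x2 - y) \<le> h * (norm w + norm v)"
      "f (y + h *\<^sub>R w + h *\<^sub>R v) - f (y + h *\<^sub>R w) - f (y + h *\<^sub>R v) + f y = h\<^sup>2 * dird v (dird w f) x2"
      using second_difference[OF assms(2) r(2) h, of w v] hm by (auto simp: m_def add.commute)
    have "h\<^sup>2 * dird v (dird w f) x2 = h\<^sup>2 * dird w (dird v f) x1"
      unfolding x1(2)[symmetric] x2(2)[symmetric] by (simp add: add_ac)
    then have eq: "dird v (dird w f) x2 = dird w (dird v f) x1" using h by auto
    have "dist x1 y < d2" "dist x2 y < d1"
      using x1(1) x2(1) hm by (auto simp: dist_norm m_def add.commute)
    then show ?thesis using d1(2)[of x2] d2(2)[of x1] eq unfolding dist_real_def by linarith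
  qed
  show ?thesis
  proof (rule ccontr)
    assume "\<not> ?thesis"
    then show False using small[of "\<bar>dird v (dird w f) y - dird w (dird v f) y\<bar>"] by simp
  qed
qed

lemma dird_bounded_linear:
  assumes "bounded_linear L" "smooth_on S f" "y \<in> S"
  shows "dird v (\<lambda>x. L (f x)) y = L (dird v f y)"
  by (rule dirdI[OF bounded_linear.has_derivative[OF assms(1) smooth_on_has_derivative[OF assms(2,3)]]])

lemma dird_linear:
  assumes "smooth_on S f" "y \<in> S"
  shows "linear (\<lambda>v. dird v f y)"
  using has_derivative_linear[OF smooth_on_has_derivative[OF assms]] .

section \<open>Modulus and argument of a nonvanishing function\<close>

definition modsq :: "('a::euclidean_space \<Rightarrow> complex) \<Rightarrow> 'a \<Rightarrow> real" where
  "modsq \<zeta> = (\<lambda>y. (Re (\<zeta> y))\<^sup>2 + (Im (\<zeta> y))\<^sup>2)"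

text \<open>The derivative of an argument of \<open>\<zeta>\<close>, that is \<open>Im (D\<^sub>v \<zeta> / \<zeta>)\<close>. It does not depend on a branch of
  the argument, which need not exist globally.\<close>
definition arg_deriv :: "'a::euclidean_space \<Rightarrow> ('a \<Rightarrow> complex) \<Rightarrow> 'a \<Rightarrow> real" where
  "arg_deriv v \<zeta> = (\<lambda>y. (Re (\<zeta> y) * Im (dird v \<zeta> y) - Im (\<zeta> y) * Re (dird v \<zeta> y)) / modsq \<zeta> y)"

lemma modsq_pos: "\<zeta> y \<noteq> 0 \<Longrightarrow> modsq \<zeta> y > 0"
  by (auto simp: modsq_def complex_eq_iff sum_power2_gt_zero_iff)

lemma smooth_on_Re [smooth_intros]: "open S \<Longrightarrow> smooth_on S f \<Longrightarrow> smooth_on S (\<lambda>x. Re (f x))"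
  by (rule smooth_on_bounded_linear[OF _ bounded_linear_Re])

lemma smooth_on_Im [smooth_intros]: "open S \<Longrightarrow> smooth_on S f \<Longrightarrow> smooth_on S (\<lambda>x. Im (f x))"
  by (rule smooth_on_bounded_linear[OF _ bounded_linear_Im])

lemma smooth_on_modsq [smooth_intros]: "open S \<Longrightarrow> smooth_on S \<zeta> \<Longrightarrow> smooth_on S (modsq \<zeta>)"
  unfolding modsq_def by (intro smooth_intros)

lemma smooth_on_arg_deriv [smooth_intros]:
  assumes "open S" "smooth_on S \<zeta>" "\<And>y. y \<in> S \<Longrightarrow> \<zeta> y \<noteq> 0"
  shows "smooth_on S (arg_deriv v \<zeta>)"
proof -
  have "modsq \<zeta> y \<noteq> 0" if "y \<in> S" for y using modsq_pos[of \<zeta> y, OF assms(3)[OF that]] by simp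
  then show ?thesis unfolding arg_deriv_def using assms(1,2) by (intro smooth_intros) assumption+
qed

lemma dird_commute_complex:
  fixes \<zeta> :: "'a::euclidean_space \<Rightarrow> complex"
  assumes "open S" "smooth_on S \<zeta>" "y \<in> S"
  shows "dird v (dird w \<zeta>) y = dird w (dird v \<zeta>) y"
proof (rule complex_eqI)
  have *: "L (dird v (dird w \<zeta>) y) = L (dird w (dird v \<zeta>) y)"
    if L: "bounded_linear (L :: complex \<Rightarrow> real)" for L
  proof -
    have d: "L (dird v (dird w \<zeta>) y) = dird v (dird w (\<lambda>x. L (\<zeta> x))) y" for v w
    proof -
      have "dird v (dird w (\<lambda>x. L (\<zeta> x))) y = dird v (\<lambda>x. L (dird w \<zeta> x)) y"
        by (rule dird_cong[OF assms(1,3)]) (rule dird_bounded_linear[OF L assms(2)])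
      also have "\<dots> = L (dird v (dird w \<zeta>) y)"
        by (rule dird_bounded_linear[OF L smooth_on_dird[OF assms(2)] assms(3)])
      finally show ?thesis by simp
    qed
    show ?thesis unfolding d
      by (rule dird_commute[OF assms(1) smooth_on_bounded_linear[OF assms(1) L assms(2)] assms(3)])
  qed
  show "Re (dird v (dird w \<zeta>) y) = Re (dird w (dird v \<zeta>) y)" by (rule *[OF bounded_linear_Re])
  show "Im (dird v (dird w \<zeta>) y) = Im (dird w (dird v \<zeta>) y)" by (rule *[OF bounded_linear_Im])
qed

lemma dird_modsq:
  assumes "smooth_on S \<zeta>" "y \<in> S"
  shows "dird v (modsq \<zeta>) y = 2 * (Re (\<zeta> y) * Re (dird v \<zeta> y) + Im (\<zeta> y) * Im (dird v \<zeta> y))"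
  unfolding modsq_def
  by (rule dirdI, (rule derivative_eq_intros smooth_on_has_derivative[OF assms] refl)+) (simp add: algebra_simps)

text \<open>The logarithmic derivative of \<open>\<zeta>\<close> has half the logarithmic derivative of \<open>|\<zeta>|\<^sup>2\<close> as real part and
  the derivative of the argument as imaginary part.\<close>
lemma dird_polar:
  assumes "open S" "smooth_on S \<zeta>" "y \<in> S" "\<zeta> y \<noteq> 0"
  shows "dird v \<zeta> y = \<zeta> y * Complex (dird v (modsq \<zeta>) y / (2 * modsq \<zeta> y)) (arg_deriv v \<zeta> y)"
proof -
  define m where "m = modsq \<zeta> y"
  have m: "m = Re (\<zeta> y) * Re (\<zeta> y) + Im (\<zeta> y) * Im (\<zeta> y)" by (simp add: m_def modsq_def power2_eq_square)
  have m0: "m \<noteq> 0" using modsq_pos[of \<zeta> y, OF assms(4)] by (simp add: m_def)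
  have 1: "p = x * (2 * (x * p + y * q) / (2 * m)) - y * ((x * q - y * p) / m)"
    "q = x * ((x * q - y * p) / m) + y * (2 * (x * p + y * q) / (2 * m))"
    if "m = x * x + y * y" for x y p q :: real
  proof -
    have "x * (2 * (x * p + y * q) / (2 * m)) - y * ((x * q - y * p) / m) = p * (x * x + y * y) / m"
      "x * ((x * q - y * p) / m) + y * (2 * (x * p + y * q) / (2 * m)) = q * (x * x + y * y) / m"
      using m0 by (simp_all add: field_simps)
    then show "p = x * (2 * (x * p + y * q) / (2 * m)) - y * ((x * q - y * p) / m)"
      "q = x * ((x * q - y * p) / m) + y * (2 * (x * p + y * q) / (2 * m))"
      unfolding that[symmetric] using m0 by simp_all
  qed
  show ?thesis
    unfolding dird_modsq[OF assms(2,3)] arg_deriv_def m_def[symmetric]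
    using 1[OF m] by (intro complex_eqI) simp_all
qed

text \<open>Obtained by differentiating the identity of the previous lemma once more.\<close>
lemma dird_dird_polar:
  assumes "open S" "smooth_on S \<zeta>" "\<And>y. y \<in> S \<Longrightarrow> \<zeta> y \<noteq> 0" and y: "y \<in> S"
  defines "r \<equiv> \<lambda>v. dird v (modsq \<zeta>) y" and "m \<equiv> modsq \<zeta> y" and "\<alpha> \<equiv> \<lambda>v. arg_deriv v \<zeta> y"
  shows "dird v (dird w \<zeta>) y = \<zeta> y * Complex
    (dird v (dird w (modsq \<zeta>)) y / (2 * m) - r v * r w / (4 * m\<^sup>2) - \<alpha> v * \<alpha> w)
    (dird v (arg_deriv w \<zeta>) y + (r v * \<alpha> w + r w * \<alpha> v) / (2 * m))"
proof -
  define R where "R = dird w (modsq \<zeta>)"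
  define A where "A = arg_deriv w \<zeta>"
  have m: "m \<noteq> 0" using modsq_pos[of \<zeta> y, OF assms(3)[OF y]] by (simp add: m_def)
  have sm: "smooth_on S (modsq \<zeta>)" using assms by (intro smooth_intros)
  have "dird v (dird w \<zeta>) y = dird v (\<lambda>y. \<zeta> y * (of_real (R y / (2 * modsq \<zeta> y)) + \<i> * of_real (A y))) y"
  proof (rule dird_cong[OF assms(1) y])
    fix x assume "x \<in> S"
    then show "dird w \<zeta> x = \<zeta> x * (of_real (R x / (2 * modsq \<zeta> x)) + \<i> * of_real (A x))"
      by (subst dird_polar[OF assms(1,2) _ assms(3)]) (simp_all add: R_def A_def complex_eq_iff)
  qed
  also have "\<dots> = dird v \<zeta> y * (of_real (R y / (2 * m)) + \<i> * of_real (A y)) +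
     \<zeta> y * (of_real (dird v R y / (2 * m) - R y * r v / (2 * m\<^sup>2)) + \<i> * of_real (dird v A y))"
  proof (rule dirdI)
    have dR: "(R has_derivative (\<lambda>v. dird v R y)) (at y)"
      unfolding R_def by (rule smooth_on_has_derivative[OF smooth_on_dird[OF sm] y])
    have dA: "(A has_derivative (\<lambda>v. dird v A y)) (at y)"
      unfolding A_def using assms by (intro smooth_on_has_derivative[of S] smooth_intros)
    have dm: "(modsq \<zeta> has_derivative (\<lambda>v. dird v (modsq \<zeta>) y)) (at y)"
      by (rule smooth_on_has_derivative[OF sm y])
    have dG: "((\<lambda>y. R y / (2 * modsq \<zeta> y)) has_derivative
      (\<lambda>v. dird v R y / (2 * m) - R y * dird v (modsq \<zeta>) y / (2 * m\<^sup>2))) (at y)"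
    proof -
      have "(p * (2 * m) - R y * (2 * d)) / (2 * m * (2 * m)) = p / (2 * m) - R y * d / (2 * m\<^sup>2)" for p d
        using m by (simp add: field_simps power2_eq_square)
      moreover have "2 * modsq \<zeta> y \<noteq> 0" using m by (simp add: m_def)
      ultimately show ?thesis
        using has_derivative_divide'[OF dR has_derivative_mult_right[OF dm, of 2]] by (simp add: m_def[symmetric])
    qed
    show "((\<lambda>y. \<zeta> y * (of_real (R y / (2 * modsq \<zeta> y)) + \<i> * of_real (A y))) has_derivative
      (\<lambda>v. dird v \<zeta> y * (of_real (R y / (2 * m)) + \<i> * of_real (A y)) +
     \<zeta> y * (of_real (dird v R y / (2 * m) - R y * r v / (2 * m\<^sup>2)) + \<i> * of_real (dird v A y)))) (at y)"
      by (rule has_derivative_eq_rhs[OF has_derivative_mult[OF smooth_on_has_derivative[OF assms(2) y]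
            has_derivative_add[OF has_derivative_of_real[OF dG]
              has_derivative_mult_right[OF has_derivative_of_real[OF dA]]]]])
         (simp add: fun_eq_iff m_def r_def)
  qed
  also have "dird v \<zeta> y = \<zeta> y * Complex (r v / (2 * m)) (\<alpha> v)"
    unfolding r_def m_def \<alpha>_def using assms by (intro dird_polar) auto
  also have "R y = r w" by (simp add: R_def r_def)
  also have "A y = \<alpha> w" by (simp add: A_def \<alpha>_def)
  finally have *: "dird v (dird w \<zeta>) y = \<zeta> y * (Complex (r v / (2 * m)) (\<alpha> v) * Complex (r w / (2 * m)) (\<alpha> w) +
     Complex (dird v R y / (2 * m) - r w * r v / (2 * m\<^sup>2)) (dird v A y))"
    unfolding Complex_eq by (simp only: mult.assoc distrib_left[symmetric])
  show ?thesis
    unfolding * R_def[symmetric] A_def[symmetric] using m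
    by (intro arg_cong[where f = "\<lambda>u. \<zeta> y * u"] complex_eqI) (simp_all add: field_simps power2_eq_square)
qed

text \<open>The differential of the argument is closed; this is the imaginary part of the symmetry of the
  second derivatives of \<open>\<zeta>\<close>, divided by \<open>\<zeta>\<close>.\<close>
lemma arg_deriv_closed:
  assumes "open S" "smooth_on S \<zeta>" "\<And>y. y \<in> S \<Longrightarrow> \<zeta> y \<noteq> 0" "y \<in> S"
  shows "dird v (arg_deriv w \<zeta>) y = dird w (arg_deriv v \<zeta>) y"
proof -
  have "\<zeta> y \<noteq> 0" using assms by blast
  moreover note dird_dird_polar[OF assms(1,2,3,4), of v w] dird_dird_polar[OF assms(1,2,3,4), of w v]
    dird_commute_complex[OF assms(1,2,4), of v w]
  ultimately show ?thesis by (simp add: add.commute)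
qed

section \<open>The Willmore integrand in terms of two bilinear forms\<close>

text \<open>The metric \<open>d\<rho>\<^sup>2 / (4 q) + q \<psi>\<^sup>2 + T \<eta>\<^sup>2\<close> evaluated on two vectors with components \<open>(r, p, e)\<close> along
  \<open>d\<rho>\<close>, \<open>\<psi>\<close> and \<open>\<eta>\<close>. Throughout, \<open>T\<close> stands for \<open>\<tau>\<^sup>2\<close>.\<close>
definition metric_form :: "real \<Rightarrow> real \<Rightarrow> real \<Rightarrow> real \<Rightarrow> real \<Rightarrow> real \<Rightarrow> real \<Rightarrow> real \<Rightarrow> real" where
  "metric_form q T r1 p1 e1 r2 p2 e2 = r1 * r2 / (4 * q) + q * p1 * p2 + T * e1 * e2"

text \<open>The normal covector of a surface is a combination of \<open>d\<rho>\<close>, \<open>\<psi>\<close> and \<open>\<eta>\<close>. The second fundamental form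
  is correspondingly a combination of \<open>height_form\<close>, \<open>psi_form\<close> and the symmetrised derivative of \<open>\<eta>\<close>; see
  \<open>frame_second_form\<close>. Here \<open>q = \<rho> (1 - \<rho>)\<close>, \<open>s = 1 - 2 \<rho>\<close>, and the last argument is the second derivative of
  \<open>\<rho>\<close>, respectively the derivative of \<open>\<psi>\<close>.\<close>
definition height_form :: "real \<Rightarrow> real \<Rightarrow> real \<Rightarrow> real \<Rightarrow> real \<Rightarrow> real \<Rightarrow> real \<Rightarrow> real \<Rightarrow> real \<Rightarrow> real \<Rightarrow> real" where
  "height_form q s T r1 p1 e1 r2 p2 e2 r12 = r12 - r1 * r2 * s / (2 * q) - 2 * q * (T * (e1 * p2 + e2 * p1) + s * p1 * p2)"

definition psi_form :: "real \<Rightarrow> real \<Rightarrow> real \<Rightarrow> real \<Rightarrow> real \<Rightarrow> real \<Rightarrow> real \<Rightarrow> real \<Rightarrow> real \<Rightarrow> real \<Rightarrow> real" where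
  "psi_form q s T r1 p1 e1 r2 p2 e2 p12 = p12 + (T * (r1 * e2 + r2 * e1) + s * (r1 * p2 + r2 * p1)) / (2 * q)"

text \<open>The unit normal covector is a multiple of the cross product \<open>c\<close> of the two coordinate vectors, so
  the second fundamental form is a multiple of a form \<open>K\<close> that is polynomial in \<open>c\<close>. In terms of
  the Gram matrix \<open>G\<close> and of \<open>K\<close> the Willmore integrand is the following expression, which is even
  in \<open>K\<close> and hence blind to the choice of the normal; see \<open>form_density_normal\<close>.\<close>
definition form_density :: "real \<Rightarrow> real \<Rightarrow> real \<Rightarrow> real \<Rightarrow> real \<Rightarrow> real \<Rightarrow> real \<Rightarrow> real" where
  "form_density T G11 G12 G22 K11 K12 K22 = T / 4 * ((G22 * K11 + G11 * K22 - 2 * G12 * K12)\<^sup>2 / 2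
     - 2 * (G11 * G22 - G12\<^sup>2) * (K11 * K22 - K12\<^sup>2)) * (inverse (sqrt (G11 * G22 - G12\<^sup>2))) ^ 5"

definition jet_density :: "real \<Rightarrow> real \<Rightarrow> real \<Rightarrow> real \<Rightarrow> real \<Rightarrow> real \<Rightarrow> real \<Rightarrow> real \<Rightarrow>
    real \<Rightarrow> real \<Rightarrow> real \<Rightarrow> real \<Rightarrow> real \<Rightarrow> real \<Rightarrow> real \<Rightarrow> real \<Rightarrow> real \<Rightarrow> real" where
  "jet_density T \<rho> r1 r2 p1 p2 e1 e2 r11 r12 r22 p11 p12 p22 e11 e12 e22 =
    (let q = \<rho> * (1 - \<rho>); s = 1 - 2 * \<rho>;
       c1 = p1 * e2 - e1 * p2; c2 = e1 * r2 - r1 * e2; c3 = r1 * p2 - p1 * r2 in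
     form_density T (metric_form q T r1 p1 e1 r1 p1 e1) (metric_form q T r1 p1 e1 r2 p2 e2) (metric_form q T r2 p2 e2 r2 p2 e2)
       (c1 * height_form q s T r1 p1 e1 r1 p1 e1 r11 + c2 * psi_form q s T r1 p1 e1 r1 p1 e1 p11 + c3 * e11)
       (c1 * height_form q s T r1 p1 e1 r2 p2 e2 r12 + c2 * psi_form q s T r1 p1 e1 r2 p2 e2 p12 + c3 * e12)
       (c1 * height_form q s T r2 p2 e2 r2 p2 e2 r22 + c2 * psi_form q s T r2 p2 e2 r2 p2 e2 p22 + c3 * e22))"

lemma matrix_inv_2:
  fixes A :: "real^2^2"
  assumes "det A \<noteq> 0"
  shows "matrix_inv A = (\<chi> i j. (if i = 1 then (if j = 1 then A$2$2 else - A$1$2)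
    else (if j = 1 then - A$2$1 else A$1$1)) / det A)"
proof -
  define B :: "real^2^2" where "B = (\<chi> i j. (if i = 1 then (if j = 1 then A$2$2 else - A$1$2)
    else (if j = 1 then - A$2$1 else A$1$1)) / det A)"
  have d: "A$1$1 * A$2$2 - A$1$2 * A$2$1 = det A" by (simp add: det_2)
  have "A ** B = mat 1"
    unfolding vec_eq_iff forall_2 using assms d
    by (simp add: B_def matrix_matrix_mult_def mat_def sum_2 add_divide_distrib[symmetric] diff_divide_distrib[symmetric] mult.commute)
  then have inv: "invertible A" and AB: "A ** B = mat 1"
    using invertible_right_inverse by blast+
  from inv have "A ** matrix_inv A = mat 1 \<and> matrix_inv A ** A = mat 1"
    unfolding matrix_inv_def invertible_def by (rule someI_ex)
  then have "matrix_inv A = B"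
    by (metis AB matrix_mul_assoc matrix_mul_lid matrix_mul_rid)
  then show ?thesis by (simp add: B_def)
qed

text \<open>The endomorphism \<open>G\<^sup>-\<^sup>1 B - H / 2\<close> is traceless, so its square has trace \<open>H\<^sup>2 / 2 - 2 det B / det G\<close>.\<close>
lemma traceless_norm_algebra:
  fixes G B :: "real^2^2"
  assumes G: "G$2$1 = G$1$2" and B: "B$2$1 = B$1$2" and D: "det G > 0"
  shows "form_norm_sq G (B - (trace (matrix_inv G ** B) / 2) *\<^sub>R G) * sqrt (det G) =
    ((G$2$2 * B$1$1 + G$1$1 * B$2$2 - 2 * G$1$2 * B$1$2)\<^sup>2 / 2
      - 2 * det G * (B$1$1 * B$2$2 - (B$1$2)\<^sup>2)) * (inverse (sqrt (det G))) ^ 3"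
proof -
  define d where "d = det G"
  define P where "P = G$2$2 * B$1$1 + G$1$1 * B$2$2 - 2 * G$1$2 * B$1$2"
  define h where "h = trace (matrix_inv G ** B) / 2"
  have d0: "d > 0" "d \<noteq> 0" using D by (simp_all add: d_def)
  have d: "d = G$1$1 * G$2$2 - (G$1$2)\<^sup>2" using G by (simp add: d_def det_2 power2_eq_square)
  note inv = matrix_inv_2[OF d0(2)[unfolded d_def], folded d_def]
  have "trace (matrix_inv G ** B) = P / d"
    unfolding inv trace_def matrix_matrix_mult_def sum_2 P_def using d0 G B
    by (simp add: field_simps)
  then have h: "2 * h * d = P" using d0 by (simp add: h_def)
  define C where "C = B - h *\<^sub>R G"
  have C: "C$2$1 = C$1$2" using G B by (simp add: C_def)
  have Ce: "C$1$1 = B$1$1 - h * G$1$1" "C$1$2 = B$1$2 - h * G$1$2" "C$2$2 = B$2$2 - h * G$2$2"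
    by (simp_all add: C_def)
  have num: "((G$2$2 * C$1$1 - G$1$2 * C$1$2)\<^sup>2 + 2 * (G$2$2 * C$1$2 - G$1$2 * C$2$2) * (G$1$1 * C$1$2 - G$1$2 * C$1$1)
      + (G$1$1 * C$2$2 - G$1$2 * C$1$2)\<^sup>2) = P\<^sup>2 / 2 - 2 * d * (B$1$1 * B$2$2 - (B$1$2)\<^sup>2)"
  proof -
    define X where "X = G$2$2 * B$1$1 - G$1$2 * B$1$2"
    define Y where "Y = G$1$1 * B$2$2 - G$1$2 * B$1$2"
    have 1: "G$2$2 * C$1$1 - G$1$2 * C$1$2 = X - h * d" "G$1$1 * C$2$2 - G$1$2 * C$1$2 = Y - h * d"
      unfolding Ce X_def Y_def d by algebra+
    have 2: "G$2$2 * C$1$2 - G$1$2 * C$2$2 = G$2$2 * B$1$2 - G$1$2 * B$2$2"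
      "G$1$1 * C$1$2 - G$1$2 * C$1$1 = G$1$1 * B$1$2 - G$1$2 * B$1$1"
      unfolding Ce by algebra+
    have 3: "P = X + Y" by (simp add: P_def X_def Y_def)
    have 4: "h * d = P / 2" using h by simp
    have 5: "X * Y - (G$2$2 * B$1$2 - G$1$2 * B$2$2) * (G$1$1 * B$1$2 - G$1$2 * B$1$1) =
      d * (B$1$1 * B$2$2 - (B$1$2)\<^sup>2)"
      unfolding X_def Y_def d by algebra
    have "(X - P/2)\<^sup>2 + (Y - P/2)\<^sup>2 = P\<^sup>2 / 2 - 2 * (X * Y)"
      unfolding 3 by (simp add: power2_eq_square field_simps)
    then show ?thesis unfolding 1 2 4 using 5 by (simp add: algebra_simps)
  qed
  have "form_norm_sq G C = ((G$2$2 * C$1$1 - G$1$2 * C$1$2)\<^sup>2 + 2 * (G$2$2 * C$1$2 - G$1$2 * C$2$2) * (G$1$1 * C$1$2 - G$1$2 * C$1$1)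
      + (G$1$1 * C$2$2 - G$1$2 * C$1$2)\<^sup>2) / d\<^sup>2"
  proof -
    define M where "M = matrix_inv G ** C"
    have M: "M$1$1 = (G$2$2 * C$1$1 - G$1$2 * C$1$2) / d" "M$1$2 = (G$2$2 * C$1$2 - G$1$2 * C$2$2) / d"
      "M$2$1 = (G$1$1 * C$1$2 - G$1$2 * C$1$1) / d" "M$2$2 = (G$1$1 * C$2$2 - G$1$2 * C$1$2) / d"
      unfolding M_def inv matrix_matrix_mult_def sum_2 using d0 G C by (simp_all add: field_simps)
    have "transpose C = C" using C by (simp add: vec_eq_iff forall_2 transpose_def)
    then have "form_norm_sq G C = trace (M ** M)"
      by (simp add: form_norm_sq_def M_def matrix_mul_assoc)
    also have "\<dots> = (M$1$1)\<^sup>2 + 2 * M$1$2 * M$2$1 + (M$2$2)\<^sup>2"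
      by (simp add: trace_def matrix_matrix_mult_def sum_2 power2_eq_square)
    finally show ?thesis unfolding M by (simp add: power_divide add_divide_distrib power2_eq_square)
  qed
  then have fn: "form_norm_sq G C = (P\<^sup>2 / 2 - 2 * d * (B$1$1 * B$2$2 - (B$1$2)\<^sup>2)) / d\<^sup>2"
    unfolding num .
  have "sqrt d / d\<^sup>2 = (inverse (sqrt d)) ^ 3"
  proof -
    define t where "t = sqrt d"
    have "t > 0" "d = t\<^sup>2" using d0 by (simp_all add: t_def)
    then show ?thesis unfolding t_def[symmetric] by (simp add: field_simps power2_eq_square power3_eq_cube)
  qed
  moreover have "form_norm_sq G C * sqrt d = (P\<^sup>2 / 2 - 2 * d * (B$1$1 * B$2$2 - (B$1$2)\<^sup>2)) * (sqrt d / d\<^sup>2)"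
    unfolding fn by simp
  ultimately have "form_norm_sq G C * sqrt d = (P\<^sup>2 / 2 - 2 * d * (B$1$1 * B$2$2 - (B$1$2)\<^sup>2)) * (inverse (sqrt d)) ^ 3"
    by (simp only:)
  then show ?thesis unfolding C_def h_def P_def d_def .
qed

lemma normal_parallel:
  fixes m1 m2 m3 r1 p1 e1 r2 p2 e2 :: real
  defines "c1 \<equiv> p1 * e2 - e1 * p2" and "c2 \<equiv> e1 * r2 - r1 * e2" and "c3 \<equiv> r1 * p2 - p1 * r2"
  assumes o: "m1 * r1 + m2 * p1 + m3 * e1 = 0" "m1 * r2 + m2 * p2 + m3 * e2 = 0"
    and c: "c1 \<noteq> 0 \<or> c2 \<noteq> 0 \<or> c3 \<noteq> 0"
  shows "\<exists>\<mu>. m1 = \<mu> * c1 \<and> m2 = \<mu> * c2 \<and> m3 = \<mu> * c3"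
proof -
  have "m1 * c2 - m2 * c1 = e1 * (m1 * r2 + m2 * p2 + m3 * e2) - e2 * (m1 * r1 + m2 * p1 + m3 * e1)"
    "m2 * c3 - m3 * c2 = r1 * (m1 * r2 + m2 * p2 + m3 * e2) - r2 * (m1 * r1 + m2 * p1 + m3 * e1)"
    "m1 * c3 - m3 * c1 = p2 * (m1 * r1 + m2 * p1 + m3 * e1) - p1 * (m1 * r2 + m2 * p2 + m3 * e2)"
    unfolding c1_def c2_def c3_def by (simp_all add: algebra_simps)
  then have x: "m1 * c2 = m2 * c1" "m2 * c3 = m3 * c2" "m1 * c3 = m3 * c1"
    unfolding o by simp_all
  have "0 \<le> c1\<^sup>2" "0 \<le> c2\<^sup>2" "0 \<le> c3\<^sup>2" by simp_all
  moreover have "c1\<^sup>2 \<noteq> 0 \<or> c2\<^sup>2 \<noteq> 0 \<or> c3\<^sup>2 \<noteq> 0" using c by simp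
  ultimately have n: "c1\<^sup>2 + c2\<^sup>2 + c3\<^sup>2 > 0" by linarith
  define \<mu> where "\<mu> = (m1 * c1 + m2 * c2 + m3 * c3) / (c1\<^sup>2 + c2\<^sup>2 + c3\<^sup>2)"
  have "(m1 * c1 + m2 * c2 + m3 * c3) * c1 - m1 * (c1\<^sup>2 + c2\<^sup>2 + c3\<^sup>2) = c2 * (m2 * c1 - m1 * c2) + c3 * (m3 * c1 - m1 * c3)"
    "(m1 * c1 + m2 * c2 + m3 * c3) * c2 - m2 * (c1\<^sup>2 + c2\<^sup>2 + c3\<^sup>2) = c1 * (m1 * c2 - m2 * c1) + c3 * (m3 * c2 - m2 * c3)"
    "(m1 * c1 + m2 * c2 + m3 * c3) * c3 - m3 * (c1\<^sup>2 + c2\<^sup>2 + c3\<^sup>2) = c1 * (m1 * c3 - m3 * c1) + c2 * (m2 * c3 - m3 * c2)"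
    by (simp_all add: power2_eq_square algebra_simps)
  then have "(m1 * c1 + m2 * c2 + m3 * c3) * c1 = m1 * (c1\<^sup>2 + c2\<^sup>2 + c3\<^sup>2)"
    "(m1 * c1 + m2 * c2 + m3 * c3) * c2 = m2 * (c1\<^sup>2 + c2\<^sup>2 + c3\<^sup>2)"
    "(m1 * c1 + m2 * c2 + m3 * c3) * c3 = m3 * (c1\<^sup>2 + c2\<^sup>2 + c3\<^sup>2)"
    unfolding x by simp_all
  then have "m1 = \<mu> * c1 \<and> m2 = \<mu> * c2 \<and> m3 = \<mu> * c3"
    using n by (simp add: \<mu>_def)
  then show ?thesis by blast
qed

text \<open>The covector \<open>m\<close> annihilates both coordinate vectors, hence is \<open>\<mu> c\<close>; its length gives
  \<open>\<mu>\<^sup>2 = T / (4 det G)\<close>, and \<open>\<mu>\<close> enters the integrand quadratically.\<close>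
lemma form_density_normal:
  assumes q: "q > 0" and T: "T > 0"
    and o: "m1 * r1 + m2 * p1 + m3 * e1 = 0" "m1 * r2 + m2 * p2 + m3 * e2 = 0"
    and u: "4 * q * m1\<^sup>2 + m2\<^sup>2 / q + m3\<^sup>2 / T = 1"
    and G: "G11 = metric_form q T r1 p1 e1 r1 p1 e1" "G12 = metric_form q T r1 p1 e1 r2 p2 e2" "G22 = metric_form q T r2 p2 e2 r2 p2 e2"
    and D: "G11 * G22 - G12\<^sup>2 > 0"
    and c: "c1 = p1 * e2 - e1 * p2" "c2 = e1 * r2 - r1 * e2" "c3 = r1 * p2 - p1 * r2"
    and h: "h11 = - (m1 * A11 + m2 * B11 + m3 * E11)" "h12 = - (m1 * A12 + m2 * B12 + m3 * E12)"
      "h22 = - (m1 * A22 + m2 * B22 + m3 * E22)"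
  shows "((G22 * h11 + G11 * h22 - 2 * G12 * h12)\<^sup>2 / 2 - 2 * (G11 * G22 - G12\<^sup>2) * (h11 * h22 - h12\<^sup>2))
      * (inverse (sqrt (G11 * G22 - G12\<^sup>2))) ^ 3 =
    form_density T G11 G12 G22 (c1 * A11 + c2 * B11 + c3 * E11) (c1 * A12 + c2 * B12 + c3 * E12)
      (c1 * A22 + c2 * B22 + c3 * E22)"
proof -
  define d where "d = G11 * G22 - G12\<^sup>2"
  have d0: "d > 0" using D by (simp add: d_def)
  have d: "d = T * (q * c1\<^sup>2 + c2\<^sup>2 / (4 * q)) + c3\<^sup>2 / 4"
    unfolding d_def G metric_form_def c using q by (simp add: field_simps power2_eq_square)
  have "c1 \<noteq> 0 \<or> c2 \<noteq> 0 \<or> c3 \<noteq> 0" using d0 d by auto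
  then obtain \<mu> where \<mu>: "m1 = \<mu> * c1" "m2 = \<mu> * c2" "m3 = \<mu> * c3"
    using normal_parallel[OF o] unfolding c by blast
  have "4 * d * \<mu>\<^sup>2 = T * (4 * q * m1\<^sup>2 + m2\<^sup>2 / q + m3\<^sup>2 / T)"
    unfolding d \<mu> using q T by (simp add: field_simps power2_eq_square)
  then have "4 * d * \<mu>\<^sup>2 = T" unfolding u by simp
  then have mu: "\<mu>\<^sup>2 = T / (4 * d)" using d0 by (simp add: field_simps)
  define K11 where "K11 = c1 * A11 + c2 * B11 + c3 * E11"
  define K12 where "K12 = c1 * A12 + c2 * B12 + c3 * E12"
  define K22 where "K22 = c1 * A22 + c2 * B22 + c3 * E22"
  have hK: "h11 = - \<mu> * K11" "h12 = - \<mu> * K12" "h22 = - \<mu> * K22"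
    unfolding h \<mu> K11_def K12_def K22_def by algebra+
  define W where "W = (G22 * K11 + G11 * K22 - 2 * G12 * K12)\<^sup>2 / 2 - 2 * d * (K11 * K22 - K12\<^sup>2)"
  have "(G22 * h11 + G11 * h22 - 2 * G12 * h12)\<^sup>2 / 2 - 2 * d * (h11 * h22 - h12\<^sup>2) = \<mu>\<^sup>2 * W"
    unfolding hK W_def by (simp add: power2_eq_square algebra_simps)
  also have "\<dots> = T / 4 * W * inverse d" unfolding mu by (simp add: field_simps)
  finally have 1: "(G22 * h11 + G11 * h22 - 2 * G12 * h12)\<^sup>2 / 2 - 2 * d * (h11 * h22 - h12\<^sup>2) =
    T / 4 * W * inverse d" .
  have 2: "inverse d * inverse (sqrt d) ^ 3 = inverse (sqrt d) ^ 5"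
  proof -
    have "inverse d = inverse (sqrt d) ^ 2" using d0 by (simp add: power_inverse)
    then show ?thesis by (simp add: power_add[symmetric])
  qed
  have "((G22 * h11 + G11 * h22 - 2 * G12 * h12)\<^sup>2 / 2 - 2 * d * (h11 * h22 - h12\<^sup>2)) * inverse (sqrt d) ^ 3
      = T / 4 * W * inverse (sqrt d) ^ 5"
    unfolding 1 2[symmetric] by (simp only: mult.assoc)
  then show ?thesis
    by (simp only: form_density_def K11_def[symmetric] K12_def[symmetric] K22_def[symmetric] d_def[symmetric] W_def)
qed

text \<open>Needed to replace the coordinate directions by a basis that contains the Hopf direction.\<close>
lemma form_density_invariant:
  assumes "a * d - b * c = 1"
  shows "form_density T (a\<^sup>2 * G11 + 2 * a * b * G12 + b\<^sup>2 * G22) (a * c * G11 + (a * d + b * c) * G12 + b * d * G22)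
      (c\<^sup>2 * G11 + 2 * c * d * G12 + d\<^sup>2 * G22)
      (a\<^sup>2 * K11 + 2 * a * b * K12 + b\<^sup>2 * K22) (a * c * K11 + (a * d + b * c) * K12 + b * d * K22)
      (c\<^sup>2 * K11 + 2 * c * d * K12 + d\<^sup>2 * K22) = form_density T G11 G12 G22 K11 K12 K22"
proof -
  have q: "(a\<^sup>2 * x + 2 * a * b * y + b\<^sup>2 * z) * (c\<^sup>2 * x + 2 * c * d * y + d\<^sup>2 * z)
      - (a * c * x + (a * d + b * c) * y + b * d * z)\<^sup>2 = x * z - y\<^sup>2" for x y z
  proof -
    have "(a\<^sup>2 * x + 2 * a * b * y + b\<^sup>2 * z) * (c\<^sup>2 * x + 2 * c * d * y + d\<^sup>2 * z)
      - (a * c * x + (a * d + b * c) * y + b * d * z)\<^sup>2 = (a * d - b * c)\<^sup>2 * (x * z - y\<^sup>2)" by algebra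
    then show ?thesis using assms by simp
  qed
  have p: "(c\<^sup>2 * G11 + 2 * c * d * G12 + d\<^sup>2 * G22) * (a\<^sup>2 * K11 + 2 * a * b * K12 + b\<^sup>2 * K22)
    + (a\<^sup>2 * G11 + 2 * a * b * G12 + b\<^sup>2 * G22) * (c\<^sup>2 * K11 + 2 * c * d * K12 + d\<^sup>2 * K22)
    - 2 * (a * c * G11 + (a * d + b * c) * G12 + b * d * G22) * (a * c * K11 + (a * d + b * c) * K12 + b * d * K22)
    = G22 * K11 + G11 * K22 - 2 * G12 * K12"
  proof -
    have "(c\<^sup>2 * G11 + 2 * c * d * G12 + d\<^sup>2 * G22) * (a\<^sup>2 * K11 + 2 * a * b * K12 + b\<^sup>2 * K22)
    + (a\<^sup>2 * G11 + 2 * a * b * G12 + b\<^sup>2 * G22) * (c\<^sup>2 * K11 + 2 * c * d * K12 + d\<^sup>2 * K22)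
    - 2 * (a * c * G11 + (a * d + b * c) * G12 + b * d * G22) * (a * c * K11 + (a * d + b * c) * K12 + b * d * K22)
    = (a * d - b * c)\<^sup>2 * (G22 * K11 + G11 * K22 - 2 * G12 * K12)" by algebra
    then show ?thesis using assms by simp
  qed
  show ?thesis unfolding form_density_def q p ..
qed

section \<open>Surfaces in the Berger sphere in polar coordinates\<close>

lemma pd_eq_dird: "pd i F = dird (coord_dir i) F"
  by (simp add: pd_def dird_def fun_eq_iff)

lemma bounded_linear_hopf_field: "bounded_linear hopf_field"
  unfolding hopf_field_def
  by (intro bounded_linear_Pair bounded_linear_const_mult bounded_linear_fst bounded_linear_snd)

lemma berger_metric_has_derivative:
  assumes X: "(X has_derivative X') (at x)" and A: "(A has_derivative A') (at x)"
    and B: "(B has_derivative B') (at x)"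
  shows "((\<lambda>y. berger_metric \<tau> (X y) (A y) (B y)) has_derivative
    (\<lambda>v. berger_metric \<tau> (X x) (A' v) (B x) + berger_metric \<tau> (X x) (A x) (B' v)
      + berger_metric_deriv \<tau> (X x) (X' v) (A x) (B x))) (at x)"
proof -
  have hX: "((\<lambda>y. hopf_field (X y)) has_derivative (\<lambda>v. hopf_field (X' v))) (at x)"
    by (rule bounded_linear.has_derivative[OF bounded_linear_hopf_field X])
  show ?thesis
    unfolding berger_metric_def berger_metric_deriv_eq
    by (rule has_derivative_eq_rhs[OF has_derivative_add[OF has_derivative_inner[OF A B]
          has_derivative_mult[OF has_derivative_mult_right[OF has_derivative_inner[OF A hX]]
            has_derivative_inner[OF B hX]]]])
      (simp add: fun_eq_iff algebra_simps)
qed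

lemma S3_inner: "p \<in> S3 \<longleftrightarrow> p \<bullet> p = 1"
  by (cases p) (auto simp: S3_def inner_prod_def dot_square_norm)

lemma dird_tangent:
  assumes "smooth_on UNIV X" "\<And>x. X x \<in> S3"
  shows "dird v X x \<in> tangent_S3 (X x)"
proof -
  have d: "(X has_derivative (\<lambda>v. dird v X x)) (at x)"
    using smooth_on_has_derivative[OF assms(1)] by simp
  have "((\<lambda>y. X y \<bullet> X y) has_derivative (\<lambda>v. 0)) (at x)"
    using assms(2) by (simp add: S3_inner)
  from has_derivative_unique[OF this has_derivative_inner[OF d d]]
  have "0 = X x \<bullet> dird v X x + dird v X x \<bullet> X x" by meson
  then show ?thesis by (simp add: tangent_S3_def inner_commute)
qed

text \<open>In the Koszul formula the derivative of the normal is eliminated by differentiating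
  \<open>g(N, X\<^sub>j) = 0\<close>; of the derivatives of the metric only two terms survive, since \<open>X \<bullet> hopf_field Y\<close> is
  antisymmetric.\<close>
lemma second_form_eq:
  assumes \<tau>: "\<tau> > 0" and X: "smooth_on UNIV X" "\<And>x. X x \<in> S3" and N: "unit_normal \<tau> X N"
  shows "second_form \<tau> X N x $ i $ j =
    - berger_metric \<tau> (X x) (N x) (pd i (pd j X) x)
    - (\<tau>\<^sup>2 - 1) * ((N x \<bullet> hopf_field (pd i X x)) * (pd j X x \<bullet> hopf_field (X x))
        + (N x \<bullet> hopf_field (pd j X x)) * (pd i X x \<bullet> hopf_field (X x)))"
proof -
  define p n Xi Xj Ni Xij where "p = X x" and "n = N x" and "Xi = pd i X x" and "Xj = pd j X x"
    and "Ni = pd i N x" and "Xij = pd i (pd j X) x"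
  have dX: "(X has_derivative (\<lambda>v. dird v X x)) (at x)"
    using smooth_on_has_derivative[OF X(1)] by simp
  have dN: "(N has_derivative (\<lambda>v. dird v N x)) (at x)"
    using smooth_on_has_derivative[of UNIV N] N by (simp add: unit_normal_def)
  have dXj: "(pd j X has_derivative (\<lambda>v. dird v (pd j X) x)) (at x)"
    unfolding pd_eq_dird using smooth_on_has_derivative[OF smooth_on_dird[OF X(1)]] by simp
  have "berger_metric \<tau> (X y) (N y) (pd j X y) = 0" for y
    using N unfolding unit_normal_def by blast
  then have "((\<lambda>y. berger_metric \<tau> (X y) (N y) (pd j X y)) has_derivative (\<lambda>v. 0)) (at x)"
    by simp
  from has_derivative_unique[OF this berger_metric_has_derivative[OF dX dN dXj]]
  have "0 = berger_metric \<tau> (X x) (dird v N x) (pd j X x) + berger_metric \<tau> (X x) (N x) (dird v (pd j X) x)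
      + berger_metric_deriv \<tau> (X x) (dird v X x) (N x) (pd j X x)" for v by meson
  from this[of "coord_dir i"]
  have 0: "0 = berger_metric \<tau> p Ni Xj + berger_metric \<tau> p n Xij + berger_metric_deriv \<tau> p Xi n Xj"
    by (simp add: p_def n_def Xi_def Xj_def Ni_def Xij_def pd_eq_dird)
  have tj: "Xj \<in> tangent_S3 p" unfolding Xj_def p_def pd_eq_dird by (rule dird_tangent[OF X])
  have pS: "p \<in> S3" by (simp add: p_def X)
  have "second_form \<tau> X N x $ i $ j = berger_metric \<tau> p (levi_civita \<tau> p Xi n Ni) Xj"
    by (simp add: second_form_def p_def Xi_def Xj_def n_def Ni_def)
  also have "\<dots> = berger_metric \<tau> p Ni Xj +
       (berger_metric_deriv \<tau> p Xi n Xj + berger_metric_deriv \<tau> p n Xi Xj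
         - berger_metric_deriv \<tau> p Xj Xi n) / 2"
    by (rule levi_civita_koszul[OF \<tau> pS tj])
  also have "\<dots> = - berger_metric \<tau> p n Xij +
       (- berger_metric_deriv \<tau> p Xi n Xj + berger_metric_deriv \<tau> p n Xi Xj
         - berger_metric_deriv \<tau> p Xj Xi n) / 2"
    using 0 by (simp add: field_simps)
  also have "\<dots> = - berger_metric \<tau> p n Xij
     - (\<tau>\<^sup>2 - 1) * ((n \<bullet> hopf_field Xi) * (Xj \<bullet> hopf_field p) + (n \<bullet> hopf_field Xj) * (Xi \<bullet> hopf_field p))"
  proof -
    have "Xi \<bullet> hopf_field n = - (n \<bullet> hopf_field Xi)" "Xj \<bullet> hopf_field n = - (n \<bullet> hopf_field Xj)"
      "Xj \<bullet> hopf_field Xi = - (Xi \<bullet> hopf_field Xj)"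
      using inner_hopf_field inner_commute by metis+
    then show ?thesis unfolding berger_metric_deriv_eq by (simp add: field_simps)
  qed
  finally show ?thesis by (simp add: p_def n_def Xi_def Xj_def Xij_def)
qed

text \<open>The tangent vector at \<open>(z, w)\<close> on which \<open>d\<rho>\<close>, \<open>d\<phi>\<close> and \<open>d\<theta>\<close> take the values \<open>r\<close>, \<open>f\<close> and \<open>g\<close>.\<close>
definition polar_frame :: "real \<Rightarrow> complex \<Rightarrow> complex \<Rightarrow> real \<Rightarrow> real \<Rightarrow> real \<Rightarrow> C2" where
  "polar_frame \<rho> z w r f g = (z * Complex (r / (2 * \<rho>)) f, w * Complex (- r / (2 * (1 - \<rho>))) g)"

lemma inner_polar: "inner (z * Complex a b) (z * Complex a' b') = ((Re z)\<^sup>2 + (Im z)\<^sup>2) * (a * a' + b * b')"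
  by (simp add: inner_complex_def power2_eq_square algebra_simps)

lemma inner_polar_i: "inner (z * Complex a b) (\<i> * (z * Complex a' b')) = ((Re z)\<^sup>2 + (Im z)\<^sup>2) * (b * a' - a * b')"
  by (simp add: inner_complex_def power2_eq_square algebra_simps)

lemma inner_polar_1: "inner (z * Complex a b) (\<i> * z) = ((Re z)\<^sup>2 + (Im z)\<^sup>2) * b"
  by (simp add: inner_complex_def power2_eq_square algebra_simps)

lemma frame_inner:
  assumes "\<rho> > 0" "\<rho> < 1" "(Re z)\<^sup>2 + (Im z)\<^sup>2 = \<rho>" "(Re w)\<^sup>2 + (Im w)\<^sup>2 = 1 - \<rho>"
  shows "polar_frame \<rho> z w r f g \<bullet> hopf_field (z, w) = \<rho> * f + (1 - \<rho>) * g"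
    "polar_frame \<rho> z w r f g \<bullet> hopf_field (polar_frame \<rho> z w r' f' g') = ((f - g) * r' - r * (f' - g')) / 2"
    "polar_frame \<rho> z w r f g \<bullet> (z * Complex a b, w * Complex a' b') = r / 2 * (a - a') + \<rho> * f * b + (1 - \<rho>) * g * b'"
    "(z * Complex a b, w * Complex a' b') \<bullet> hopf_field (z, w) = \<rho> * b + (1 - \<rho>) * b'"
    "berger_metric \<tau> (z, w) (polar_frame \<rho> z w r f g) (polar_frame \<rho> z w r' f' g') =
      metric_form (\<rho> * (1 - \<rho>)) (\<tau>\<^sup>2) r (f - g) (\<rho> * f + (1 - \<rho>) * g) r' (f' - g') (\<rho> * f' + (1 - \<rho>) * g')"
proof -
  have nz: "\<rho> \<noteq> 0" "1 - \<rho> \<noteq> 0" using assms by auto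
  show 1: "polar_frame \<rho> z w r f g \<bullet> hopf_field (z, w) = \<rho> * f + (1 - \<rho>) * g" for r f g
    by (simp add: polar_frame_def hopf_field_def inner_prod_def inner_polar_1 assms)
  define \<sigma> where "\<sigma> = 1 - \<rho>"
  have \<sigma>: "\<sigma> \<noteq> 0" "1 - \<rho> = \<sigma>" using nz by (simp_all add: \<sigma>_def)
  show "polar_frame \<rho> z w r f g \<bullet> hopf_field (polar_frame \<rho> z w r' f' g') = ((f - g) * r' - r * (f' - g')) / 2"
    unfolding polar_frame_def hopf_field_def inner_prod_def fst_conv snd_conv inner_polar_i assms(3,4) \<sigma>(2)
    using nz(1) \<sigma>(1) by (simp add: field_simps)
  show "polar_frame \<rho> z w r f g \<bullet> (z * Complex a b, w * Complex a' b') = r / 2 * (a - a') + \<rho> * f * b + (1 - \<rho>) * g * b'"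
    unfolding polar_frame_def inner_prod_def fst_conv snd_conv inner_polar assms(3,4) \<sigma>(2)
    using nz(1) \<sigma>(1) by (simp add: field_simps)
  show "(z * Complex a b, w * Complex a' b') \<bullet> hopf_field (z, w) = \<rho> * b + (1 - \<rho>) * b'"
    unfolding hopf_field_def inner_prod_def fst_conv snd_conv inner_polar_1 assms(3,4) ..
  have "polar_frame \<rho> z w r f g \<bullet> polar_frame \<rho> z w r' f' g' = r * r' / (4 * \<rho>) + r * r' / (4 * \<sigma>) + \<rho> * f * f' + \<sigma> * g * g'"
    unfolding polar_frame_def inner_prod_def fst_conv snd_conv inner_polar assms(3,4) \<sigma>(2)
    using nz(1) \<sigma>(1) by (simp add: field_simps power2_eq_square)
  also have "r * r' / (4 * \<rho>) + r * r' / (4 * \<sigma>) = r * r' * (\<rho> + \<sigma>) / (4 * (\<rho> * \<sigma>))"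
    using nz(1) \<sigma>(1) by (simp add: field_simps)
  also have "\<rho> + \<sigma> = 1" by (simp add: \<sigma>_def)
  finally have 2: "polar_frame \<rho> z w r f g \<bullet> polar_frame \<rho> z w r' f' g' = r * r' / (4 * (\<rho> * \<sigma>)) + \<rho> * f * f' + \<sigma> * g * g'"
    by simp
  show "berger_metric \<tau> (z, w) (polar_frame \<rho> z w r f g) (polar_frame \<rho> z w r' f' g') =
      metric_form (\<rho> * (1 - \<rho>)) (\<tau>\<^sup>2) r (f - g) (\<rho> * f + (1 - \<rho>) * g) r' (f' - g') (\<rho> * f' + (1 - \<rho>) * g')"
    unfolding berger_metric_def 1 2 metric_form_def \<sigma>(2) by (simp add: \<sigma>_def algebra_simps)
qed

text \<open>The left-hand side is \<open>second_form_eq\<close> for a normal with components \<open>(n, nf, ng)\<close>, with the second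
  derivatives taken from \<open>dird_dird_polar\<close>. Both sides are linear in \<open>n\<close>, \<open>nf - ng\<close> and
  \<open>\<rho> nf + \<sigma> ng\<close>, and the three coefficients are compared separately.\<close>
lemma frame_second_form:
  fixes \<rho> n nf ng T r1 r2 f1 f2 g1 g2 R F H :: real
  assumes "\<rho> > 0" "\<rho> < 1"
  defines "\<sigma> \<equiv> 1 - \<rho>"
  defines "q \<equiv> \<rho> * \<sigma>" and "s \<equiv> 1 - 2 * \<rho>"
  defines "p1 \<equiv> f1 - g1" and "p2 \<equiv> f2 - g2" and "e1 \<equiv> \<rho> * f1 + \<sigma> * g1" and "e2 \<equiv> \<rho> * f2 + \<sigma> * g2"
  defines "a \<equiv> R / (2 * \<rho>) - r1 * r2 / (4 * \<rho>\<^sup>2) - f1 * f2" and "b \<equiv> F + (r1 * f2 + r2 * f1) / (2 * \<rho>)"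
  defines "a' \<equiv> - R / (2 * \<sigma>) - r1 * r2 / (4 * \<sigma>\<^sup>2) - g1 * g2" and "b' \<equiv> H - (r1 * g2 + r2 * g1) / (2 * \<sigma>)"
  shows "- (n / 2 * (a - a') + \<rho> * nf * b + \<sigma> * ng * b' + (T - 1) * (\<rho> * nf + \<sigma> * ng) * (\<rho> * b + \<sigma> * b'))
      - (T - 1) * (((nf - ng) * r1 - n * p1) / 2 * e2 + ((nf - ng) * r2 - n * p2) / 2 * e1) =
    - (n / (4 * q) * height_form q s T r1 p1 e1 r2 p2 e2 R + q * (nf - ng) * psi_form q s T r1 p1 e1 r2 p2 e2 (F - H)
        + T * (\<rho> * nf + \<sigma> * ng) * (\<rho> * F + \<sigma> * H + (r1 * p2 + r2 * p1) / 2))"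
proof -
  have nz: "\<rho> \<noteq> 0" "\<sigma> \<noteq> 0" "q \<noteq> 0" using assms(1,2) by (auto simp: \<sigma>_def q_def)
  have sum: "\<rho> + \<sigma> = 1" "s = \<sigma> - \<rho>" by (simp_all add: \<sigma>_def s_def)
  have f: "f1 = e1 + \<sigma> * p1" "f2 = e2 + \<sigma> * p2" "g1 = e1 - \<rho> * p1" "g2 = e2 - \<rho> * p2"
    unfolding e1_def e2_def p1_def p2_def \<sigma>_def by algebra+
  have A: "(a - a') / 2 - (T - 1) / 2 * (p1 * e2 + p2 * e1) = height_form q s T r1 p1 e1 r2 p2 e2 R / (4 * q)"
  proof -
    have 1: "R / (2 * \<rho>) + R / (2 * \<sigma>) = R / (2 * q)"
    proof -
      have "R / (2 * \<rho>) + R / (2 * \<sigma>) = R * (\<rho> + \<sigma>) / (2 * q)"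
        unfolding q_def using nz by (simp add: field_simps)
      then show ?thesis by (simp add: sum)
    qed
    have 2: "r1 * r2 / (4 * \<rho>\<^sup>2) - r1 * r2 / (4 * \<sigma>\<^sup>2) = r1 * r2 * s / (4 * q\<^sup>2)"
    proof -
      have "r1 * r2 / (4 * \<rho>\<^sup>2) - r1 * r2 / (4 * \<sigma>\<^sup>2) = r1 * r2 * ((\<rho> + \<sigma>) * (\<sigma> - \<rho>)) / (4 * q\<^sup>2)"
        unfolding q_def using nz by (simp add: field_simps power2_eq_square)
      then show ?thesis by (simp add: sum)
    qed
    have 3: "f1 * f2 - g1 * g2 = e1 * p2 + e2 * p1 + s * p1 * p2"
    proof -
      have "f1 * f2 - g1 * g2 = (\<rho> + \<sigma>) * (e1 * p2 + e2 * p1) + (\<rho> + \<sigma>) * s * p1 * p2"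
        unfolding f sum(2) by algebra
      then show ?thesis by (simp add: sum)
    qed
    have "a - a' = R / (2 * q) - r1 * r2 * s / (4 * q\<^sup>2) - (e1 * p2 + e2 * p1 + s * p1 * p2)"
      unfolding a_def a'_def 1[symmetric] 2[symmetric] 3[symmetric] by simp
    then show ?thesis unfolding height_form_def using nz(3) by (simp add: field_simps power2_eq_square)
  qed
  have B: "q * (b - b') + (T - 1) / 2 * (r1 * e2 + r2 * e1) = q * psi_form q s T r1 p1 e1 r2 p2 e2 (F - H)"
  proof -
    have "q * (b - b') = q * (F - H) + (\<sigma> * (r1 * f2 + r2 * f1) / 2 + \<rho> * (r1 * g2 + r2 * g1) / 2)"
      unfolding b_def b'_def q_def using nz by (simp add: field_simps)
    also have "\<sigma> * (r1 * f2 + r2 * f1) / 2 + \<rho> * (r1 * g2 + r2 * g1) / 2 =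
      ((\<rho> + \<sigma>) * (r1 * e2 + r2 * e1) + (\<rho> + \<sigma>) * s * (r1 * p2 + r2 * p1)) / 2"
      unfolding f sum(2) by (simp add: field_simps)
    finally have bb: "q * (b - b') = q * (F - H) + ((r1 * e2 + r2 * e1) + s * (r1 * p2 + r2 * p1)) / 2"
      by (simp add: sum(1))
    have zz: "q * (F - H + Z / (2 * q)) = q * (F - H) + Z / 2" for Z
      using nz(3) by (simp add: field_simps)
    show ?thesis unfolding psi_form_def zz bb by (simp add: field_simps)
  qed
  have C: "\<rho> * b + \<sigma> * b' = \<rho> * F + \<sigma> * H + (r1 * p2 + r2 * p1) / 2"
    unfolding b_def b'_def p1_def p2_def using nz by (simp add: field_simps)
  define np ne where "np = nf - ng" and "ne = \<rho> * nf + \<sigma> * ng"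
  have nf: "nf = ne + \<sigma> * np" "ng = ne - \<rho> * np"
    unfolding np_def ne_def \<sigma>_def by algebra+
  have "\<rho> * nf * b + \<sigma> * ng * b' = ne * (\<rho> * b + \<sigma> * b') + np * (q * (b - b'))"
    unfolding nf q_def by (simp add: algebra_simps)
  then have "- (n / 2 * (a - a') + \<rho> * nf * b + \<sigma> * ng * b' + (T - 1) * (\<rho> * nf + \<sigma> * ng) * (\<rho> * b + \<sigma> * b'))
      - (T - 1) * (((nf - ng) * r1 - n * p1) / 2 * e2 + ((nf - ng) * r2 - n * p2) / 2 * e1) =
     - (n * ((a - a') / 2 - (T - 1) / 2 * (p1 * e2 + p2 * e1)) + np * (q * (b - b') + (T - 1) / 2 * (r1 * e2 + r2 * e1))
        + T * ne * (\<rho> * b + \<sigma> * b'))"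
    unfolding np_def[symmetric] ne_def[symmetric] by (simp add: field_simps)
  also have "\<dots> = - (n / (4 * q) * height_form q s T r1 p1 e1 r2 p2 e2 R + q * np * psi_form q s T r1 p1 e1 r2 p2 e2 (F - H)
        + T * ne * (\<rho> * F + \<sigma> * H + (r1 * p2 + r2 * p1) / 2))"
    unfolding A B C by simp
  finally show ?thesis unfolding np_def ne_def .
qed

definition height :: "('a::euclidean_space \<Rightarrow> C2) \<Rightarrow> 'a \<Rightarrow> real" where
  "height Y = modsq (\<lambda>y. fst (Y y))"

text \<open>The forms \<open>\<psi> = d\<phi> - d\<theta>\<close> and, below, \<open>\<eta> = \<rho> d\<phi> + (1 - \<rho>) d\<theta>\<close> pulled back by \<open>Y\<close>; \<open>\<psi>\<close> vanishes on the
  Hopf direction, \<open>\<eta>\<close> is the inner product with the Hopf field.\<close>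
definition psi :: "'a::euclidean_space \<Rightarrow> ('a \<Rightarrow> C2) \<Rightarrow> 'a \<Rightarrow> real" where
  "psi v Y = (\<lambda>y. arg_deriv v (\<lambda>y. fst (Y y)) y - arg_deriv v (\<lambda>y. snd (Y y)) y)"

definition eta :: "'a::euclidean_space \<Rightarrow> ('a \<Rightarrow> C2) \<Rightarrow> 'a \<Rightarrow> real" where
  "eta v Y = (\<lambda>y. height Y y * arg_deriv v (\<lambda>y. fst (Y y)) y + (1 - height Y y) * arg_deriv v (\<lambda>y. snd (Y y)) y)"

text \<open>The Willmore integrand of \<open>Y\<close> restricted to the plane spanned by \<open>v\<close> and \<open>w\<close>. The domain of \<open>Y\<close> is
  left general because a family of surfaces is treated as one map of time and position.\<close>
definition surface_density :: "real \<Rightarrow> 'a::euclidean_space \<Rightarrow> 'a \<Rightarrow> ('a \<Rightarrow> C2) \<Rightarrow> 'a \<Rightarrow> real" where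
  "surface_density T v w Y = (\<lambda>y. jet_density T (height Y y) (dird v (height Y) y) (dird w (height Y) y)
    (psi v Y y) (psi w Y y) (eta v Y y) (eta w Y y)
    (dird v (dird v (height Y)) y) (dird v (dird w (height Y)) y) (dird w (dird w (height Y)) y)
    (dird v (psi v Y) y) (dird v (psi w Y) y) (dird w (psi w Y) y)
    (dird v (eta v Y) y) ((dird v (eta w Y) y + dird w (eta v Y) y) / 2) (dird w (eta w Y) y))"

definition polar_map :: "'a::euclidean_space set \<Rightarrow> ('a \<Rightarrow> C2) \<Rightarrow> bool" where
  "polar_map S Y \<longleftrightarrow> open S \<and> smooth_on S Y \<and> (\<forall>y\<in>S. Y y \<in> S3 \<and> fst (Y y) \<noteq> 0 \<and> snd (Y y) \<noteq> 0)"

lemma smooth_on_fst [smooth_intros]: "open S \<Longrightarrow> smooth_on S f \<Longrightarrow> smooth_on S (\<lambda>x. fst (f x))"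
  by (rule smooth_on_bounded_linear[OF _ bounded_linear_fst])

lemma smooth_on_snd [smooth_intros]: "open S \<Longrightarrow> smooth_on S f \<Longrightarrow> smooth_on S (\<lambda>x. snd (f x))"
  by (rule smooth_on_bounded_linear[OF _ bounded_linear_snd])

context
  fixes S :: "'a::euclidean_space set" and Y :: "'a \<Rightarrow> C2"
  assumes Y: "polar_map S Y"
begin

lemma polar_facts:
  shows "open S" "smooth_on S Y" "smooth_on S (\<lambda>y. fst (Y y))" "smooth_on S (\<lambda>y. snd (Y y))"
    "\<And>y. y \<in> S \<Longrightarrow> fst (Y y) \<noteq> 0" "\<And>y. y \<in> S \<Longrightarrow> snd (Y y) \<noteq> 0"
    "\<And>y. y \<in> S \<Longrightarrow> modsq (\<lambda>y. snd (Y y)) y = 1 - height Y y"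
    "\<And>y. y \<in> S \<Longrightarrow> 0 < height Y y" "\<And>y. y \<in> S \<Longrightarrow> height Y y < 1"
proof -
  show 1: "open S" "smooth_on S Y" "\<And>y. y \<in> S \<Longrightarrow> fst (Y y) \<noteq> 0" "\<And>y. y \<in> S \<Longrightarrow> snd (Y y) \<noteq> 0"
    using Y by (auto simp: polar_map_def)
  show "smooth_on S (\<lambda>y. fst (Y y))" "smooth_on S (\<lambda>y. snd (Y y))"
    using 1 by (auto intro!: smooth_intros)
  show 2: "modsq (\<lambda>y. snd (Y y)) y = 1 - height Y y" if "y \<in> S" for y
  proof -
    have "Y y \<in> S3" using Y that by (auto simp: polar_map_def)
    then show ?thesis by (cases "Y y") (simp add: S3_def height_def modsq_def cmod_power2)
  qed
  show "0 < height Y y" if "y \<in> S" for y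
    unfolding height_def using 1(3)[OF that] by (rule modsq_pos)
  show "height Y y < 1" if "y \<in> S" for y
    using modsq_pos[of "\<lambda>y. snd (Y y)" y, OF 1(4)[OF that]] 2[OF that] by simp
qed

lemma smooth_polar [smooth_intros]:
  "smooth_on S (height Y)" "smooth_on S (psi v Y)" "smooth_on S (eta v Y)"
    "smooth_on S (arg_deriv v (\<lambda>y. fst (Y y)))" "smooth_on S (arg_deriv v (\<lambda>y. snd (Y y)))"
proof -
  show 1: "smooth_on S (height Y)" unfolding height_def by (intro smooth_intros polar_facts)
  show 2: "smooth_on S (arg_deriv v (\<lambda>y. fst (Y y)))" by (rule smooth_on_arg_deriv[OF polar_facts(1,3,5)])
  show 3: "smooth_on S (arg_deriv v (\<lambda>y. snd (Y y)))" by (rule smooth_on_arg_deriv[OF polar_facts(1,4,6)])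
  show "smooth_on S (psi v Y)" "smooth_on S (eta v Y)"
    unfolding psi_def eta_def by (intro smooth_intros 1 2 3 polar_facts)+
qed

lemma dird_modsq_snd:
  assumes "y \<in> S"
  shows "dird v (modsq (\<lambda>y. snd (Y y))) y = - dird v (height Y) y"
    "dird v (dird w (modsq (\<lambda>y. snd (Y y)))) y = - dird v (dird w (height Y)) y"
proof -
  have a: "dird v (modsq (\<lambda>y. snd (Y y))) y = - dird v (height Y) y" if "y \<in> S" for v y
  proof -
    have "dird v (modsq (\<lambda>y. snd (Y y))) y = dird v (\<lambda>y. 1 - height Y y) y"
      by (rule dird_cong[OF polar_facts(1) that]) (rule polar_facts(7))
    also have "\<dots> = 0 - dird v (height Y) y"
      by (rule dirdI[OF has_derivative_diff[OF has_derivative_const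
            smooth_on_has_derivative[OF smooth_polar(1) that]]])
    finally show ?thesis by simp
  qed
  show "dird v (modsq (\<lambda>y. snd (Y y))) y = - dird v (height Y) y" by (rule a[OF assms])
  have "dird v (dird w (modsq (\<lambda>y. snd (Y y)))) y = dird v (\<lambda>y. - dird w (height Y) y) y"
    by (rule dird_cong[OF polar_facts(1) assms]) (rule a)
  also have "\<dots> = - dird v (dird w (height Y)) y"
    by (rule dirdI[OF has_derivative_minus[OF smooth_on_has_derivative[OF smooth_on_dird[OF smooth_polar(1)] assms]]])
  finally show "dird v (dird w (modsq (\<lambda>y. snd (Y y)))) y = - dird v (dird w (height Y)) y" .
qed

text \<open>First and second derivatives of \<open>Y\<close> in the polar frame; the modulus of the second coordinate
  contributes the derivatives of \<open>1 - \<rho>\<close>.\<close>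
lemma dird_frame:
  assumes y: "y \<in> S"
  defines "z \<equiv> fst (Y y)" and "w \<equiv> snd (Y y)" and "\<rho> \<equiv> height Y y" and "r \<equiv> \<lambda>v. dird v (height Y) y"
    and "f \<equiv> \<lambda>v. arg_deriv v (\<lambda>y. fst (Y y)) y" and "g \<equiv> \<lambda>v. arg_deriv v (\<lambda>y. snd (Y y)) y"
  shows "dird v Y y = polar_frame \<rho> z w (r v) (f v) (g v)"
    "dird v (dird u Y) y = (z * Complex (dird v (dird u (height Y)) y / (2 * \<rho>) - r v * r u / (4 * \<rho>\<^sup>2) - f v * f u)
         (dird v (arg_deriv u (\<lambda>y. fst (Y y))) y + (r v * f u + r u * f v) / (2 * \<rho>)),
       w * Complex (- dird v (dird u (height Y)) y / (2 * (1 - \<rho>)) - r v * r u / (4 * (1 - \<rho>)\<^sup>2) - g v * g u)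
         (dird v (arg_deriv u (\<lambda>y. snd (Y y))) y - (r v * g u + r u * g v) / (2 * (1 - \<rho>))))"
proof -
  note P = polar_facts
  have 1: "fst (dird v Y y) = dird v (\<lambda>y. fst (Y y)) y" "snd (dird v Y y) = dird v (\<lambda>y. snd (Y y)) y"
    if "y \<in> S" for v y
    using dird_bounded_linear[OF bounded_linear_fst P(2) that] dird_bounded_linear[OF bounded_linear_snd P(2) that]
    by simp_all
  have 2: "fst (dird v (dird u Y) y) = dird v (dird u (\<lambda>y. fst (Y y))) y"
    "snd (dird v (dird u Y) y) = dird v (dird u (\<lambda>y. snd (Y y))) y"
  proof -
    have "fst (dird v (dird u Y) y) = dird v (\<lambda>y. fst (dird u Y y)) y"
      "snd (dird v (dird u Y) y) = dird v (\<lambda>y. snd (dird u Y y)) y"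
      using dird_bounded_linear[OF bounded_linear_fst smooth_on_dird[OF P(2)] y]
        dird_bounded_linear[OF bounded_linear_snd smooth_on_dird[OF P(2)] y] by simp_all
    moreover have "dird v (\<lambda>y. fst (dird u Y y)) y = dird v (dird u (\<lambda>y. fst (Y y))) y"
      "dird v (\<lambda>y. snd (dird u Y y)) y = dird v (dird u (\<lambda>y. snd (Y y))) y"
      by (rule dird_cong[OF P(1) y], rule 1, assumption)+
    ultimately show "fst (dird v (dird u Y) y) = dird v (dird u (\<lambda>y. fst (Y y))) y"
      "snd (dird v (dird u Y) y) = dird v (dird u (\<lambda>y. snd (Y y))) y" by simp_all
  qed
  have fs: "fst (Y y) \<noteq> 0" "snd (Y y) \<noteq> 0" using P y by blast+
  have "fst (dird v Y y) = z * Complex (r v / (2 * \<rho>)) (f v)"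
    unfolding 1[OF y] dird_polar[OF P(1,3) y fs(1)] z_def r_def \<rho>_def f_def height_def ..
  moreover have "snd (dird v Y y) = w * Complex (- r v / (2 * (1 - \<rho>))) (g v)"
    unfolding 1[OF y] dird_polar[OF P(1,4) y fs(2)] w_def r_def \<rho>_def g_def dird_modsq_snd[OF y] P(7)[OF y] by simp
  ultimately show "dird v Y y = polar_frame \<rho> z w (r v) (f v) (g v)"
    by (simp add: polar_frame_def prod_eq_iff)
  have "fst (dird v (dird u Y) y) = z * Complex (dird v (dird u (height Y)) y / (2 * \<rho>) - r v * r u / (4 * \<rho>\<^sup>2) - f v * f u)
         (dird v (arg_deriv u (\<lambda>y. fst (Y y))) y + (r v * f u + r u * f v) / (2 * \<rho>))"
    unfolding 2(1) z_def r_def \<rho>_def f_def height_def by (rule dird_dird_polar[OF P(1,3,5) y])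
  moreover have "snd (dird v (dird u Y) y) = w * Complex (- dird v (dird u (height Y)) y / (2 * (1 - \<rho>)) - r v * r u / (4 * (1 - \<rho>)\<^sup>2) - g v * g u)
         (dird v (arg_deriv u (\<lambda>y. snd (Y y))) y - (r v * g u + r u * g v) / (2 * (1 - \<rho>)))"
    using dird_dird_polar[OF P(1,4,6) y, of v u]
    unfolding 2(2) w_def r_def \<rho>_def g_def dird_modsq_snd[OF y] P(7)[OF y]
    by (simp add: diff_divide_distrib add_divide_distrib)
  ultimately show "dird v (dird u Y) y = (z * Complex (dird v (dird u (height Y)) y / (2 * \<rho>) - r v * r u / (4 * \<rho>\<^sup>2) - f v * f u)
         (dird v (arg_deriv u (\<lambda>y. fst (Y y))) y + (r v * f u + r u * f v) / (2 * \<rho>)),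
       w * Complex (- dird v (dird u (height Y)) y / (2 * (1 - \<rho>)) - r v * r u / (4 * (1 - \<rho>)\<^sup>2) - g v * g u)
         (dird v (arg_deriv u (\<lambda>y. snd (Y y))) y - (r v * g u + r u * g v) / (2 * (1 - \<rho>))))"
    by (simp add: prod_eq_iff)
qed

lemma dird_psi_eta:
  assumes y: "y \<in> S"
  shows "dird v (psi u Y) y = dird v (arg_deriv u (\<lambda>y. fst (Y y))) y - dird v (arg_deriv u (\<lambda>y. snd (Y y))) y"
    "dird v (eta u Y) y = height Y y * dird v (arg_deriv u (\<lambda>y. fst (Y y))) y
       + (1 - height Y y) * dird v (arg_deriv u (\<lambda>y. snd (Y y))) y + dird v (height Y) y * psi u Y y"
    "dird v (psi u Y) y = dird u (psi v Y) y"
    "dird v (arg_deriv u (\<lambda>y. fst (Y y))) y = dird u (arg_deriv v (\<lambda>y. fst (Y y))) y"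
    "dird v (arg_deriv u (\<lambda>y. snd (Y y))) y = dird u (arg_deriv v (\<lambda>y. snd (Y y))) y"
proof -
  note d1 = smooth_on_has_derivative[OF smooth_polar(4) y, of u]
  note d2 = smooth_on_has_derivative[OF smooth_polar(5) y, of u]
  note dh = smooth_on_has_derivative[OF smooth_polar(1) y]
  show 1: "dird v (psi u Y) y = dird v (arg_deriv u (\<lambda>y. fst (Y y))) y - dird v (arg_deriv u (\<lambda>y. snd (Y y))) y" for u v
    unfolding psi_def by (rule dirdI[OF has_derivative_diff[OF
          smooth_on_has_derivative[OF smooth_polar(4) y] smooth_on_has_derivative[OF smooth_polar(5) y]]])
  show "dird v (eta u Y) y = height Y y * dird v (arg_deriv u (\<lambda>y. fst (Y y))) y
       + (1 - height Y y) * dird v (arg_deriv u (\<lambda>y. snd (Y y))) y + dird v (height Y) y * psi u Y y"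
    unfolding eta_def psi_def
    by (rule trans[OF dirdI[OF has_derivative_add[OF has_derivative_mult[OF dh d1]
            has_derivative_mult[OF has_derivative_diff[OF has_derivative_const dh] d2]]]])
      (simp add: algebra_simps)
  show 2: "dird v (arg_deriv u (\<lambda>y. fst (Y y))) y = dird u (arg_deriv v (\<lambda>y. fst (Y y))) y"
    by (rule arg_deriv_closed[OF polar_facts(1,3,5) y])
  show 3: "dird v (arg_deriv u (\<lambda>y. snd (Y y))) y = dird u (arg_deriv v (\<lambda>y. snd (Y y))) y"
    by (rule arg_deriv_closed[OF polar_facts(1,4,6) y])
  show "dird v (psi u Y) y = dird u (psi v Y) y" unfolding 1 2 3 ..
qed

end

text \<open>The metric is positive on the nonzero vector \<open>G\<^sub>1\<^sub>1 X\<^sub>2 - G\<^sub>1\<^sub>2 X\<^sub>1\<close>, where its value is \<open>G\<^sub>1\<^sub>1\<close> times the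
  determinant.\<close>
lemma gram_det_pos:
  fixes X :: "real \<times> real \<Rightarrow> C2"
  assumes \<tau>: "\<tau> > 1" and d: "(X has_derivative X') (at x)" and inj: "inj X'"
  defines "G \<equiv> \<lambda>u v. berger_metric \<tau> (X x) (X' u) (X' v)"
  shows "G (1, 0) (1, 0) * G (0, 1) (0, 1) - (G (1, 0) (0, 1))\<^sup>2 > 0"
proof -
  have lin: "linear X'" using d by (rule has_derivative_linear)
  have pos: "berger_metric \<tau> p Z Z > 0" if "Z \<noteq> 0" for p Z
  proof -
    have "Z \<bullet> Z > 0" using that by simp
    moreover have "(\<tau>\<^sup>2 - 1) * (Z \<bullet> hopf_field p) * (Z \<bullet> hopf_field p) \<ge> 0"
    proof -
      have "\<tau>\<^sup>2 \<ge> 1" using \<tau> by simp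
      then have "(\<tau>\<^sup>2 - 1) * (Z \<bullet> hopf_field p)\<^sup>2 \<ge> 0" by (intro mult_nonneg_nonneg) auto
      then show ?thesis by (simp add: power2_eq_square mult.assoc)
    qed
    ultimately show ?thesis unfolding berger_metric_def by linarith
  qed
  have nz: "X' u \<noteq> 0" if "u \<noteq> 0" for u
  proof
    assume "X' u = 0"
    then have "X' u = X' 0" by (simp add: linear_0[OF lin])
    then show False using inj that by (simp add: inj_eq)
  qed
  have g1: "G (1, 0) (1, 0) > 0"
    unfolding G_def by (intro pos nz) (simp add: zero_prod_def)
  define a where "a = G (1, 0) (1, 0)"
  define b where "b = G (1, 0) (0, 1)"
  define Z where "Z = a *\<^sub>R X' (0, 1) - b *\<^sub>R X' (1, 0)"
  have "Z = X' (a *\<^sub>R (0, 1) - b *\<^sub>R (1, 0))"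
    unfolding Z_def linear_diff[OF lin] linear_scale[OF lin] ..
  moreover have "(a *\<^sub>R (0, 1) - b *\<^sub>R (1, 0) :: real \<times> real) \<noteq> 0"
    using g1 by (simp add: zero_prod_def a_def)
  ultimately have "Z \<noteq> 0" using nz by simp
  then have "berger_metric \<tau> (X x) Z Z > 0" by (rule pos)
  also have "berger_metric \<tau> (X x) Z Z = a * (a * G (0, 1) (0, 1) - b\<^sup>2)"
  proof -
    have "berger_metric \<tau> (X x) Z Z = a\<^sup>2 * G (0, 1) (0, 1) - 2 * a * b * G (1, 0) (0, 1) + b\<^sup>2 * G (1, 0) (1, 0)"
      unfolding G_def Z_def berger_metric_def inner_diff_left inner_diff_right inner_scaleR_left inner_scaleR_right
      by (simp add: algebra_simps power2_eq_square inner_commute)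
    then show ?thesis unfolding a_def[symmetric] b_def[symmetric] by (simp add: power2_eq_square algebra_simps)
  qed
  finally show ?thesis using g1 unfolding a_def[symmetric] b_def[symmetric]
    by (simp add: zero_less_mult_iff)
qed

text \<open>The components of the unit normal along the polar frame form the covector \<open>m\<close> of \<open>form_density_normal\<close>.\<close>
theorem willmore_integrand:
  fixes X :: "real \<times> real \<Rightarrow> C2"
  assumes \<tau>: "\<tau> > 1" and X: "polar_map UNIV X" and inj: "inj (frechet_derivative X (at x))"
    and N: "unit_normal \<tau> X N"
  shows "form_norm_sq (first_form \<tau> X x) (traceless_form \<tau> X N x) * sqrt (det (first_form \<tau> X x)) =
    surface_density (\<tau>\<^sup>2) (1, 0) (0, 1) X x"
proof -
  note P = polar_facts[OF X]
  have x: "x \<in> UNIV" by simp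
  define z w \<rho> q s T where "z = fst (X x)" and "w = snd (X x)" and "\<rho> = height X x"
    and "q = \<rho> * (1 - \<rho>)" and "s = 1 - 2 * \<rho>" and "T = \<tau>\<^sup>2"
  define r f g where "r = (\<lambda>i. dird (coord_dir i) (height X) x)"
    and "f = (\<lambda>i. arg_deriv (coord_dir i) (\<lambda>y. fst (X y)) x)" and "g = (\<lambda>i. arg_deriv (coord_dir i) (\<lambda>y. snd (X y)) x)"
  define p e where "p = (\<lambda>i. f i - g i)" and "e = (\<lambda>i. \<rho> * f i + (1 - \<rho>) * g i)"
  have Xx: "X x = (z, w)" by (simp add: z_def w_def)
  have \<rho>: "0 < \<rho>" "\<rho> < 1" using P(8,9)[OF x] by (simp_all add: \<rho>_def)
  have q: "q > 0" using \<rho> by (simp add: q_def)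
  have T: "T > 0" using \<tau> by (simp add: T_def)
  have mz: "(Re z)\<^sup>2 + (Im z)\<^sup>2 = \<rho>" by (simp add: z_def \<rho>_def height_def modsq_def)
  have mw: "(Re w)\<^sup>2 + (Im w)\<^sup>2 = 1 - \<rho>"
    using P(7)[OF x] by (simp add: w_def \<rho>_def modsq_def)
  note FI = frame_inner[OF \<rho> mz mw]
  have S3: "X y \<in> S3" for y using X unfolding polar_map_def by blast
  have D1: "pd i X x = polar_frame \<rho> z w (r i) (f i) (g i)" for i
    unfolding pd_eq_dird dird_frame(1)[OF X x] \<rho>_def z_def w_def r_def f_def g_def ..
  have Nt: "N x \<bullet> X x = 0" and N1: "berger_metric \<tau> (X x) (N x) (N x) = 1"
    and N2: "\<And>i. berger_metric \<tau> (X x) (N x) (pd i X x) = 0"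
    using N unfolding unit_normal_def tangent_S3_def by blast+
  obtain n nf ng where Nx: "N x = polar_frame \<rho> z w n nf ng"
  proof -
    define \<alpha> \<beta> where "\<alpha> = fst (N x) / z" and "\<beta> = snd (N x) / w"
    have zw: "z \<noteq> 0" "w \<noteq> 0" using P(5,6)[OF x] by (simp_all add: z_def w_def)
    have N': "fst (N x) = z * Complex (Re \<alpha>) (Im \<alpha>)" "snd (N x) = w * Complex (Re \<beta>) (Im \<beta>)"
      using zw by (simp_all add: \<alpha>_def \<beta>_def)
    have one: "inner (c * Complex a b) c = ((Re c)\<^sup>2 + (Im c)\<^sup>2) * a" for c a b
      by (simp add: inner_complex_def power2_eq_square algebra_simps)
    have "\<rho> * Re \<alpha> + (1 - \<rho>) * Re \<beta> = 0"
      using Nt unfolding Xx inner_prod_def N' fst_conv snd_conv one mz mw .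
    then have "Re \<beta> = - (2 * \<rho> * Re \<alpha>) / (2 * (1 - \<rho>))"
      using \<rho> by (simp add: field_simps)
    moreover have "Re \<alpha> = 2 * \<rho> * Re \<alpha> / (2 * \<rho>)" using \<rho> by simp
    ultimately have "N x = polar_frame \<rho> z w (2 * \<rho> * Re \<alpha>) (Im \<alpha>) (Im \<beta>)"
      unfolding polar_frame_def prod_eq_iff fst_conv snd_conv using N' by metis
    then show thesis by (rule that)
  qed
  define np ne where "np = nf - ng" and "ne = \<rho> * nf + (1 - \<rho>) * ng"
  define m1 m2 m3 where "m1 = n / (4 * q)" and "m2 = q * np" and "m3 = T * ne"
  have orth: "m1 * r i + m2 * p i + m3 * e i = 0" for i
    using N2[of i] unfolding Xx Nx D1 FI(5) q_def[symmetric] T_def[symmetric]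
    by (simp add: metric_form_def m1_def m2_def m3_def np_def ne_def p_def e_def)
  have unit: "4 * q * m1\<^sup>2 + m2\<^sup>2 / q + m3\<^sup>2 / T = 1"
  proof -
    have "4 * q * m1\<^sup>2 + m2\<^sup>2 / q + m3\<^sup>2 / T = n * n / (4 * q) + q * np * np + T * ne * ne"
      unfolding m1_def m2_def m3_def using q T by (simp add: power2_eq_square)
    also have "\<dots> = 1"
      using N1 unfolding Xx Nx FI(5) q_def[symmetric] T_def[symmetric] by (simp add: metric_form_def np_def ne_def)
    finally show ?thesis .
  qed
  have G: "first_form \<tau> X x $ i $ j = metric_form q T (r i) (p i) (e i) (r j) (p j) (e j)" for i j
    unfolding first_form_def Xx D1 p_def e_def q_def T_def using FI(5) by simp
  define A B E where "A = (\<lambda>i j. height_form q s T (r i) (p i) (e i) (r j) (p j) (e j) (dird (coord_dir i) (dird (coord_dir j) (height X)) x))"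
    and "B = (\<lambda>i j. psi_form q s T (r i) (p i) (e i) (r j) (p j) (e j) (dird (coord_dir i) (psi (coord_dir j) X) x))"
    and "E = (\<lambda>i j. (dird (coord_dir i) (eta (coord_dir j) X) x + dird (coord_dir j) (eta (coord_dir i) X) x) / 2)"
  have h: "second_form \<tau> X N x $ i $ j = - (m1 * A i j + m2 * B i j + m3 * E i j)" for i j
  proof -
    define R F H where "R = dird (coord_dir i) (dird (coord_dir j) (height X)) x"
      and "F = dird (coord_dir i) (arg_deriv (coord_dir j) (\<lambda>y. fst (X y))) x"
      and "H = dird (coord_dir i) (arg_deriv (coord_dir j) (\<lambda>y. snd (X y))) x"
    have D2: "pd i (pd j X) x = (z * Complex (R / (2 * \<rho>) - r i * r j / (4 * \<rho>\<^sup>2) - f i * f j)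
         (F + (r i * f j + r j * f i) / (2 * \<rho>)),
       w * Complex (- R / (2 * (1 - \<rho>)) - r i * r j / (4 * (1 - \<rho>)\<^sup>2) - g i * g j)
         (H - (r i * g j + r j * g i) / (2 * (1 - \<rho>))))"
      unfolding pd_eq_dird dird_frame(2)[OF X x] \<rho>_def z_def w_def r_def f_def g_def R_def F_def H_def ..
    have psi: "dird (coord_dir i) (psi (coord_dir j) X) x = F - H"
      unfolding F_def H_def by (rule dird_psi_eta(1)[OF X x])
    have pp: "psi (coord_dir i) X x = p i" for i
      by (simp add: psi_def p_def f_def g_def)
    have E: "E i j = \<rho> * F + (1 - \<rho>) * H + (r i * p j + r j * p i) / 2"
      unfolding E_def dird_psi_eta(2)[OF X x] pp
        dird_psi_eta(4)[OF X x, of "coord_dir j" "coord_dir i"] dird_psi_eta(5)[OF X x, of "coord_dir j" "coord_dir i"]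
        F_def[symmetric] H_def[symmetric] \<rho>_def[symmetric] by (simp add: r_def field_simps)
    have "second_form \<tau> X N x $ i $ j = - berger_metric \<tau> (X x) (N x) (pd i (pd j X) x)
      - (\<tau>\<^sup>2 - 1) * ((N x \<bullet> hopf_field (pd i X x)) * (pd j X x \<bullet> hopf_field (X x))
          + (N x \<bullet> hopf_field (pd j X x)) * (pd i X x \<bullet> hopf_field (X x)))"
      using \<tau> by (intro second_form_eq[OF _ P(2) S3 N]) simp
    then show ?thesis
      unfolding berger_metric_def Xx Nx D1 D2 FI(1-4) T_def[symmetric]
      using frame_second_form[OF \<rho>, of n R "r i" "r j" "f i" "f j" "g i" "g j" nf F ng H T]
      unfolding A_def B_def E psi R_def[symmetric] m1_def m2_def m3_def np_def ne_def p_def e_def q_def s_def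
      by simp
  qed
  have hsym: "second_form \<tau> X N x $ 2 $ 1 = second_form \<tau> X N x $ 1 $ 2"
  proof -
    have "A 2 1 = A 1 2" unfolding A_def height_form_def
      using dird_commute[OF P(1) smooth_polar(1)[OF X] x, of "coord_dir 1" "coord_dir 2"] by (simp add: algebra_simps)
    moreover have "B 2 1 = B 1 2" unfolding B_def psi_form_def
      using dird_psi_eta(3)[OF X x, of "coord_dir 1" "coord_dir 2"] by (simp add: algebra_simps)
    moreover have "E 2 1 = E 1 2" unfolding E_def by simp
    ultimately show ?thesis unfolding h by simp
  qed
  define g11 g12 g22 where "g11 = first_form \<tau> X x $ 1 $ 1" and "g12 = first_form \<tau> X x $ 1 $ 2"
    and "g22 = first_form \<tau> X x $ 2 $ 2"
  have gsym: "first_form \<tau> X x $ 2 $ 1 = first_form \<tau> X x $ 1 $ 2" unfolding G metric_form_def by simp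
  have det: "det (first_form \<tau> X x) = g11 * g22 - g12\<^sup>2"
    using gsym by (simp add: det_2 g11_def g12_def g22_def power2_eq_square)
  have cd: "coord_dir 1 = (1, 0)" "coord_dir 2 = (0, 1)" by (simp_all add: coord_dir_def)
  have D: "g11 * g22 - g12\<^sup>2 > 0"
  proof -
    have "(X has_derivative frechet_derivative X (at x)) (at x)"
      using smooth_on_has_derivative[OF P(2) x] frechet_derivative_works[of X "at x"]
      by (auto simp: differentiable_def)
    from gram_det_pos[OF \<tau> this inj] show ?thesis
      by (simp add: g11_def g12_def g22_def first_form_def pd_def cd)
  qed
  have "form_norm_sq (first_form \<tau> X x) (traceless_form \<tau> X N x) * sqrt (det (first_form \<tau> X x)) =
    ((g22 * second_form \<tau> X N x $ 1 $ 1 + g11 * second_form \<tau> X N x $ 2 $ 2 - 2 * g12 * second_form \<tau> X N x $ 1 $ 2)\<^sup>2 / 2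
      - 2 * (g11 * g22 - g12\<^sup>2) * (second_form \<tau> X N x $ 1 $ 1 * second_form \<tau> X N x $ 2 $ 2
         - (second_form \<tau> X N x $ 1 $ 2)\<^sup>2)) * (inverse (sqrt (g11 * g22 - g12\<^sup>2))) ^ 3"
    unfolding traceless_form_def mean_curvature_def
    using traceless_norm_algebra[OF gsym hsym] D unfolding det g11_def[symmetric] g12_def[symmetric] g22_def[symmetric]
    by simp
  also have "\<dots> = form_density T g11 g12 g22
     ((p 1 * e 2 - e 1 * p 2) * A 1 1 + (e 1 * r 2 - r 1 * e 2) * B 1 1 + (r 1 * p 2 - p 1 * r 2) * E 1 1)
     ((p 1 * e 2 - e 1 * p 2) * A 1 2 + (e 1 * r 2 - r 1 * e 2) * B 1 2 + (r 1 * p 2 - p 1 * r 2) * E 1 2)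
     ((p 1 * e 2 - e 1 * p 2) * A 2 2 + (e 1 * r 2 - r 1 * e 2) * B 2 2 + (r 1 * p 2 - p 1 * r 2) * E 2 2)"
    by (rule form_density_normal[OF q T orth[of 1] orth[of 2] unit _ _ _ D refl refl refl h h h])
       (simp_all add: g11_def g12_def g22_def G)
  also have "\<dots> = surface_density T (1, 0) (0, 1) X x"
    unfolding surface_density_def jet_density_def Let_def cd[symmetric] g11_def g12_def g22_def G A_def B_def E_def
    by (simp add: r_def p_def e_def f_def g_def q_def s_def \<rho>_def psi_def eta_def)
  finally show ?thesis unfolding T_def .
qed

text \<open>All ingredients are tensors on the parameter plane: the minors \<open>c\<close> are multiplied by the
  determinant \<open>1\<close>, the forms \<open>G\<close> and \<open>K\<close> transform as in \<open>form_density_invariant\<close>.\<close>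
lemma jet_density_invariant:
  assumes abcd: "a * d - b * c = 1"
  shows "jet_density T \<rho> (a * r1 + b * r2) (c * r1 + d * r2) (a * p1 + b * p2) (c * p1 + d * p2) (a * e1 + b * e2) (c * e1 + d * e2)
    (a\<^sup>2 * r11 + 2 * a * b * r12 + b\<^sup>2 * r22) (a * c * r11 + (a * d + b * c) * r12 + b * d * r22) (c\<^sup>2 * r11 + 2 * c * d * r12 + d\<^sup>2 * r22)
    (a\<^sup>2 * p11 + 2 * a * b * p12 + b\<^sup>2 * p22) (a * c * p11 + (a * d + b * c) * p12 + b * d * p22) (c\<^sup>2 * p11 + 2 * c * d * p12 + d\<^sup>2 * p22)
    (a\<^sup>2 * e11 + 2 * a * b * e12 + b\<^sup>2 * e22) (a * c * e11 + (a * d + b * c) * e12 + b * d * e22) (c\<^sup>2 * e11 + 2 * c * d * e12 + d\<^sup>2 * e22)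
   = jet_density T \<rho> r1 r2 p1 p2 e1 e2 r11 r12 r22 p11 p12 p22 e11 e12 e22"
proof -
  define q s where "q = \<rho> * (1 - \<rho>)" and "s = 1 - 2 * \<rho>"
  have minor: "(a * x1 + b * x2) * (c * y1 + d * y2) - (a * y1 + b * y2) * (c * x1 + d * x2) = x1 * y2 - y1 * x2" for x1 x2 y1 y2
  proof -
    have "(a * x1 + b * x2) * (c * y1 + d * y2) - (a * y1 + b * y2) * (c * x1 + d * x2) = (a * d - b * c) * (x1 * y2 - y1 * x2)"
      by algebra
    then show ?thesis using abcd by simp
  qed
  have G: "metric_form q T (u * r1 + v * r2) (u * p1 + v * p2) (u * e1 + v * e2) (u' * r1 + v' * r2) (u' * p1 + v' * p2) (u' * e1 + v' * e2)
     = u * u' * metric_form q T r1 p1 e1 r1 p1 e1 + (u * v' + v * u') * metric_form q T r1 p1 e1 r2 p2 e2 + v * v' * metric_form q T r2 p2 e2 r2 p2 e2"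
    for u v u' v'
    unfolding metric_form_def by (simp add: add_divide_distrib algebra_simps)
  have KA: "height_form q s T (u * r1 + v * r2) (u * p1 + v * p2) (u * e1 + v * e2) (u' * r1 + v' * r2) (u' * p1 + v' * p2) (u' * e1 + v' * e2)
        (u * u' * r11 + (u * v' + v * u') * r12 + v * v' * r22)
     = u * u' * height_form q s T r1 p1 e1 r1 p1 e1 r11 + (u * v' + v * u') * height_form q s T r1 p1 e1 r2 p2 e2 r12 + v * v' * height_form q s T r2 p2 e2 r2 p2 e2 r22"
    for u v u' v'
    unfolding height_form_def by (simp add: add_divide_distrib algebra_simps)
  have KB: "psi_form q s T (u * r1 + v * r2) (u * p1 + v * p2) (u * e1 + v * e2) (u' * r1 + v' * r2) (u' * p1 + v' * p2) (u' * e1 + v' * e2)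
        (u * u' * p11 + (u * v' + v * u') * p12 + v * v' * p22)
     = u * u' * psi_form q s T r1 p1 e1 r1 p1 e1 p11 + (u * v' + v * u') * psi_form q s T r1 p1 e1 r2 p2 e2 p12 + v * v' * psi_form q s T r2 p2 e2 r2 p2 e2 p22"
    for u v u' v'
    unfolding psi_form_def by (simp add: add_divide_distrib algebra_simps)
  have sq: "a\<^sup>2 * x + 2 * a * b * y + b\<^sup>2 * z = a * a * x + (a * b + b * a) * y + b * b * z"
    "c\<^sup>2 * x + 2 * c * d * y + d\<^sup>2 * z = c * c * x + (c * d + d * c) * y + d * d * z" for x y z
    by (simp_all add: power2_eq_square)
  have comb: "k1 * (u * u' * x + w * y + v * v' * z) + k2 * (u * u' * x' + w * y' + v * v' * z') + k3 * (u * u' * x'' + w * y'' + v * v' * z'')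
    = u * u' * (k1 * x + k2 * x' + k3 * x'') + w * (k1 * y + k2 * y' + k3 * y'') + v * v' * (k1 * z + k2 * z' + k3 * z'')"
    for k1 k2 k3 u u' v v' w x y z x' y' z' x'' y'' z'' :: real
    by algebra
  show ?thesis
    unfolding jet_density_def Let_def q_def[symmetric] s_def[symmetric] minor sq G KA KB comb
    unfolding sq[symmetric] by (rule form_density_invariant[OF abcd])
qed

section \<open>Second-order jets of the integrand\<close>

text \<open>Value, first and second derivative at \<open>0\<close>. These triples are propagated through the integrand one
  operation at a time, which avoids differentiating the full expression.\<close>
definition jet2 :: "(real \<Rightarrow> real) \<Rightarrow> real \<Rightarrow> real \<Rightarrow> real \<Rightarrow> bool" where
  "jet2 F a b c \<longleftrightarrow> F 0 = a \<and> (\<exists>F'. (\<forall>\<^sub>F t in nhds 0. (F has_real_derivative F' t) (at t)) \<and> F' 0 = b \<and>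
     (F' has_real_derivative c) (at 0))"

lemma jet2I:
  assumes "F 0 = a" "\<forall>\<^sub>F t in nhds 0. (F has_real_derivative F' t) (at t)" "F' 0 = b" "(F' has_real_derivative c) (at 0)"
  shows "jet2 F a b c"
  using assms unfolding jet2_def by blast

lemma jet2E:
  assumes "jet2 F a b c"
  obtains F' where "F 0 = a" "\<forall>\<^sub>F t in nhds 0. (F has_real_derivative F' t) (at t)" "F' 0 = b"
    "(F' has_real_derivative c) (at 0)" "(F has_real_derivative b) (at 0)"
  using assms unfolding jet2_def by (metis eventually_nhds_x_imp_x)

lemma jet2_unique:
  assumes "jet2 F a b c" "jet2 F a' b' c'"
  shows "a = a'" "b = b'" "c = c'"
proof -
  obtain F' where F: "F 0 = a" "\<forall>\<^sub>F t in nhds 0. (F has_real_derivative F' t) (at t)" "F' 0 = b"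
    "(F' has_real_derivative c) (at 0)" "(F has_real_derivative b) (at 0)" using assms(1) by (rule jet2E)
  obtain G' where G: "F 0 = a'" "\<forall>\<^sub>F t in nhds 0. (F has_real_derivative G' t) (at t)" "G' 0 = b'"
    "(G' has_real_derivative c') (at 0)" "(F has_real_derivative b') (at 0)" using assms(2) by (rule jet2E)
  show "a = a'" using F G by simp
  show "b = b'" using F(5) G(5) by (rule DERIV_unique)
  have "\<forall>\<^sub>F t in nhds 0. F' t = G' t"
    using F(2) G(2) by eventually_elim (rule DERIV_unique)
  then have "(F' has_real_derivative c') (at 0)" using G(4) DERIV_cong_ev[of 0 0 F' G' c' c'] by simp
  then show "c = c'" by (rule DERIV_unique[OF F(4)])
qed

named_theorems jet2_intros

lemma jet2_const [jet2_intros]: "jet2 (\<lambda>t. k) k 0 0"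
  by (rule jet2I[where F' = "\<lambda>t. 0"]) auto

lemma jet2_add [jet2_intros]:
  assumes "jet2 F a b c" "jet2 G a' b' c'"
  shows "jet2 (\<lambda>t. F t + G t) (a + a') (b + b') (c + c')"
proof -
  obtain F' where F: "F 0 = a" "\<forall>\<^sub>F t in nhds 0. (F has_real_derivative F' t) (at t)" "F' 0 = b"
    "(F' has_real_derivative c) (at 0)" "(F has_real_derivative b) (at 0)" using assms(1) by (rule jet2E)
  obtain G' where G: "G 0 = a'" "\<forall>\<^sub>F t in nhds 0. (G has_real_derivative G' t) (at t)" "G' 0 = b'"
    "(G' has_real_derivative c') (at 0)" "(G has_real_derivative b') (at 0)" using assms(2) by (rule jet2E)
  show ?thesis
  proof (rule jet2I[where F' = "\<lambda>t. F' t + G' t"])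
    show "\<forall>\<^sub>F t in nhds 0. ((\<lambda>t. F t + G t) has_real_derivative F' t + G' t) (at t)"
      using F(2) G(2) by eventually_elim (rule DERIV_add)
  qed (use F G in \<open>auto intro: DERIV_add\<close>)
qed

lemma jet2_mult [jet2_intros]:
  assumes "jet2 F a b c" "jet2 G a' b' c'"
  shows "jet2 (\<lambda>t. F t * G t) (a * a') (b * a' + a * b') (c * a' + 2 * b * b' + a * c')"
proof -
  obtain F' where F: "F 0 = a" "\<forall>\<^sub>F t in nhds 0. (F has_real_derivative F' t) (at t)" "F' 0 = b"
    "(F' has_real_derivative c) (at 0)" "(F has_real_derivative b) (at 0)" using assms(1) by (rule jet2E)
  obtain G' where G: "G 0 = a'" "\<forall>\<^sub>F t in nhds 0. (G has_real_derivative G' t) (at t)" "G' 0 = b'"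
    "(G' has_real_derivative c') (at 0)" "(G has_real_derivative b') (at 0)" using assms(2) by (rule jet2E)
  show ?thesis
  proof (rule jet2I[where F' = "\<lambda>t. F' t * G t + F t * G' t"])
    show "\<forall>\<^sub>F t in nhds 0. ((\<lambda>t. F t * G t) has_real_derivative F' t * G t + F t * G' t) (at t)"
      using F(2) G(2)
    proof eventually_elim
      case (elim t)
      then show ?case using DERIV_mult[OF elim] by (simp add: mult.commute)
    qed
    show "((\<lambda>t. F' t * G t + F t * G' t) has_real_derivative c * a' + 2 * b * b' + a * c') (at 0)"
      using DERIV_add[OF DERIV_mult[OF F(4) G(5)] DERIV_mult[OF F(5) G(4)]] F(1,3) G(1,3)
      by (simp add: algebra_simps)
  qed (use F G in auto)
qed

lemma jet2_diff [jet2_intros]: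
  assumes "jet2 F a b c" "jet2 G a' b' c'"
  shows "jet2 (\<lambda>t. F t - G t) (a - a') (b - b') (c - c')"
  using jet2_add[OF assms(1) jet2_mult[OF jet2_const[of "-1"] assms(2)]] by simp

lemma jet2_power2 [jet2_intros]:
  assumes "jet2 F a b c"
  shows "jet2 (\<lambda>t. (F t)\<^sup>2) (a\<^sup>2) (2 * a * b) (2 * a * c + 2 * b\<^sup>2)"
  using jet2_mult[OF assms assms] by (simp add: power2_eq_square algebra_simps)

lemma jet2_compose:
  assumes "jet2 F a b c" and h: "\<forall>\<^sub>F x in nhds a. (h has_real_derivative h' x) (at x)"
    and h': "(h' has_real_derivative h'') (at a)"
  shows "jet2 (\<lambda>t. h (F t)) (h a) (h' a * b) (h'' * b\<^sup>2 + h' a * c)"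
proof -
  obtain F' where F: "F 0 = a" "\<forall>\<^sub>F t in nhds 0. (F has_real_derivative F' t) (at t)" "F' 0 = b"
    "(F' has_real_derivative c) (at 0)" "(F has_real_derivative b) (at 0)" using assms(1) by (rule jet2E)
  have "isCont F 0" using F(5) by (rule DERIV_isCont)
  then have "filterlim F (nhds a) (nhds 0)" using F(1) by (simp add: continuous_at tendsto_nhds_iff)
  then have ev: "\<forall>\<^sub>F t in nhds 0. (h has_real_derivative h' (F t)) (at (F t))"
    by (rule eventually_compose_filterlim[OF h])
  show ?thesis
  proof (rule jet2I[where F' = "\<lambda>t. h' (F t) * F' t"])
    show "\<forall>\<^sub>F t in nhds 0. ((\<lambda>t. h (F t)) has_real_derivative h' (F t) * F' t) (at t)"
      using ev F(2) by eventually_elim (rule DERIV_chain2)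
    show "((\<lambda>t. h' (F t) * F' t) has_real_derivative h'' * b\<^sup>2 + h' a * c) (at 0)"
      using DERIV_mult[OF DERIV_chain2[of h' h'' F 0, OF _ F(5)] F(4)] h' F(1,3)
      by (simp add: power2_eq_square algebra_simps)
  qed (use F in auto)
qed

lemma jet2_inverse:
  assumes "jet2 F a b c" "a \<noteq> 0"
  shows "jet2 (\<lambda>t. inverse (F t)) (1 / a) (- b / a\<^sup>2) (2 * b\<^sup>2 / a ^ 3 - c / a\<^sup>2)"
proof -
  have "open (- {0::real})" by (rule open_Compl) simp
  then have "\<forall>\<^sub>F x in nhds a. x \<in> - {0}" by (rule eventually_nhds_in_open) (use assms in simp)
  then have "\<forall>\<^sub>F x in nhds a. (inverse has_real_derivative - 1 / x\<^sup>2) (at x)"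
    by eventually_elim (auto intro!: derivative_eq_intros simp: power2_eq_square field_simps)
  moreover have "((\<lambda>x. - 1 / x\<^sup>2) has_real_derivative 2 / a ^ 3) (at a)"
    using assms(2) by (auto intro!: derivative_eq_intros simp: field_simps power2_eq_square power3_eq_cube)
  ultimately have "jet2 (\<lambda>t. inverse (F t)) (inverse a) (- 1 / a\<^sup>2 * b) (2 / a ^ 3 * b\<^sup>2 + - 1 / a\<^sup>2 * c)"
    by (rule jet2_compose[OF assms(1)])
  then show ?thesis by (simp add: inverse_eq_divide)
qed

lemma jet2_divide [jet2_intros]:
  assumes "jet2 F a b c" "jet2 G a' b' c'" "a' \<noteq> 0"
  shows "jet2 (\<lambda>t. F t / G t) (a / a') (b / a' - a * b' / a'\<^sup>2)
    (c / a' - 2 * b * b' / a'\<^sup>2 + a * (2 * b'\<^sup>2 / a' ^ 3 - c' / a'\<^sup>2))"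
  using jet2_mult[OF assms(1) jet2_inverse[OF assms(2,3)]] by (simp add: divide_inverse mult.assoc)

lemma jet2_inverse_sqrt_5:
  assumes "jet2 F a b c" "a > 0"
  shows "jet2 (\<lambda>t. inverse (sqrt (F t)) ^ 5) (inverse (sqrt a) ^ 5) (- (5/2) * inverse (sqrt a) ^ 5 * b / a)
    (inverse (sqrt a) ^ 5 * (35/4 * b\<^sup>2 / a\<^sup>2 - 5/2 * c / a))"
proof -
  have d: "((\<lambda>x. inverse (sqrt x) ^ n) has_real_derivative - (real n / 2) * inverse (sqrt x) ^ (n + 2)) (at x)"
    if "x > 0" for x n
  proof -
    have "((\<lambda>x. inverse (sqrt x)) has_real_derivative - (1/2) * inverse (sqrt x) ^ 3) (at x)"
      using that by (auto intro!: derivative_eq_intros simp: field_simps power2_eq_square power3_eq_cube)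
    then show ?thesis
      by (rule DERIV_cong[OF DERIV_power])
        (cases n; simp add: power_add[symmetric] algebra_simps power3_eq_cube power2_eq_square)
  qed
  have "\<forall>\<^sub>F x in nhds a. x \<in> {0<..}" by (rule eventually_nhds_in_open) (use assms in auto)
  then have 1: "\<forall>\<^sub>F x in nhds a. ((\<lambda>x. inverse (sqrt x) ^ 5) has_real_derivative - (5 / 2) * inverse (sqrt x) ^ 7) (at x)"
    by eventually_elim (use d[of _ 5] in simp)
  have 2: "((\<lambda>x. - (5 / 2) * inverse (sqrt x) ^ 7) has_real_derivative 35/4 * inverse (sqrt a) ^ 9) (at a)"
    using DERIV_cmult[OF d[OF assms(2), of 7], of "- (5/2)"] by simp
  have i: "inverse (sqrt a) ^ 2 = 1 / a" using assms(2) by (simp add: inverse_eq_divide power_divide)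
  have "inverse (sqrt a) ^ 7 = inverse (sqrt a) ^ 5 * inverse (sqrt a) ^ 2"
    "inverse (sqrt a) ^ 9 = inverse (sqrt a) ^ 5 * (inverse (sqrt a) ^ 2)\<^sup>2"
    by (simp_all flip: power_add power_mult)
  then have 3: "inverse (sqrt a) ^ 7 = inverse (sqrt a) ^ 5 / a" "inverse (sqrt a) ^ 9 = inverse (sqrt a) ^ 5 / a\<^sup>2"
    unfolding i by (simp_all add: power_divide)
  show ?thesis using jet2_compose[OF assms(1) 1 2] unfolding 3 by (simp add: algebra_simps)
qed

text \<open>Running through a curve at time \<open>t\<^sup>2 / 2\<close> makes its velocity appear as an acceleration. In this way
  the first variation is read off from the second-order formula with zero velocity.\<close>
lemma jet2_square_time:
  assumes "jet2 F a b c"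
  shows "jet2 (\<lambda>t. F (t\<^sup>2 / 2)) a 0 b"
proof -
  obtain F' where F: "F 0 = a" "\<forall>\<^sub>F t in nhds 0. (F has_real_derivative F' t) (at t)" "F' 0 = b"
    "(F' has_real_derivative c) (at 0)" "(F has_real_derivative b) (at 0)" using assms(1) by (rule jet2E)
  have "((\<lambda>t::real. t\<^sup>2 / 2) \<longlongrightarrow> 0\<^sup>2 / 2) (at 0)" by (intro tendsto_intros) auto
  then have "filterlim (\<lambda>t::real. t\<^sup>2 / 2) (nhds 0) (nhds 0)" by (simp add: tendsto_nhds_iff)
  then have ev: "\<forall>\<^sub>F t in nhds 0. (F has_real_derivative F' (t\<^sup>2 / 2)) (at (t\<^sup>2 / 2))"
    by (rule eventually_compose_filterlim[OF F(2)])
  have sq: "((\<lambda>t. t\<^sup>2 / 2) has_real_derivative t) (at t)" for t :: real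
    by (auto intro!: derivative_eq_intros)
  show ?thesis
  proof (rule jet2I[where F' = "\<lambda>t. F' (t\<^sup>2 / 2) * t"])
    show "\<forall>\<^sub>F t in nhds 0. ((\<lambda>t. F (t\<^sup>2 / 2)) has_real_derivative F' (t\<^sup>2 / 2) * t) (at t)"
      using ev by eventually_elim (rule DERIV_chain2[OF _ sq])
    show "((\<lambda>t. F' (t\<^sup>2 / 2) * t) has_real_derivative b) (at 0)"
      using DERIV_mult[OF DERIV_chain2[of F' c "\<lambda>t. t\<^sup>2 / 2" 0 0, OF _ sq] DERIV_ident] F(3,4) by simp
  qed (use F in auto)
qed

lemma jet2_cong: "jet2 F a b c \<Longrightarrow> a = a' \<Longrightarrow> b = b' \<Longrightarrow> c = c' \<Longrightarrow> jet2 F a' b' c'"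
  by simp

text \<open>The quadratic part of the second time derivative of the integrand, up to the factor
  \<open>T / 2 (T q)\<^sup>-\<^sup>5\<^sup>/\<^sup>2\<close>, for a velocity that moves only \<open>\<rho>\<close>: \<open>g\<close> is the velocity of \<open>\<rho>\<close>, the other
  arguments are its derivatives in the two basis directions.\<close>
definition hess_quadratic :: "real \<Rightarrow> real \<Rightarrow> real \<Rightarrow> real \<Rightarrow> real \<Rightarrow> real \<Rightarrow> real \<Rightarrow> real \<Rightarrow> real \<Rightarrow> real" where
  "hess_quadratic T q s g r1 r2 r11 r12 r22 = - T * g * q * r22 * s^2 - 4 * T * g * q^2 * r22 - T * q * r11 * r22 + 2 * T * q * r12^2 - 5 * T * q * r2^2 * s^2 / 4 + 4 * T^2 * g * q * r11 + 8 * T^2 * g * q * r12 * s + 8 * T^2 * g * q^2 * r22 + 3 * T^2 * g * r11 * s^2 + 5 * T^2 * g^2 * q * s^2 + 8 * T^2 * g^2 * q^2 + 3 * T^2 * g^2 * s^4 / 4 + 6 * T^2 * q * r1 * r2 * s + T^2 * q^2 * r2^2 + 7 * T^2 * r1^2 * s^2 / 4 + T^2 * r11^2 / 2 - T^3 * g^2 * q * s^2 - 4 * T^3 * g^2 * q^2 + T^3 * q * r1^2 + q^2 * r22^2 / 2"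

text \<open>The dependence of the second time derivative of the integrand on the accelerations of \<open>\<psi>\<^sub>1\<close>, \<open>\<eta>\<^sub>2\<close>
  and the second derivatives of \<open>\<rho>\<close>.\<close>
definition hess_linear :: "real \<Rightarrow> real \<Rightarrow> real \<Rightarrow> real \<Rightarrow> real \<Rightarrow> real \<Rightarrow> real \<Rightarrow> real \<Rightarrow> real" where
  "hess_linear T q s P1 E2 R11 R12 R22 = 2 * E2 * T^2 * q^2 * s^2 + 8 * E2 * T^3 * q^3 + 2 * P1 * T^2 * q^2 * s^2 + 8 * P1 * T^3 * q^3 - 2 * R11 * T^2 * q * s - 8 * R12 * T^2 * q^2 + 2 * R22 * T * q^2 * s"

text \<open>The values at time \<open>0\<close> are those of a Clifford torus in a basis whose first vector is horizontal
  with \<open>\<psi> = 1\<close> and whose second is the Hopf direction. The velocities of \<open>\<psi>\<close> vanish, and since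
  \<open>\<eta> = \<rho> \<psi> + d\<theta>\<close> the velocity of \<open>\<eta>\<^sub>1\<close> equals that of \<open>\<rho>\<close>. The coefficient of the acceleration \<open>rr\<close> is,
  up to a positive factor, the derivative of the integrand along the Clifford tori.\<close>
lemma jet_density_jet2:
  fixes T \<alpha> g rr :: real
  assumes T: "T > 0" and \<alpha>: "0 < \<alpha>" "\<alpha> < 1"
    and \<rho>: "jet2 fh \<alpha> g rr" and fr1: "jet2 fr1 0 r1 R1" and fr2: "jet2 fr2 0 r2 R2"
    and fp1: "jet2 fp1 1 0 P1" and fp2: "jet2 fp2 0 0 P2" and fe1: "jet2 fe1 0 g E1" and fe2: "jet2 fe2 1 0 E2"
    and fr11: "jet2 fr11 0 r11 R11" and fr12: "jet2 fr12 0 r12 R12" and fr22: "jet2 fr22 0 r22 R22"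
    and fp11: "jet2 fp11 0 0 P11" and fp12: "jet2 fp12 0 0 P12" and fp22: "jet2 fp22 0 0 P22"
    and fe11: "jet2 fe11 0 r1 E11" and fe12: "jet2 fe12 0 (r2 / 2) E12" and fe22: "jet2 fe22 0 0 E22"
  defines "q \<equiv> \<alpha> * (1 - \<alpha>)" and "s \<equiv> 1 - 2 * \<alpha>"
  shows "\<exists>a b. jet2 (\<lambda>t. jet_density T (fh t) (fr1 t) (fr2 t) (fp1 t) (fp2 t) (fe1 t) (fe2 t) (fr11 t) (fr12 t) (fr22 t)
      (fp11 t) (fp12 t) (fp22 t) (fe11 t) (fe12 t) (fe22 t)) a b
    (T / 4 * inverse (sqrt (T * q)) ^ 5 * (2 * hess_quadratic T q s g r1 r2 r11 r12 r22
      + hess_linear T q s P1 E2 R11 R12 R22 + T^2 * q * s * (4 * T * q - 8 * q - s^2) * rr))"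
proof -
  have q: "q > 0" using \<alpha> by (simp add: q_def)
  define Q S where "Q = (\<lambda>t. fh t * (1 - fh t))" and "S = (\<lambda>t. 1 - 2 * fh t)"
  note base = \<rho> fr1 fr2 fp1 fp2 fe1 fe2 fr11 fr12 fr22 fp11 fp12 fp22 fe11 fe12 fe22
  have jQ: "jet2 Q q (s * g) (s * rr - 2 * g^2)"
    unfolding Q_def by (rule jet2_cong, (rule jet2_intros \<rho>)+) (simp_all add: q_def s_def algebra_simps power2_eq_square)
  have jS: "jet2 S s (- 2 * g) (- 2 * rr)"
    unfolding S_def by (rule jet2_cong, (rule jet2_intros \<rho>)+) (simp_all add: s_def)

  define G11 where "G11 = (\<lambda>t. metric_form (Q t) T (fr1 t) (fp1 t) (fe1 t) (fr1 t) (fp1 t) (fe1 t))"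
  have jG11: "jet2 G11 (q) (g * s) (2 * P1 * q + 2 * T * g^2 - 2 * g^2 + r1^2 / (2 * q) + rr * s)"
    unfolding G11_def metric_form_def by (rule jet2_cong, (rule jet2_intros jQ base | use q in \<open>simp; fail\<close>)+,
      (use q in \<open>simp_all add: field_simps power2_eq_square power3_eq_cube power4_eq_xxxx\<close>)?)
  define G12 where "G12 = (\<lambda>t. metric_form (Q t) T (fr1 t) (fp1 t) (fe1 t) (fr2 t) (fp2 t) (fe2 t))"
  have jG12: "jet2 G12 (0) (T * g) (E1 * T + P2 * q + r1 * r2 / (2 * q))"
    unfolding G12_def metric_form_def by (rule jet2_cong, (rule jet2_intros jQ base | use q in \<open>simp; fail\<close>)+,
      (use q in \<open>simp_all add: field_simps power2_eq_square power3_eq_cube power4_eq_xxxx\<close>)?)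
  define G22 where "G22 = (\<lambda>t. metric_form (Q t) T (fr2 t) (fp2 t) (fe2 t) (fr2 t) (fp2 t) (fe2 t))"
  have jG22: "jet2 G22 (T) (0) (2 * E2 * T + r2^2 / (2 * q))"
    unfolding G22_def metric_form_def by (rule jet2_cong, (rule jet2_intros jQ base | use q in \<open>simp; fail\<close>)+,
      (use q in \<open>simp_all add: field_simps power2_eq_square power3_eq_cube power4_eq_xxxx\<close>)?)
  define c1 where "c1 = (\<lambda>t. fp1 t * fe2 t - fe1 t * fp2 t)"
  have jc1: "jet2 c1 (1) (0) (E2 + P1)"
    unfolding c1_def  by (rule jet2_cong, (rule jet2_intros base | use q in \<open>simp; fail\<close>)+,
      (use q in \<open>simp_all add: field_simps power2_eq_square power3_eq_cube power4_eq_xxxx\<close>)?)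
  define c2 where "c2 = (\<lambda>t. fe1 t * fr2 t - fr1 t * fe2 t)"
  have jc2: "jet2 c2 (0) (- r1) (- R1 + 2 * g * r2)"
    unfolding c2_def  by (rule jet2_cong, (rule jet2_intros base | use q in \<open>simp; fail\<close>)+,
      (use q in \<open>simp_all add: field_simps power2_eq_square power3_eq_cube power4_eq_xxxx\<close>)?)
  define c3 where "c3 = (\<lambda>t. fr1 t * fp2 t - fp1 t * fr2 t)"
  have jc3: "jet2 c3 (0) (- r2) (- R2)"
    unfolding c3_def  by (rule jet2_cong, (rule jet2_intros base | use q in \<open>simp; fail\<close>)+,
      (use q in \<open>simp_all add: field_simps power2_eq_square power3_eq_cube power4_eq_xxxx\<close>)?)
  define A11 where "A11 = (\<lambda>t. height_form (Q t) (S t) T (fr1 t) (fp1 t) (fe1 t) (fr1 t) (fp1 t) (fe1 t) (fr11 t))"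
  have jA11: "jet2 A11 (- 2 * q * s) (- 4 * T * g * q + 4 * g * q - 2 * g * s^2 + r11) (- 4 * E1 * T * q - 4 * P1 * q * s + R11 - 8 * T * g^2 * s + 12 * g^2 * s - r1^2 * s / q + 4 * q * rr - 2 * rr * s^2)"
    unfolding A11_def height_form_def by (rule jet2_cong, (rule jet2_intros jQ jS base | use q in \<open>simp; fail\<close>)+,
      (use q in \<open>simp_all add: field_simps power2_eq_square power3_eq_cube power4_eq_xxxx\<close>)?)
  define B11 where "B11 = (\<lambda>t. psi_form (Q t) (S t) T (fr1 t) (fp1 t) (fe1 t) (fr1 t) (fp1 t) (fe1 t) (fp11 t))"
  have jB11: "jet2 B11 (0) (r1 * s / q) (P11 + R1 * s / q + 2 * T * g * r1 / q - 2 * g * r1 * s^2 / q^2 - 4 * g * r1 / q)"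
    unfolding B11_def psi_form_def by (rule jet2_cong, (rule jet2_intros jQ jS base | use q in \<open>simp; fail\<close>)+,
      (use q in \<open>simp_all add: field_simps power2_eq_square power3_eq_cube power4_eq_xxxx\<close>)?)
  define K11 where "K11 = (\<lambda>t. c1 t * A11 t + c2 t * B11 t + c3 t * fe11 t)"
  have jK11: "jet2 K11 (- 2 * q * s) (- 4 * T * g * q + 4 * g * q - 2 * g * s^2 + r11) (- 4 * E1 * T * q - 2 * E2 * q * s - 6 * P1 * q * s + R11 - 8 * T * g^2 * s + 12 * g^2 * s - 3 * r1^2 * s / q + 4 * q * rr - 2 * r1 * r2 - 2 * rr * s^2)"
    unfolding K11_def  by (rule jet2_cong, (rule jet2_intros jc1 jc2 jc3 jA11 jB11 base | use q in \<open>simp; fail\<close>)+,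
      (use q in \<open>simp_all add: field_simps power2_eq_square power3_eq_cube power4_eq_xxxx\<close>)?)
  define A12 where "A12 = (\<lambda>t. height_form (Q t) (S t) T (fr1 t) (fp1 t) (fe1 t) (fr2 t) (fp2 t) (fe2 t) (fr12 t))"
  have jA12: "jet2 A12 (- 2 * T * q) (- 2 * T * g * s + r12) (- 2 * E2 * T * q - 2 * P1 * T * q - 2 * P2 * q * s + R12 + 4 * T * g^2 - 2 * T * rr * s - r1 * r2 * s / q)"
    unfolding A12_def height_form_def by (rule jet2_cong, (rule jet2_intros jQ jS base | use q in \<open>simp; fail\<close>)+,
      (use q in \<open>simp_all add: field_simps power2_eq_square power3_eq_cube power4_eq_xxxx\<close>)?)
  define B12 where "B12 = (\<lambda>t. psi_form (Q t) (S t) T (fr1 t) (fp1 t) (fe1 t) (fr2 t) (fp2 t) (fe2 t) (fp12 t))"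
  have jB12: "jet2 B12 (0) (T * r1 / (2 * q) + r2 * s / (2 * q)) (P12 + R1 * T / (2 * q) + R2 * s / (2 * q) - T * g * r1 * s / q^2 + T * g * r2 / q - g * r2 * s^2 / q^2 - 2 * g * r2 / q)"
    unfolding B12_def psi_form_def by (rule jet2_cong, (rule jet2_intros jQ jS base | use q in \<open>simp; fail\<close>)+,
      (use q in \<open>simp_all add: field_simps power2_eq_square power3_eq_cube power4_eq_xxxx\<close>)?)
  define K12 where "K12 = (\<lambda>t. c1 t * A12 t + c2 t * B12 t + c3 t * fe12 t)"
  have jK12: "jet2 K12 (- 2 * T * q) (- 2 * T * g * s + r12) (- 4 * E2 * T * q - 4 * P1 * T * q - 2 * P2 * q * s + R12 + 4 * T * g^2 - T * r1^2 / q - 2 * T * rr * s - 2 * r1 * r2 * s / q - r2^2)"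
    unfolding K12_def  by (rule jet2_cong, (rule jet2_intros jc1 jc2 jc3 jA12 jB12 base | use q in \<open>simp; fail\<close>)+,
      (use q in \<open>simp_all add: field_simps power2_eq_square power3_eq_cube power4_eq_xxxx\<close>)?)
  define A22 where "A22 = (\<lambda>t. height_form (Q t) (S t) T (fr2 t) (fp2 t) (fe2 t) (fr2 t) (fp2 t) (fe2 t) (fr22 t))"
  have jA22: "jet2 A22 (0) (r22) (- 4 * P2 * T * q + R22 - r2^2 * s / q)"
    unfolding A22_def height_form_def by (rule jet2_cong, (rule jet2_intros jQ jS base | use q in \<open>simp; fail\<close>)+,
      (use q in \<open>simp_all add: field_simps power2_eq_square power3_eq_cube power4_eq_xxxx\<close>)?)
  define B22 where "B22 = (\<lambda>t. psi_form (Q t) (S t) T (fr2 t) (fp2 t) (fe2 t) (fr2 t) (fp2 t) (fe2 t) (fp22 t))"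
  have jB22: "jet2 B22 (0) (T * r2 / q) (P22 + R2 * T / q - 2 * T * g * r2 * s / q^2)"
    unfolding B22_def psi_form_def by (rule jet2_cong, (rule jet2_intros jQ jS base | use q in \<open>simp; fail\<close>)+,
      (use q in \<open>simp_all add: field_simps power2_eq_square power3_eq_cube power4_eq_xxxx\<close>)?)
  define K22 where "K22 = (\<lambda>t. c1 t * A22 t + c2 t * B22 t + c3 t * fe22 t)"
  have jK22: "jet2 K22 (0) (r22) (- 4 * P2 * T * q + R22 - 2 * T * r1 * r2 / q - r2^2 * s / q)"
    unfolding K22_def  by (rule jet2_cong, (rule jet2_intros jc1 jc2 jc3 jA22 jB22 base | use q in \<open>simp; fail\<close>)+,
      (use q in \<open>simp_all add: field_simps power2_eq_square power3_eq_cube power4_eq_xxxx\<close>)?)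
  define P where "P = (\<lambda>t. G22 t * K11 t + G11 t * K22 t - 2 * G12 t * K12 t)"
  have jP: "jet2 P (- 2 * T * q * s) (4 * T * g * q - 2 * T * g * s^2 + T * r11 + q * r22) (- 6 * E2 * T * q * s - 6 * P1 * T * q * s + R11 * T + R22 * q - 4 * T * g * r12 + 12 * T * g^2 * s - 3 * T * r1^2 * s / q + 4 * T * q * rr - 2 * T * r1 * r2 - 2 * T * rr * s^2 + 2 * g * r22 * s - 2 * r2^2 * s)"
    unfolding P_def  by (rule jet2_cong, (rule jet2_intros jG11 jG12 jG22 jK11 jK12 jK22 | use q in \<open>simp; fail\<close>)+,
      (use q in \<open>simp_all add: field_simps power2_eq_square power3_eq_cube power4_eq_xxxx\<close>)?)
  define D where "D = (\<lambda>t. G11 t * G22 t - (G12 t)\<^sup>2)"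
  have jD: "jet2 D (T * q) (T * g * s) (2 * E2 * T * q + 2 * P1 * T * q - 2 * T * g^2 + T * r1^2 / (2 * q) + T * rr * s + r2^2 / 2)"
    unfolding D_def  by (rule jet2_cong, (rule jet2_intros jG11 jG12 jG22 | use q in \<open>simp; fail\<close>)+,
      (use q in \<open>simp_all add: field_simps power2_eq_square power3_eq_cube power4_eq_xxxx\<close>)?)
  define dK where "dK = (\<lambda>t. K11 t * K22 t - (K12 t)\<^sup>2)"
  have jdK: "jet2 dK (- 4 * T^2 * q^2) (4 * T * q * r12 - 8 * T^2 * g * q * s - 2 * q * r22 * s) (- 16 * E2 * T^2 * q^2 - 16 * P1 * T^2 * q^2 + 4 * R12 * T * q - 2 * R22 * q * s - 8 * T * g * q * r22 + 8 * T * g * r12 * s - 4 * T * q * r2^2 - 4 * T * r1 * r2 * s + 16 * T^2 * g^2 * q - 8 * T^2 * g^2 * s^2 - 8 * T^2 * q * rr * s - 4 * T^2 * r1^2 + 8 * g * q * r22 - 4 * g * r22 * s^2 + 2 * r11 * r22 - 2 * r12^2 + 2 * r2^2 * s^2)"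
    unfolding dK_def  by (rule jet2_cong, (rule jet2_intros jK11 jK12 jK22 | use q in \<open>simp; fail\<close>)+,
      (use q in \<open>simp_all add: field_simps power2_eq_square power3_eq_cube power4_eq_xxxx\<close>)?)
  define W where "W = (\<lambda>t. (P t)\<^sup>2 / 2 - 2 * D t * dK t)"
  have jW: "jet2 W (2 * T^2 * q^2 * s^2 + 8 * T^3 * q^3) (2 * T * q^2 * r22 * s + 4 * T^2 * g * q * s^3 - 8 * T^2 * g * q^2 * s - 2 * T^2 * q * r11 * s - 8 * T^2 * q^2 * r12 + 24 * T^3 * g * q^2 * s) (12 * E2 * T^2 * q^2 * s^2 + 48 * E2 * T^3 * q^3 + 12 * P1 * T^2 * q^2 * s^2 + 48 * P1 * T^3 * q^3 - 2 * R11 * T^2 * q * s - 8 * R12 * T^2 * q^2 + 2 * R22 * T * q^2 * s + 8 * T * g * q * r22 * s^2 - 8 * T * g * q^2 * r22 - 2 * T * q * r11 * r22 + 4 * T * q * r12^2 + 8 * T^2 * g * q * r11 - 24 * T^2 * g * q * r12 * s + 16 * T^2 * g * q^2 * r22 - 4 * T^2 * g * r11 * s^2 - 40 * T^2 * g^2 * q * s^2 + 16 * T^2 * g^2 * q^2 + 4 * T^2 * g^2 * s^4 + 12 * T^2 * q * r1 * r2 * s + 4 * T^2 * q * rr * s^3 + 12 * T^2 * q^2 * r2^2 - 8 * T^2 * q^2 * rr * s + 6 * T^2 * r1^2 * s^2 + T^2 * r11^2 + 48 * T^3 * g^2 * q * s^2 - 48 * T^3 * g^2 * q^2 + 12 *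 T^3 * q * r1^2 + 24 * T^3 * q^2 * rr * s + q^2 * r22^2)"
    unfolding W_def  by (rule jet2_cong, (rule jet2_intros jP jD jdK | use q in \<open>simp; fail\<close>)+,
      (use q in \<open>simp_all add: field_simps power2_eq_square power3_eq_cube power4_eq_xxxx\<close>)?)

  \<comment> \<open>the second derivative of \<open>W (det G)\<^sup>-\<^sup>5\<^sup>/\<^sup>2\<close> in terms of the jets of \<open>W\<close> and of the determinant\<close>
  define W0 W1 W2 \<Delta>1 \<Delta>2 \<kappa> where "W0 = 2 * T^2 * q^2 * s^2 + 8 * T^3 * q^3"
    and "W1 = 2 * T * q^2 * r22 * s + 4 * T^2 * g * q * s^3 - 8 * T^2 * g * q^2 * s - 2 * T^2 * q * r11 * s - 8 * T^2 * q^2 * r12 + 24 * T^3 * g * q^2 * s"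
    and "W2 = 12 * E2 * T^2 * q^2 * s^2 + 48 * E2 * T^3 * q^3 + 12 * P1 * T^2 * q^2 * s^2 + 48 * P1 * T^3 * q^3 - 2 * R11 * T^2 * q * s - 8 * R12 * T^2 * q^2 + 2 * R22 * T * q^2 * s + 8 * T * g * q * r22 * s^2 - 8 * T * g * q^2 * r22 - 2 * T * q * r11 * r22 + 4 * T * q * r12^2 + 8 * T^2 * g * q * r11 - 24 * T^2 * g * q * r12 * s + 16 * T^2 * g * q^2 * r22 - 4 * T^2 * g * r11 * s^2 - 40 * T^2 * g^2 * q * s^2 + 16 * T^2 * g^2 * q^2 + 4 * T^2 * g^2 * s^4 + 12 * T^2 * q * r1 * r2 * s + 4 * T^2 * q * rr * s^3 + 12 * T^2 * q^2 * r2^2 - 8 * T^2 * q^2 * rr * s + 6 * T^2 * r1^2 * s^2 + T^2 * r11^2 + 48 * T^3 * g^2 * q * s^2 - 48 * T^3 * g^2 * q^2 + 12 * T^3 * q * r1^2 + 24 * T^3 * q^2 * rr * s + q^2 * r22^2"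
    and "\<Delta>1 = T * g * s" and "\<Delta>2 = 2 * E2 * T * q + 2 * P1 * T * q - 2 * T * g^2 + T * r1^2 / (2 * q) + T * rr * s + r2^2 / 2" and "\<kappa> = inverse (sqrt (T * q)) ^ 5"
  note J = jet2_mult[OF jet2_mult[OF jet2_const[of "T / 4"] jW] jet2_inverse_sqrt_5[OF jD],
      folded W0_def W1_def W2_def \<Delta>1_def \<Delta>2_def \<kappa>_def]
  have "\<exists>a b. jet2 (\<lambda>t. T / 4 * W t * inverse (sqrt (D t)) ^ 5) a b
    (T / 4 * \<kappa> * (W2 - 5 * W1 * (\<Delta>1 / (T * q)) + W0 * (35/4 * (\<Delta>1 / (T * q))\<^sup>2 - 5/2 * (\<Delta>2 / (T * q)))))"
    by (intro exI, rule jet2_cong[OF J refl refl]) (use q T in \<open>simp_all add: power_divide algebra_simps\<close>)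
  moreover have "W2 - 5 * W1 * (\<Delta>1 / (T * q)) + W0 * (35/4 * (\<Delta>1 / (T * q))\<^sup>2 - 5/2 * (\<Delta>2 / (T * q)))
      = 2 * hess_quadratic T q s g r1 r2 r11 r12 r22 + hess_linear T q s P1 E2 R11 R12 R22 + T^2 * q * s * (4 * T * q - 8 * q - s^2) * rr"
  proof -
    have 1: "\<Delta>1 / (T * q) = g * s / q" unfolding \<Delta>1_def using q T by simp
    have 2: "\<Delta>2 / (T * q) = 2 * E2 + 2 * P1 + r2^2 / (2 * T * q) - 2 * g^2 / q + r1^2 / (2 * q^2) + rr * s / q"
      unfolding \<Delta>2_def using q T by (simp add: field_simps power2_eq_square)
    show ?thesis
      unfolding 1 2 W0_def W1_def W2_def hess_quadratic_def hess_linear_def using q T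
      by (simp add: field_simps power2_eq_square power3_eq_cube power4_eq_xxxx)
  qed
  ultimately show ?thesis
    unfolding jet_density_def Let_def form_density_def W_def P_def D_def dK_def K11_def K12_def K22_def G11_def G12_def G22_def
      A11_def A12_def A22_def B11_def B12_def B22_def c1_def c2_def c3_def Q_def S_def \<kappa>_def
    by simp
qed

section \<open>Families of doubly periodic functions\<close>

text \<open>A family of maps of the plane is treated as a map on a slab, time being the first coordinate.\<close>
abbreviation slab :: "real \<Rightarrow> (real \<times> real \<times> real) set" where
  "slab \<delta> \<equiv> {-\<delta><..<\<delta>} \<times> UNIV"

abbreviation tdir :: "real \<times> real \<times> real" where "tdir \<equiv> (1, 0)"

lemma open_slab: "open (slab \<delta>)"
  by (intro open_Times) auto

lemma dird_slice:
  fixes G :: "real \<times> real \<times> real \<Rightarrow> 'b::real_normed_vector"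
  assumes "smooth_on (slab \<delta>) G" "t \<in> {-\<delta><..<\<delta>}"
  shows "dird v (\<lambda>x. G (t, x)) x = dird (0, v) G (t, x)"
proof (rule dirdI)
  have "((\<lambda>x. (t, x)) has_derivative (\<lambda>h. (0, h))) (at x)" by (auto intro!: derivative_eq_intros)
  from has_derivative_compose[OF this smooth_on_has_derivative[OF assms(1)]] assms(2)
  show "((\<lambda>x. G (t, x)) has_derivative (\<lambda>v. dird (0, v) G (t, x))) (at x)" by simp
qed

lemma smooth_slice:
  fixes G :: "real \<times> real \<times> real \<Rightarrow> 'b::real_normed_vector"
  assumes "smooth_on (slab \<delta>) G" "t \<in> {-\<delta><..<\<delta>}"
  shows "smooth_on UNIV (\<lambda>x. G (t, x))"
  unfolding smooth_on_def
proof
  fix k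
  have "Ck_on k UNIV (\<lambda>x. G (t, x))" if "smooth_on (slab \<delta>) G" for G :: "real \<times> real \<times> real \<Rightarrow> 'b"
    using that
  proof (induction k arbitrary: G)
    case 0
    have "continuous_on UNIV (\<lambda>x. G (t, x))"
      by (rule continuous_on_compose2[OF smooth_on_continuous[OF 0]]) (use assms(2) in \<open>auto intro!: continuous_intros\<close>)
    then show ?case by simp
  next
    case (Suc k)
    show ?case
    proof (rule Ck_on_SucI)
      have "((\<lambda>x. (t, x)) has_derivative (\<lambda>h. (0, h))) (at x)" for x :: "real \<times> real"
        by (auto intro!: derivative_eq_intros)
      from has_derivative_compose[OF this smooth_on_has_derivative[OF Suc.prems]] assms(2)
      show "((\<lambda>x. G (t, x)) has_derivative (\<lambda>v. dird (0, v) G (t, x))) (at x)" for x by simp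
      show "Ck_on k UNIV (\<lambda>x. dird (0, v) G (t, x))" for v
        by (rule Suc.IH[OF smooth_on_dird[OF Suc.prems]])
    qed simp
  qed
  then show "Ck_on k UNIV (\<lambda>x. G (t, x))" using assms(1) by blast
qed

lemma time_derivative:
  fixes G :: "real \<times> real \<times> real \<Rightarrow> real"
  assumes "smooth_on (slab \<delta>) G" "t \<in> {-\<delta><..<\<delta>}"
  shows "((\<lambda>t. G (t, x)) has_real_derivative dird tdir G (t, x)) (at t)"
proof -
  have "(0, x) + t *\<^sub>R tdir = (t, x)" for t by simp
  then show ?thesis
    using smooth_on_line_derivative[OF assms(1), of "(0, x)" t tdir] assms(2) by simp
qed

lemma jet2_smooth:
  fixes G :: "real \<times> real \<times> real \<Rightarrow> real"
  assumes "smooth_on (slab \<delta>) G" "\<delta> > 0"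
  shows "jet2 (\<lambda>t. G (t, x)) (G (0, x)) (dird tdir G (0, x)) (dird tdir (dird tdir G) (0, x))"
proof (rule jet2I[where F' = "\<lambda>t. dird tdir G (t, x)"])
  have "\<forall>\<^sub>F t in nhds 0. t \<in> {-\<delta><..<\<delta>}"
    by (rule eventually_nhds_in_open) (use assms(2) in auto)
  then show "\<forall>\<^sub>F t in nhds 0. ((\<lambda>t. G (t, x)) has_real_derivative dird tdir G (t, x)) (at t)"
    by eventually_elim (rule time_derivative[OF assms(1)])
  show "((\<lambda>t. dird tdir G (t, x)) has_real_derivative dird tdir (dird tdir G) (0, x)) (at 0)"
    by (rule time_derivative[OF smooth_on_dird[OF assms(1)]]) (use assms(2) in simp)
qed simp_all

abbreviation cell :: "(real \<times> real) set" where "cell \<equiv> cbox (0, 0) (2 * pi, 2 * pi)"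

lemma integral_time_derivative:
  fixes G :: "real \<times> real \<times> real \<Rightarrow> real"
  assumes G: "smooth_on (slab \<delta>) G" and t: "t \<in> {-\<delta><..<\<delta>}"
  shows "((\<lambda>t. integral cell (\<lambda>x. G (t, x))) has_real_derivative integral cell (\<lambda>x. dird tdir G (t, x))) (at t)"
proof -
  let ?U = "{-\<delta><..<\<delta>}"
  have c: "continuous_on cell (\<lambda>x. G (t, x))" if "t \<in> ?U" for t
    by (rule continuous_on_compose2[OF smooth_on_continuous[OF G]]) (use that in \<open>auto intro!: continuous_intros\<close>)
  have "((\<lambda>t. integral cell (\<lambda>x. G (t, x))) has_real_derivative integral cell (\<lambda>x. dird tdir G (t, x))) (at t within ?U)"
  proof (rule leibniz_rule_field_derivative)
    show "((\<lambda>t. G (t, x)) has_real_derivative dird tdir G (t, x)) (at t within ?U)" if "t \<in> ?U" for t x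
      using time_derivative[OF G that] by (rule has_field_derivative_at_within)
    show "(\<lambda>x. G (t, x)) integrable_on cell" if "t \<in> ?U" for t
      by (rule integrable_continuous[OF c[OF that]])
    have "continuous_on (?U \<times> cell) (dird tdir G)"
      by (rule continuous_on_subset[OF smooth_on_continuous[OF smooth_on_dird[OF G]]]) auto
    then show "continuous_on (?U \<times> cell) (\<lambda>(t, x). dird tdir G (t, x))" by (simp add: case_prod_beta')
    show "t \<in> ?U" by (rule t)
    show "convex ?U" by simp
  qed
  then show ?thesis using t by (simp add: at_within_open[of t ?U])
qed

text \<open>Fubini and the fundamental theorem of calculus in the direction of differentiation.\<close>
lemma integral_dird_periodic_2:
  fixes H :: "real \<times> real \<Rightarrow> real"
  assumes H: "smooth_on UNIV H" and p: "doubly_periodic H"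
  shows "integral cell (dird (0, 1) H) = 0" "integral cell (dird (1, 0) H) = 0"
proof -
  have c: "continuous_on cell (dird v H)" for v
    by (rule continuous_on_subset[OF smooth_on_continuous[OF smooth_on_dird[OF H]]]) simp
  have "integral (cbox 0 (2 * pi)) (\<lambda>v. dird (0, 1) H (u, v)) = 0" for u
  proof -
    have "((\<lambda>v. H (u, v)) has_vector_derivative dird (0, 1) H (u, v)) (at v within {0..2 * pi})" for v
    proof -
      have "(u, 0) + v *\<^sub>R (0, 1) = (u, v)" for v :: real by simp
      then have "((\<lambda>v. H (u, v)) has_real_derivative dird (0, 1) H (u, v)) (at v)"
        using smooth_on_line_derivative[OF H, of "(u, 0)" v "(0, 1)"] by simp
      then show ?thesis
        by (meson has_real_derivative_iff_has_vector_derivative has_vector_derivative_at_within)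
    qed
    then have "((\<lambda>v. dird (0, 1) H (u, v)) has_integral (H (u, 2 * pi) - H (u, 0))) {0..2 * pi}"
      by (intro fundamental_theorem_of_calculus) auto
    moreover have "H (u, 2 * pi) = H (u, 0)" using p unfolding doubly_periodic_def by (metis add_0)
    ultimately show ?thesis by (simp add: integral_unique)
  qed
  then show "integral cell (dird (0, 1) H) = 0"
    by (subst integral_prod_continuous[OF c]) simp
  have "integral (cbox 0 (2 * pi)) (\<lambda>u. dird (1, 0) H (u, v)) = 0" for v
  proof -
    have "((\<lambda>u. H (u, v)) has_vector_derivative dird (1, 0) H (u, v)) (at u within {0..2 * pi})" for u
    proof -
      have "(0, v) + u *\<^sub>R (1, 0) = (u, v)" for u :: real by simp
      then have "((\<lambda>u. H (u, v)) has_real_derivative dird (1, 0) H (u, v)) (at u)"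
        using smooth_on_line_derivative[OF H, of "(0, v)" u "(1, 0)"] by simp
      then show ?thesis
        by (meson has_real_derivative_iff_has_vector_derivative has_vector_derivative_at_within)
    qed
    then have "((\<lambda>u. dird (1, 0) H (u, v)) has_integral (H (2 * pi, v) - H (0, v))) {0..2 * pi}"
      by (intro fundamental_theorem_of_calculus) auto
    moreover have "H (2 * pi, v) = H (0, v)" using p unfolding doubly_periodic_def by (metis add_0)
    ultimately show ?thesis by (simp add: integral_unique)
  qed
  moreover have "integral (cbox 0 (2 * pi)) (\<lambda>u. integral (cbox 0 (2 * pi)) (\<lambda>v. dird (1, 0) H (u, v))) =
      integral (cbox 0 (2 * pi)) (\<lambda>v. integral (cbox 0 (2 * pi)) (\<lambda>u. dird (1, 0) H (u, v)))"
    by (rule integral_swap_continuous) (use c[of "(1, 0)"] in \<open>simp add: case_prod_beta'\<close>)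
  ultimately show "integral cell (dird (1, 0) H) = 0"
    by (subst integral_prod_continuous[OF c]) simp
qed

lemma dird_components:
  fixes H :: "real \<times> real \<Rightarrow> real"
  assumes "smooth_on UNIV H"
  shows "dird (v1, v2) H x = v1 * dird (1, 0) H x + v2 * dird (0, 1) H x"
proof -
  have "(v1, v2) = v1 *\<^sub>R (1, 0) + v2 *\<^sub>R (0, 1)" by simp
  then show ?thesis
    using linear_add[OF dird_linear[OF assms UNIV_I]] linear_scale[OF dird_linear[OF assms UNIV_I]] by (metis real_scaleR_def)
qed

lemma integral_dird_periodic:
  fixes H :: "real \<times> real \<Rightarrow> real"
  assumes H: "smooth_on UNIV H" and p: "doubly_periodic H"
  shows "(dird v H has_integral 0) cell"
proof -
  have c: "dird v H integrable_on cell" for v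
    by (rule integrable_continuous)
      (rule continuous_on_subset[OF smooth_on_continuous[OF smooth_on_dird[OF H]]], simp)
  obtain v1 v2 where v: "v = (v1, v2)" by (cases v)
  have "dird v H = (\<lambda>x. v1 * dird (1, 0) H x + v2 * dird (0, 1) H x)"
    unfolding v using dird_components[OF H] by blast
  moreover have "((\<lambda>x. v1 * dird (1, 0) H x + v2 * dird (0, 1) H x) has_integral v1 * 0 + v2 * 0) cell"
    using integral_dird_periodic_2[OF assms] integrable_integral[OF c]
    by (intro has_integral_add has_integral_mult_right) metis+
  ultimately show ?thesis by simp
qed

definition slab_periodic :: "real \<Rightarrow> (real \<times> real \<times> real \<Rightarrow> 'b) \<Rightarrow> bool" where
  "slab_periodic \<delta> G \<longleftrightarrow> (\<forall>t\<in>{-\<delta><..<\<delta>}. doubly_periodic (\<lambda>x. G (t, x)))"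

lemma dird_translate:
  fixes G :: "'a::euclidean_space \<Rightarrow> 'b::real_normed_vector"
  assumes S: "open S" "y \<in> S" "\<And>y. y \<in> S \<Longrightarrow> G (y + c) = G y" and G: "smooth_on S G" and yc: "y + c \<in> S"
  shows "dird v G (y + c) = dird v G y"
proof -
  have "((\<lambda>y. y + c) has_derivative (\<lambda>h. h)) (at y)" by (auto intro!: derivative_eq_intros)
  from has_derivative_compose[OF this smooth_on_has_derivative[OF G yc]]
  have "dird v (\<lambda>y. G (y + c)) y = dird v G (y + c)" by (rule dirdI)
  moreover have "dird v (\<lambda>y. G (y + c)) y = dird v G y" by (rule dird_cong[OF S])
  ultimately show ?thesis by simp
qed

lemma slab_periodic_dird:
  fixes G :: "real \<times> real \<times> real \<Rightarrow> 'b::real_normed_vector"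
  assumes G: "smooth_on (slab \<delta>) G" and p: "slab_periodic \<delta> G"
  shows "slab_periodic \<delta> (dird v G)"
  unfolding slab_periodic_def doubly_periodic_def
proof (intro ballI allI conjI)
  fix t a b assume t: "t \<in> {-\<delta><..<\<delta>}"
  have "dird v G ((t, a, b) + (0, 2 * pi, 0)) = dird v G (t, a, b)"
  proof (rule dird_translate[OF open_slab _ _ G])
    fix y :: "real \<times> real \<times> real" assume "y \<in> slab \<delta>"
    then show "G (y + (0, 2 * pi, 0)) = G y"
      using p by (cases y) (auto simp: slab_periodic_def doubly_periodic_def)
  qed (use t in auto)
  then show "dird v G (t, a + 2 * pi, b) = dird v G (t, a, b)" by simp
  have "dird v G ((t, a, b) + (0, 0, 2 * pi)) = dird v G (t, a, b)"
  proof (rule dird_translate[OF open_slab _ _ G])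
    fix y :: "real \<times> real \<times> real" assume "y \<in> slab \<delta>"
    then show "G (y + (0, 0, 2 * pi)) = G y"
      using p by (cases y) (auto simp: slab_periodic_def doubly_periodic_def)
  qed (use t in auto)
  then show "dird v G (t, a, b + 2 * pi) = dird v G (t, a, b)" by simp
qed

lemma slab_null:
  fixes G :: "real \<times> real \<times> real \<Rightarrow> real"
  assumes "smooth_on (slab \<delta>) G" "slab_periodic \<delta> G" "\<delta> > 0"
  shows "((\<lambda>x. dird (0, v) G (0, x)) has_integral 0) cell"
proof -
  have 0: "0 \<in> {-\<delta><..<\<delta>}" using assms(3) by simp
  have "dird v (\<lambda>x. G (0, x)) = (\<lambda>x. dird (0, v) G (0, x))"
    using dird_slice[OF assms(1) 0] by blast
  moreover have "(dird v (\<lambda>x. G (0, x)) has_integral 0) cell"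
    by (rule integral_dird_periodic[OF smooth_slice[OF assms(1) 0]]) (use assms(2) 0 in \<open>auto simp: slab_periodic_def\<close>)
  ultimately show ?thesis by simp
qed

lemma doubly_periodic_int:
  assumes "doubly_periodic F"
  shows "F (u + 2 * pi * of_int k, v + 2 * pi * of_int l) = F (u, v)"
proof -
  have 1: "F (u + 2 * pi * of_nat n, v) = F (u, v)" for u v n
  proof (induction n)
    case (Suc n)
    have "F (u + 2 * pi * of_nat (Suc n), v) = F (u + 2 * pi * of_nat n + 2 * pi, v)" by (simp add: algebra_simps)
    also have "\<dots> = F (u + 2 * pi * of_nat n, v)" using assms unfolding doubly_periodic_def by blast
    finally show ?case using Suc by simp
  qed simp
  have 2: "F (u, v + 2 * pi * of_nat n) = F (u, v)" for u v n
  proof (induction n)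
    case (Suc n)
    have "F (u, v + 2 * pi * of_nat (Suc n)) = F (u, v + 2 * pi * of_nat n + 2 * pi)" by (simp add: algebra_simps)
    also have "\<dots> = F (u, v + 2 * pi * of_nat n)" using assms unfolding doubly_periodic_def by blast
    finally show ?case using Suc by simp
  qed simp
  have 3: "F (u + 2 * pi * of_int k, v) = F (u, v)" for u v
  proof (cases k rule: int_cases2)
    case (nonneg n) then show ?thesis using 1[of u n v] by simp
  next
    case (nonpos n) then show ?thesis using 1[of "u + 2 * pi * of_int k" n v] by simp
  qed
  have 4: "F (u, v + 2 * pi * of_int l) = F (u, v)" for u v
  proof (cases l rule: int_cases2)
    case (nonneg n) then show ?thesis using 2[of u v n] by simp
  next
    case (nonpos n) then show ?thesis using 2[of u "v + 2 * pi * of_int l" n] by simp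
  qed
  show ?thesis using 3 4 by simp
qed

text \<open>Every point is equivalent to one in the fundamental cell, so that bounds follow by compactness.\<close>
lemma doubly_periodic_reduce:
  obtains x' where "x' \<in> cell" "\<And>F :: real \<times> real \<Rightarrow> 'b. doubly_periodic F \<Longrightarrow> F x = F x'"
proof -
  obtain u v where x: "x = (u, v)" by (cases x)
  define k l where "k = \<lfloor>u / (2 * pi)\<rfloor>" and "l = \<lfloor>v / (2 * pi)\<rfloor>"
  have r: "0 \<le> r - 2 * pi * of_int \<lfloor>r / (2 * pi)\<rfloor> \<and> r - 2 * pi * of_int \<lfloor>r / (2 * pi)\<rfloor> \<le> 2 * pi" for r
  proof -
    have "of_int \<lfloor>r / (2 * pi)\<rfloor> * (2 * pi) \<le> r" "r < (of_int \<lfloor>r / (2 * pi)\<rfloor> + 1) * (2 * pi)"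
      by (rule floor_divide_lower floor_divide_upper, simp)+
    then show ?thesis by (simp add: algebra_simps)
  qed
  show thesis
  proof
    show "(u - 2 * pi * of_int k, v - 2 * pi * of_int l) \<in> cell"
      using r[of u] r[of v] by (simp add: k_def l_def mem_box Basis_prod_def cbox_Pair_eq)
    show "F x = F (u - 2 * pi * of_int k, v - 2 * pi * of_int l)" if "doubly_periodic F" for F :: "real \<times> real \<Rightarrow> 'b"
      using doubly_periodic_int[OF that, of "u - 2 * pi * of_int k" k "v - 2 * pi * of_int l" l] by (simp add: x)
  qed
qed

section \<open>The integrand along a family of surfaces\<close>

definition gram :: "real \<Rightarrow> 'a::euclidean_space \<Rightarrow> 'a \<Rightarrow> ('a \<Rightarrow> C2) \<Rightarrow> 'a \<Rightarrow> real" where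
  "gram T v w Y = (\<lambda>y. metric_form (height Y y * (1 - height Y y)) T (dird v (height Y) y) (psi v Y y) (eta v Y y)
     (dird w (height Y) y) (psi w Y y) (eta w Y y))"

lemma berger_metric_gram:
  assumes Y: "polar_map S Y" and y: "y \<in> S"
  shows "berger_metric \<tau> (Y y) (dird v Y y) (dird w Y y) = gram (\<tau>\<^sup>2) v w Y y"
proof -
  note P = polar_facts[OF Y]
  have 1: "(Re (fst (Y y)))\<^sup>2 + (Im (fst (Y y)))\<^sup>2 = height Y y" by (simp add: height_def modsq_def)
  have 2: "(Re (snd (Y y)))\<^sup>2 + (Im (snd (Y y)))\<^sup>2 = 1 - height Y y"
    using P(7)[OF y] by (simp add: modsq_def)
  have "berger_metric \<tau> (fst (Y y), snd (Y y)) (dird v Y y) (dird w Y y) = gram (\<tau>\<^sup>2) v w Y y"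
    unfolding dird_frame(1)[OF Y y] frame_inner(5)[OF P(8)[OF y] P(9)[OF y] 1 2] gram_def psi_def eta_def ..
  then show ?thesis by simp
qed

lemma gram_pos:
  fixes X :: "real \<times> real \<Rightarrow> C2"
  assumes \<tau>: "\<tau> > 1" and X: "polar_map UNIV X" and inj: "inj (frechet_derivative X (at x))"
  shows "gram (\<tau>\<^sup>2) (1, 0) (1, 0) X x * gram (\<tau>\<^sup>2) (0, 1) (0, 1) X x - (gram (\<tau>\<^sup>2) (1, 0) (0, 1) X x)\<^sup>2 > 0"
proof -
  have "X differentiable (at x)"
    using smooth_on_has_derivative[OF polar_facts(2)[OF X] UNIV_I] unfolding differentiable_def by blast
  then have d: "(X has_derivative frechet_derivative X (at x)) (at x)"
    using frechet_derivative_works by blast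
  show ?thesis
    using gram_det_pos[OF \<tau> d inj] unfolding berger_metric_gram[OF X UNIV_I, symmetric] dird_def .
qed

text \<open>The integrand is built from smooth functions by field operations and one inverse root; the
  positive Gram determinant keeps the root smooth.\<close>
lemma smooth_on_surface_density:
  assumes Y: "polar_map S Y"
    and D: "\<And>y. y \<in> S \<Longrightarrow> gram T v v Y y * gram T w w Y y - (gram T v w Y y)\<^sup>2 > 0"
  shows "smooth_on S (surface_density T v w Y)"
proof -
  note P = polar_facts[OF Y] and SP = smooth_polar[OF Y]
  define q where "q = (\<lambda>y. height Y y * (1 - height Y y))"
  define s where "s = (\<lambda>y. 1 - 2 * height Y y)"
  have qe: "height Y y * (1 - height Y y) = q y" and se: "1 - 2 * height Y y = s y" for y
    by (simp_all add: q_def s_def)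
  have q0: "q y \<noteq> 0" if "y \<in> S" for y using P(8,9)[OF that] by (simp add: q_def)
  have sq: "smooth_on S q" "smooth_on S s"
    unfolding q_def s_def by (intro smooth_intros P(1) SP)+
  have height_form: "smooth_on S (\<lambda>y. height_form (q y) (s y) T (r1 y) (p1 y) (e1 y) (r2 y) (p2 y) (e2 y) (r12 y))"
    if "smooth_on S r1" "smooth_on S p1" "smooth_on S e1" "smooth_on S r2" "smooth_on S p2" "smooth_on S e2" "smooth_on S r12"
    for r1 p1 e1 r2 p2 e2 r12
    unfolding height_form_def using q0 by (intro smooth_intros P(1) sq that) simp_all
  have psi_form: "smooth_on S (\<lambda>y. psi_form (q y) (s y) T (r1 y) (p1 y) (e1 y) (r2 y) (p2 y) (e2 y) (r12 y))"
    if "smooth_on S r1" "smooth_on S p1" "smooth_on S e1" "smooth_on S r2" "smooth_on S p2" "smooth_on S e2" "smooth_on S r12"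
    for r1 p1 e1 r2 p2 e2 r12
    unfolding psi_form_def using q0 by (intro smooth_intros P(1) sq that) simp_all
  have G: "smooth_on S (gram T u u' Y)" for u u'
    unfolding gram_def metric_form_def qe using q0
    by (intro smooth_intros P(1) SP sq) simp_all
  have GD: "smooth_on S (\<lambda>y. inverse (sqrt (gram T v v Y y * gram T w w Y y - (gram T v w Y y)\<^sup>2)))"
    by (rule smooth_on_inverse_sqrt[OF P(1) _ D]) (intro smooth_intros P(1) G)
  have K: "smooth_on S (\<lambda>y. c1 y * A y + c2 y * B y + c3 y * E y)"
    if "smooth_on S c1" "smooth_on S c2" "smooth_on S c3" "smooth_on S A" "smooth_on S B" "smooth_on S E"
    for c1 c2 c3 A B E :: "'a \<Rightarrow> real"
    by (intro smooth_intros P(1) that)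
  have d0: "smooth_on S (\<lambda>y. form_density T (gram T v v Y y) (gram T v w Y y) (gram T w w Y y) (K1 y) (K2 y) (K3 y))"
    if "smooth_on S K1" "smooth_on S K2" "smooth_on S K3" for K1 K2 K3
    unfolding form_density_def
    by (rule smooth_on_mult[OF P(1) _ smooth_on_power[OF P(1) GD]]) (intro smooth_intros P(1) G that, simp_all)
  have m: "smooth_on S (\<lambda>y. f1 y * f2 y - f3 y * f4 y)"
    if "smooth_on S f1" "smooth_on S f2" "smooth_on S f3" "smooth_on S f4" for f1 f2 f3 f4 :: "'a \<Rightarrow> real"
    by (intro smooth_intros P(1) that)
  show ?thesis
    unfolding surface_density_def jet_density_def Let_def qe se
    by (rule d0[unfolded gram_def qe]; intro K m height_form psi_form SP smooth_on_dird smooth_on_divide smooth_on_add smooth_on_const P(1); simp)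
qed

lemma dird_combination:
  fixes F :: "'a::euclidean_space \<Rightarrow> 'b::real_normed_vector"
  assumes "smooth_on S F" "y \<in> S"
  shows "dird (a *\<^sub>R v + b *\<^sub>R w) F y = a *\<^sub>R dird v F y + b *\<^sub>R dird w F y"
  using linear_add[OF dird_linear[OF assms]] linear_scale[OF dird_linear[OF assms]] by metis

lemma dird_combination_family:
  fixes F :: "'a::euclidean_space \<Rightarrow> 'a \<Rightarrow> real"
  assumes S: "open S" "y \<in> S" and F: "\<And>u. smooth_on S (F u)"
    and lin: "\<And>y. y \<in> S \<Longrightarrow> F (c *\<^sub>R v + d *\<^sub>R w) y = c * F v y + d * F w y"
  shows "dird (a *\<^sub>R v + b *\<^sub>R w) (F (c *\<^sub>R v + d *\<^sub>R w)) y =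
    a * c * dird v (F v) y + a * d * dird v (F w) y + b * c * dird w (F v) y + b * d * dird w (F w) y"
proof -
  have 1: "dird u (F (c *\<^sub>R v + d *\<^sub>R w)) y = c * dird u (F v) y + d * dird u (F w) y" for u
  proof -
    have "dird u (F (c *\<^sub>R v + d *\<^sub>R w)) y = dird u (\<lambda>y. c * F v y + d * F w y) y"
      by (rule dird_cong[OF S lin])
    also have "\<dots> = c * dird u (F v) y + d * dird u (F w) y"
      by (rule dirdI[OF has_derivative_add[OF has_derivative_mult_right has_derivative_mult_right]];
          rule smooth_on_has_derivative[OF F S(2)])
    finally show ?thesis .
  qed
  show ?thesis
    unfolding dird_combination[OF F S(2)] 1 by (simp add: algebra_simps)
qed

lemma surface_density_basis:
  assumes Y: "polar_map S Y" and y: "y \<in> S" and abcd: "a * d - b * c = 1"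
  shows "surface_density T (a *\<^sub>R v + b *\<^sub>R w) (c *\<^sub>R v + d *\<^sub>R w) Y y = surface_density T v w Y y"
proof -
  note P = polar_facts[OF Y] and SP = smooth_polar[OF Y]
  have h: "dird (a *\<^sub>R v + b *\<^sub>R w) (height Y) y = a * dird v (height Y) y + b * dird w (height Y) y"
    if "y \<in> S" for a b y
    using dird_combination[OF SP(1) that] by simp
  have ang: "arg_deriv (a *\<^sub>R v + b *\<^sub>R w) \<zeta> y = a * arg_deriv v \<zeta> y + b * arg_deriv w \<zeta> y"
    if "y \<in> S" "smooth_on S \<zeta>" for a b y and \<zeta> :: "'a \<Rightarrow> complex"
    unfolding arg_deriv_def dird_combination[OF that(2,1)] by (simp add: add_divide_distrib diff_divide_distrib algebra_simps)
  have p: "psi (a *\<^sub>R v + b *\<^sub>R w) Y y = a * psi v Y y + b * psi w Y y" if "y \<in> S" for a b y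
    unfolding psi_def ang[OF that P(3)] ang[OF that P(4)] by (simp add: algebra_simps)
  have e: "eta (a *\<^sub>R v + b *\<^sub>R w) Y y = a * eta v Y y + b * eta w Y y" if "y \<in> S" for a b y
    unfolding eta_def ang[OF that P(3)] ang[OF that P(4)] by (simp add: algebra_simps)
  have hh: "dird (a *\<^sub>R v + b *\<^sub>R w) (dird (c *\<^sub>R v + d *\<^sub>R w) (height Y)) y = a * c * dird v (dird v (height Y)) y + a * d * dird v (dird w (height Y)) y + b * c * dird w (dird v (height Y)) y + b * d * dird w (dird w (height Y)) y"
    for a b c d
    by (rule dird_combination_family[where F = "\<lambda>u. dird u (height Y)", OF P(1) y], rule smooth_on_dird[OF SP(1)], rule h, assumption)
  have pp: "dird (a *\<^sub>R v + b *\<^sub>R w) (psi (c *\<^sub>R v + d *\<^sub>R w) Y) y = a * c * dird v (psi v Y) y + a * d * dird v (psi w Y) y + b * c * dird w (psi v Y) y + b * d * dird w (psi w Y) y"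
    for a b c d
    by (rule dird_combination_family[where F = "\<lambda>u. psi u Y", OF P(1) y], rule SP, rule p, assumption)
  have ee: "dird (a *\<^sub>R v + b *\<^sub>R w) (eta (c *\<^sub>R v + d *\<^sub>R w) Y) y = a * c * dird v (eta v Y) y + a * d * dird v (eta w Y) y + b * c * dird w (eta v Y) y + b * d * dird w (eta w Y) y"
    for a b c d
    by (rule dird_combination_family[where F = "\<lambda>u. eta u Y", OF P(1) y], rule SP, rule e, assumption)
  have hc: "dird w (dird v (height Y)) y = dird v (dird w (height Y)) y" by (rule dird_commute[OF P(1) SP(1) y])
  have pc: "dird w (psi v Y) y = dird v (psi w Y) y" by (rule dird_psi_eta(3)[OF Y y])
  have sq: "a * a * x + a * b * y + b * a * y + b * b * z = a\<^sup>2 * x + 2 * a * b * y + b\<^sup>2 * z"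
    "a * c * x + a * d * y + b * c * y + b * d * z = a * c * x + (a * d + b * c) * y + b * d * z" for a b c d x y z :: real
    by (simp_all add: power2_eq_square algebra_simps)
  have sqe: "a * a * x + a * b * y + b * a * y' + b * b * z = a\<^sup>2 * x + 2 * a * b * ((y + y') / 2) + b\<^sup>2 * z"
    "(a * c * x + a * d * y + b * c * y' + b * d * z + (c * a * x + c * b * y + d * a * y' + d * b * z)) / 2 =
      a * c * x + (a * d + b * c) * ((y + y') / 2) + b * d * z" for a b c d x y y' z :: real
    by (simp_all add: power2_eq_square field_simps)
  show ?thesis
    unfolding surface_density_def h[OF y] p[OF y] e[OF y] hh pp ee hc pc sq sqe by (rule jet_density_invariant[OF abcd])
qed

text \<open>Derivatives of a slice are derivatives of the family in directions without time component.\<close>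
lemma surface_density_slice:
  assumes Y: "polar_map (slab \<delta>) Y" and t: "t \<in> {-\<delta><..<\<delta>}"
  shows "polar_map UNIV (\<lambda>x. Y (t, x))"
    "surface_density T v w (\<lambda>x. Y (t, x)) x = surface_density T (0, v) (0, w) Y (t, x)"
    "gram T v w (\<lambda>x. Y (t, x)) x = gram T (0, v) (0, w) Y (t, x)"
proof -
  note P = polar_facts[OF Y] and SP = smooth_polar[OF Y]
  show "polar_map UNIV (\<lambda>x. Y (t, x))"
  proof -
    have "(t, x) \<in> slab \<delta>" for x :: "real \<times> real" using t by simp
    then show ?thesis using Y smooth_slice[OF P(2) t] unfolding polar_map_def by blast
  qed
  have h: "height (\<lambda>x. Y (t, x)) = (\<lambda>x. height Y (t, x))" by (simp add: height_def modsq_def)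
  have h1: "dird u (height (\<lambda>x. Y (t, x))) = (\<lambda>x. dird (0, u) (height Y) (t, x))" for u
    unfolding h using dird_slice[OF SP(1) t] by blast
  have h2: "dird u (\<lambda>x. dird (0, u') (height Y) (t, x)) = (\<lambda>x. dird (0, u) (dird (0, u') (height Y)) (t, x))" for u u'
    using dird_slice[OF smooth_on_dird[OF SP(1)] t] by blast
  have f: "arg_deriv u (\<lambda>x. fst (Y (t, x))) x = arg_deriv (0, u) (\<lambda>y. fst (Y y)) (t, x)" for u x
    unfolding arg_deriv_def modsq_def dird_slice[OF P(3) t] ..
  have s: "arg_deriv u (\<lambda>x. snd (Y (t, x))) x = arg_deriv (0, u) (\<lambda>y. snd (Y y)) (t, x)" for u x
    unfolding arg_deriv_def modsq_def dird_slice[OF P(4) t] ..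
  have p: "psi u (\<lambda>x. Y (t, x)) = (\<lambda>x. psi (0, u) Y (t, x))" for u
    unfolding psi_def f s ..
  have e: "eta u (\<lambda>x. Y (t, x)) = (\<lambda>x. eta (0, u) Y (t, x))" for u
    unfolding eta_def h f s ..
  have p2: "dird u (\<lambda>x. psi (0, u') Y (t, x)) = (\<lambda>x. dird (0, u) (psi (0, u') Y) (t, x))" for u u'
    using dird_slice[OF SP(2) t] by blast
  have e2: "dird u (\<lambda>x. eta (0, u') Y (t, x)) = (\<lambda>x. dird (0, u) (eta (0, u') Y) (t, x))" for u u'
    using dird_slice[OF SP(3) t] by blast
  show "surface_density T v w (\<lambda>x. Y (t, x)) x = surface_density T (0, v) (0, w) Y (t, x)"
    unfolding surface_density_def h1 h2 p e p2 e2 unfolding h ..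
  show "gram T v w (\<lambda>x. Y (t, x)) x = gram T (0, v) (0, w) Y (t, x)"
    unfolding gram_def h1 p e unfolding h ..
qed

section \<open>First and second variation of a critical Clifford torus\<close>

lemma slab_periodic_arg_deriv:
  assumes "smooth_on (slab \<delta>) \<zeta>" "slab_periodic \<delta> \<zeta>"
  shows "slab_periodic \<delta> (arg_deriv v \<zeta>)"
  using slab_periodic_dird[OF assms, of v] assms(2)
  by (simp add: slab_periodic_def doubly_periodic_def arg_deriv_def modsq_def)

text \<open>The relation between \<open>a\<close>, \<open>b\<close> and \<open>\<tau>\<close> says that the energy of the Clifford tori, as a function of
  \<open>a b\<close>, is stationary.\<close>
locale critical_torus =
  fixes \<tau> a b :: real
  assumes \<tau>: "\<tau> > 1" and ab: "a > 0" "b > 0" "a\<^sup>2 + b\<^sup>2 = 1" and critical: "4 * (a\<^sup>2 * b\<^sup>2) * (\<tau>\<^sup>2 - 1) = 1"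
begin

definition "q = a\<^sup>2 * (1 - a\<^sup>2)"
definition "s = 1 - 2 * a\<^sup>2"
text \<open>The value of \<open>T / 4 (det G)\<^sup>-\<^sup>5\<^sup>/\<^sup>2\<close> on the torus, whose Gram determinant is constant.\<close>
definition "pref = \<tau>\<^sup>2 / 4 * inverse (sqrt (\<tau>\<^sup>2 * q)) ^ 5"

lemma a2: "0 < a\<^sup>2" "a\<^sup>2 < 1" "1 - a\<^sup>2 = b\<^sup>2"
  using ab by (auto simp: algebra_simps) (metis less_add_same_cancel1 zero_less_power)

lemma critical_coefficient: "4 * \<tau>\<^sup>2 * q - 8 * q - s\<^sup>2 = 0"
proof -
  have "4 * q * (\<tau>\<^sup>2 - 1) = 1" using critical unfolding q_def a2(3) .
  moreover have "s\<^sup>2 = 1 - 4 * q" unfolding s_def q_def by (simp add: power2_eq_square algebra_simps)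
  ultimately show ?thesis by (simp add: algebra_simps)
qed

text \<open>The horizontal direction with \<open>\<psi> = 1\<close>; together with the Hopf direction \<open>d2\<close> it forms a unimodular
  basis, because \<open>a\<^sup>2 + b\<^sup>2 = 1\<close>.\<close>
abbreviation d1 :: "real \<times> real" where "d1 \<equiv> (b\<^sup>2, - a\<^sup>2)"
abbreviation d2 :: "real \<times> real" where "d2 \<equiv> (1, 1)"

definition hessian :: "(real \<times> real \<Rightarrow> real) \<Rightarrow> real" where
  "hessian f = integral cell (\<lambda>x. hess_quadratic (\<tau>\<^sup>2) q s (f x) (dird d1 f x) (dird d2 f x)
      (dird d1 (dird d1 f) x) (dird d1 (dird d2 f) x) (dird d2 (dird d2 f) x))"

end

text \<open>A variation of the critical torus that stays where polar coordinates are defined.\<close>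
locale torus_family = critical_torus +
  fixes \<delta> :: real and Y :: "real \<times> real \<times> real \<Rightarrow> C2"
  assumes \<delta>: "\<delta> > 0" and Y: "polar_map (slab \<delta>) Y" and per: "slab_periodic \<delta> Y"
    and imm: "\<And>t x. t \<in> {-\<delta><..<\<delta>} \<Longrightarrow> inj (frechet_derivative (\<lambda>x. Y (t, x)) (at x))"
    and base: "\<And>x. Y (0, x) = clifford_torus a b x"
begin

definition D1 :: "real \<times> real \<times> real" where "D1 = (0, b\<^sup>2, - a\<^sup>2)"
definition D2 :: "real \<times> real \<times> real" where "D2 = (0, 1, 1)"
definition adapted_density :: "real \<times> real \<times> real \<Rightarrow> real" where "adapted_density = surface_density (\<tau>\<^sup>2) D1 D2 Y"

abbreviation h where "h \<equiv> height Y"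
abbreviation \<zeta> where "\<zeta> \<equiv> \<lambda>y. fst (Y y)"
abbreviation \<omega> where "\<omega> \<equiv> \<lambda>y. snd (Y y)"
abbreviation ht where "ht \<equiv> dird tdir h"

lemmas P = polar_facts[OF Y] and SP = smooth_polar[OF Y]

lemma zero_in: "0 \<in> {-\<delta><..<\<delta>}" using \<delta> by simp

lemma base_in: "(0, x) \<in> slab \<delta>" using \<delta> by simp

lemma surface_density_coordinates:
  assumes "y \<in> slab \<delta>"
  shows "surface_density T (0, 1, 0) (0, 0, 1) Y y = surface_density T D1 D2 Y y"
proof -
  have "D1 = b\<^sup>2 *\<^sub>R (0, 1, 0) + (- a\<^sup>2) *\<^sub>R (0, 0, 1)" "D2 = 1 *\<^sub>R (0, 1, 0) + 1 *\<^sub>R (0, 0, 1)"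
    by (simp_all add: D1_def D2_def)
  moreover have "b\<^sup>2 * 1 - (- a\<^sup>2) * 1 = 1" using ab(3) by simp
  ultimately show ?thesis using surface_density_basis[OF Y assms, of "b\<^sup>2" 1 "- a\<^sup>2" 1] by metis
qed

lemma smooth_adapted_density: "smooth_on (slab \<delta>) adapted_density"
proof -
  have "smooth_on (slab \<delta>) (surface_density (\<tau>\<^sup>2) (0, 1, 0) (0, 0, 1) Y)"
  proof (rule smooth_on_surface_density[OF Y])
    fix y assume y: "y \<in> slab \<delta>"
    then obtain t x where [simp]: "y = (t, x)" and t: "t \<in> {-\<delta><..<\<delta>}" by (cases y) auto
    show "gram (\<tau>\<^sup>2) (0, 1, 0) (0, 1, 0) Y y * gram (\<tau>\<^sup>2) (0, 0, 1) (0, 0, 1) Y y -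
        (gram (\<tau>\<^sup>2) (0, 1, 0) (0, 0, 1) Y y)\<^sup>2 > 0"
      using gram_pos[OF \<tau> surface_density_slice(1)[OF Y t] imm[OF t]] unfolding surface_density_slice(3)[OF Y t] by simp
  qed
  moreover have "smooth_on (slab \<delta>) (surface_density (\<tau>\<^sup>2) (0, 1, 0) (0, 0, 1) Y) \<longleftrightarrow> smooth_on (slab \<delta>) (surface_density (\<tau>\<^sup>2) D1 D2 Y)"
    by (rule smooth_on_cong[OF open_slab surface_density_coordinates])
  ultimately show ?thesis unfolding adapted_density_def by (rule iffD1[rotated])
qed

lemma willmore_energy_adapted_density:
  assumes t: "t \<in> {-\<delta><..<\<delta>}" and N: "unit_normal \<tau> (\<lambda>x. Y (t, x)) N"
  shows "willmore_energy \<tau> (\<lambda>x. Y (t, x)) N = integral cell (\<lambda>x. adapted_density (t, x))"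
proof -
  have "surface_density (\<tau>\<^sup>2) (0, 1, 0) (0, 0, 1) Y (t, x) = adapted_density (t, x)" for x
    unfolding adapted_density_def by (rule surface_density_coordinates) (use t in simp)
  then show ?thesis
    unfolding willmore_energy_def willmore_integrand[OF \<tau> surface_density_slice(1)[OF Y t] imm[OF t] N]
      surface_density_slice(2)[OF Y t] by (simp only:)
qed

lemma slice_cong:
  fixes F G :: "real \<times> real \<times> real \<Rightarrow> real"
  assumes "smooth_on (slab \<delta>) F" "smooth_on (slab \<delta>) G" "\<And>x. F (0, x) = G (0, x)"
  shows "dird (0, v) F (0, x) = dird (0, v) G (0, x)"
  using dird_slice[OF assms(1) zero_in, of v x] dird_slice[OF assms(2) zero_in, of v x] assms(3) by simp

lemma slice_const:
  fixes F :: "real \<times> real \<times> real \<Rightarrow> real"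
  assumes "smooth_on (slab \<delta>) F" "\<And>x. F (0, x) = c"
  shows "dird (0, v) F (0, x) = 0"
  using slice_cong[OF assms(1) smooth_on_const[OF open_slab, of _ c] assms(2)] dirdI[OF has_derivative_const] by metis

text \<open>On the torus the arguments of the two coordinates are the parameters \<open>u\<close> and \<open>v\<close>.\<close>
lemma base_angles:
  "h (0, x) = a\<^sup>2" "arg_deriv (0, v1, v2) \<zeta> (0, x) = v1" "arg_deriv (0, v1, v2) \<omega> (0, x) = v2"
proof -
  obtain u v where x: "x = (u, v)" by (cases x)
  have z0: "(\<lambda>x. fst (Y (0, x))) = (\<lambda>x. of_real a * cis (fst x))"
    and w0: "(\<lambda>x. snd (Y (0, x))) = (\<lambda>x. of_real b * cis (snd x))"
    unfolding base clifford_torus_def by auto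
  have z: "\<zeta> (0, x) = of_real a * cis (fst x)" and w: "\<omega> (0, x) = of_real b * cis (snd x)" for x
    using fun_cong[OF z0, of x] fun_cong[OF w0, of x] by simp_all
  have one: "(r * cos t)\<^sup>2 + (r * sin t)\<^sup>2 = r\<^sup>2" for r t :: real
    by (metis distrib_left mult.right_neutral power_mult_distrib sin_cos_squared_add2)
  have mz: "modsq \<zeta> (0, x) = a\<^sup>2" and mw: "modsq \<omega> (0, x) = b\<^sup>2"
    unfolding modsq_def z w by (simp_all add: one)
  show "h (0, x) = a\<^sup>2" using mz by (simp add: height_def)
  have c: "dird d (\<lambda>x. r * cos (fst x)) x = - r * sin (fst x) * fst d" "dird d (\<lambda>x. r * sin (fst x)) x = r * cos (fst x) * fst d"
    "dird d (\<lambda>x. r * cos (snd x)) x = - r * sin (snd x) * snd d" "dird d (\<lambda>x. r * sin (snd x)) x = r * cos (snd x) * snd d"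
    for r and d x :: "real \<times> real"
    by (rule dirdI, (rule derivative_eq_intros refl)+, simp add: algebra_simps)+
  have dz: "Re (dird (0, d) \<zeta> (0, x)) = - a * sin (fst x) * fst d" "Im (dird (0, d) \<zeta> (0, x)) = a * cos (fst x) * fst d" for d
  proof -
    have s: "smooth_on UNIV (\<lambda>x. fst (Y (0, x)))" by (rule smooth_slice[OF P(3) zero_in])
    have "Re (dird (0, d) \<zeta> (0, x)) = dird d (\<lambda>x. Re (fst (Y (0, x)))) x"
      "Im (dird (0, d) \<zeta> (0, x)) = dird d (\<lambda>x. Im (fst (Y (0, x)))) x"
      unfolding dird_slice[OF P(3) zero_in, symmetric]
      using dird_bounded_linear[OF bounded_linear_Re s UNIV_I] dird_bounded_linear[OF bounded_linear_Im s UNIV_I] by simp_all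
    then show "Re (dird (0, d) \<zeta> (0, x)) = - a * sin (fst x) * fst d" "Im (dird (0, d) \<zeta> (0, x)) = a * cos (fst x) * fst d"
      unfolding z by (simp_all add: c)
  qed
  have dw: "Re (dird (0, d) \<omega> (0, x)) = - b * sin (snd x) * snd d" "Im (dird (0, d) \<omega> (0, x)) = b * cos (snd x) * snd d" for d
  proof -
    have s: "smooth_on UNIV (\<lambda>x. snd (Y (0, x)))" by (rule smooth_slice[OF P(4) zero_in])
    have "Re (dird (0, d) \<omega> (0, x)) = dird d (\<lambda>x. Re (snd (Y (0, x)))) x"
      "Im (dird (0, d) \<omega> (0, x)) = dird d (\<lambda>x. Im (snd (Y (0, x)))) x"
      unfolding dird_slice[OF P(4) zero_in, symmetric]
      using dird_bounded_linear[OF bounded_linear_Re s UNIV_I] dird_bounded_linear[OF bounded_linear_Im s UNIV_I] by simp_all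
    then show "Re (dird (0, d) \<omega> (0, x)) = - b * sin (snd x) * snd d" "Im (dird (0, d) \<omega> (0, x)) = b * cos (snd x) * snd d"
      unfolding w by (simp_all add: c)
  qed
  have two: "r * cos t * (r * cos t * d) - r * sin t * (- r * sin t * d) = r\<^sup>2 * d" for r t d :: real
  proof -
    have "r * cos t * (r * cos t * d) - r * sin t * (- r * sin t * d) = ((r * cos t)\<^sup>2 + (r * sin t)\<^sup>2) * d"
      by (simp add: power2_eq_square algebra_simps)
    then show ?thesis unfolding one .
  qed
  show "arg_deriv (0, v1, v2) \<zeta> (0, x) = v1"
    unfolding arg_deriv_def mz dz z using ab(1) two[of a "fst x" v1] by simp
  show "arg_deriv (0, v1, v2) \<omega> (0, x) = v2"
    unfolding arg_deriv_def mw dw w using ab(2) two[of b "snd x" v2] by simp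
qed

lemma base_psi_eta:
  "psi D1 Y (0, x) = 1" "psi D2 Y (0, x) = 0" "eta D1 Y (0, x) = 0" "eta D2 Y (0, x) = 1"
proof -
  have "b\<^sup>2 = 1 - a\<^sup>2" using ab(3) by simp
  then show "psi D1 Y (0, x) = 1" "psi D2 Y (0, x) = 0" "eta D1 Y (0, x) = 0" "eta D2 Y (0, x) = 1"
    by (simp_all add: psi_def eta_def D1_def D2_def base_angles)
qed
   
lemma base_derivatives:
  "dird (0, v) h (0, x) = 0" "dird (0, v) (dird (0, w) h) (0, x) = 0"
  "dird (0, v) (psi D1 Y) (0, x) = 0" "dird (0, v) (psi D2 Y) (0, x) = 0"
  "dird (0, v) (eta D1 Y) (0, x) = 0" "dird (0, v) (eta D2 Y) (0, x) = 0"
proof -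
  show 1: "dird (0, v) h (0, x) = 0" for v x by (rule slice_const[OF SP(1) base_angles(1)])
  show "dird (0, v) (dird (0, w) h) (0, x) = 0" by (rule slice_const[OF smooth_on_dird[OF SP(1)] 1])
  show "dird (0, v) (psi D1 Y) (0, x) = 0" "dird (0, v) (psi D2 Y) (0, x) = 0"
    "dird (0, v) (eta D1 Y) (0, x) = 0" "dird (0, v) (eta D2 Y) (0, x) = 0"
    by (rule slice_const[OF SP(2) base_psi_eta(1)] slice_const[OF SP(2) base_psi_eta(2)]
        slice_const[OF SP(3) base_psi_eta(3)] slice_const[OF SP(3) base_psi_eta(4)])+
qed

lemma time_commute:
  fixes F :: "real \<times> real \<times> real \<Rightarrow> real"
  assumes "smooth_on (slab \<delta>) F" "y \<in> slab \<delta>"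
  shows "dird tdir (dird v F) y = dird v (dird tdir F) y"
    "dird tdir (dird v (dird w F)) y = dird v (dird w (dird tdir F)) y"
proof -
  have 1: "dird tdir (dird v F) y = dird v (dird tdir F) y" if "smooth_on (slab \<delta>) F" "y \<in> slab \<delta>" for v y and F :: "real \<times> real \<times> real \<Rightarrow> real"
    using dird_commute[OF open_slab that] .
  show "dird tdir (dird v F) y = dird v (dird tdir F) y" by (rule 1[OF assms])
  have "dird tdir (dird v (dird w F)) y = dird v (dird tdir (dird w F)) y"
    by (rule 1[OF smooth_on_dird[OF assms(1)] assms(2)])
  also have "\<dots> = dird v (dird w (dird tdir F)) y"
    by (rule dird_cong[OF open_slab assms(2)]) (rule 1[OF assms(1)])
  finally show "dird tdir (dird v (dird w F)) y = dird v (dird w (dird tdir F)) y" .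
qed

text \<open>Closedness of \<open>d\<phi>\<close> and \<open>d\<theta>\<close> turns their time derivatives into spatial derivatives of the
  angular velocities.\<close>
lemma time_psi_eta:
  assumes "y \<in> slab \<delta>"
  shows "dird tdir (psi v Y) y = dird v (arg_deriv tdir \<zeta>) y - dird v (arg_deriv tdir \<omega>) y"
    "dird tdir (eta v Y) y = h y * dird v (arg_deriv tdir \<zeta>) y + (1 - h y) * dird v (arg_deriv tdir \<omega>) y + ht y * psi v Y y"
  unfolding dird_psi_eta(1,2)[OF Y assms] dird_psi_eta(4)[OF Y assms, of tdir] dird_psi_eta(5)[OF Y assms, of tdir]
  by simp_all

text \<open>Expressions that do not contribute to the variations of the energy.\<close>
definition null :: "(real \<times> real \<Rightarrow> real) \<Rightarrow> bool" where
  "null F \<longleftrightarrow> (F has_integral 0) cell"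

lemma null_dird:
  assumes "smooth_on (slab \<delta>) F" "slab_periodic \<delta> F"
  shows "null (\<lambda>x. dird (0, v) F (0, x))"
  unfolding null_def by (rule slab_null[OF assms \<delta>])

lemma null_add: "null F \<Longrightarrow> null G \<Longrightarrow> null (\<lambda>x. F x + G x)"
  unfolding null_def using has_integral_add[of F 0 cell G 0] by simp

lemma null_cmult: "null F \<Longrightarrow> null (\<lambda>x. c * F x)"
  unfolding null_def using has_integral_mult_right[of F 0 cell c] by simp

lemma null_hess_linear:
  assumes "null P1" "null E2" "null R11" "null R12" "null R22"
  shows "null (\<lambda>x. hess_linear T q s (P1 x) (E2 x) (R11 x) (R12 x) (R22 x))"
proof -
  have eq: "hess_linear T q s p e r1 r2 r3 = hess_linear T q s 1 0 0 0 0 * p + (hess_linear T q s 0 1 0 0 0 * e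
    + (hess_linear T q s 0 0 1 0 0 * r1 + (hess_linear T q s 0 0 0 1 0 * r2 + hess_linear T q s 0 0 0 0 1 * r3)))" for p e r1 r2 r3
    unfolding hess_linear_def by (simp add: algebra_simps)
  show ?thesis
    by (subst eq) (intro null_add null_cmult assms)
qed

lemma periodic_facts:
  "slab_periodic \<delta> h" "slab_periodic \<delta> (arg_deriv v \<zeta>)" "slab_periodic \<delta> (arg_deriv v \<omega>)"
proof -
  have 1: "slab_periodic \<delta> \<zeta>" "slab_periodic \<delta> \<omega>"
    using per by (simp_all add: slab_periodic_def doubly_periodic_def)
  show "slab_periodic \<delta> (arg_deriv v \<zeta>)" "slab_periodic \<delta> (arg_deriv v \<omega>)"
    by (rule slab_periodic_arg_deriv[OF P(3) 1(1)], rule slab_periodic_arg_deriv[OF P(4) 1(2)])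
  show "slab_periodic \<delta> h"
    using 1(1) by (simp add: slab_periodic_def doubly_periodic_def height_def modsq_def)
qed

lemma smooth_all:
  "smooth_on (slab \<delta>) (dird v h)" "smooth_on (slab \<delta>) (dird v (dird w h))"
  "smooth_on (slab \<delta>) (dird v (psi w Y))" "smooth_on (slab \<delta>) (dird v (eta w Y))"
  by (intro smooth_on_dird SP)+

lemmas jet2_t = jet2_smooth[OF _ \<delta>]

text \<open>The second-order jet with all velocities zero, evaluated along time \<open>t\<^sup>2 / 2\<close>. The velocity of \<open>\<rho>\<close> drops
  out by \<open>critical_coefficient\<close>.\<close>
lemma adapted_density_first: "dird tdir adapted_density (0, x) = pref * hess_linear (\<tau>\<^sup>2) q s (dird tdir (psi D1 Y) (0, x)) (dird tdir (eta D2 Y) (0, x))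
    (dird tdir (dird D1 (dird D1 h)) (0, x)) (dird tdir (dird D1 (dird D2 h)) (0, x)) (dird tdir (dird D2 (dird D2 h)) (0, x))"
proof -
  have S: "jet2 (\<lambda>t. F (t\<^sup>2 / 2, x)) c 0 (dird tdir F (0, x))"
    if "smooth_on (slab \<delta>) F" "F (0, x) = c" for F c
    using jet2_square_time[OF jet2_t[OF that(1), of x]] that(2) by simp
  have Z: "dird D1 h (0, x) = 0" "dird D2 h (0, x) = 0" "dird D1 (dird D1 h) (0, x) = 0" "dird D1 (dird D2 h) (0, x) = 0"
    "dird D2 (dird D2 h) (0, x) = 0" "dird D1 (psi D1 Y) (0, x) = 0" "dird D1 (psi D2 Y) (0, x) = 0"
    "dird D2 (psi D2 Y) (0, x) = 0" "dird D1 (eta D1 Y) (0, x) = 0" "dird D1 (eta D2 Y) (0, x) = 0"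
    "dird D2 (eta D1 Y) (0, x) = 0" "dird D2 (eta D2 Y) (0, x) = 0"
    using base_derivatives unfolding D1_def D2_def by auto
  have e12: "smooth_on (slab \<delta>) (\<lambda>y. (dird D1 (eta D2 Y) y + dird D2 (eta D1 Y) y) / 2)"
    by (intro smooth_on_divide smooth_on_add smooth_all smooth_on_const open_slab) simp
  obtain k0 k1 where J: "jet2 (\<lambda>t. adapted_density (t\<^sup>2 / 2, x)) k0 k1
    (pref * (2 * hess_quadratic (\<tau>\<^sup>2) q s 0 0 0 0 0 0 + hess_linear (\<tau>\<^sup>2) q s (dird tdir (psi D1 Y) (0, x)) (dird tdir (eta D2 Y) (0, x))
    (dird tdir (dird D1 (dird D1 h)) (0, x)) (dird tdir (dird D1 (dird D2 h)) (0, x)) (dird tdir (dird D2 (dird D2 h)) (0, x))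
     + (\<tau>\<^sup>2) ^ 2 * q * s * (4 * \<tau>\<^sup>2 * q - 8 * q - s ^ 2) * dird tdir h (0, x)))"
    unfolding adapted_density_def surface_density_def pref_def q_def s_def
    using jet_density_jet2[of "\<tau>\<^sup>2", OF _ a2(1,2) S[OF SP(1) base_angles(1)] S[OF smooth_all(1) Z(1)] S[OF smooth_all(1) Z(2)]
      S[OF SP(2) base_psi_eta(1)] S[OF SP(2) base_psi_eta(2)] S[OF SP(3) base_psi_eta(3)] S[OF SP(3) base_psi_eta(4)]
      S[OF smooth_all(2) Z(3)] S[OF smooth_all(2) Z(4)] S[OF smooth_all(2) Z(5)]
      S[OF smooth_all(3) Z(6)] S[OF smooth_all(3) Z(7)] S[OF smooth_all(3) Z(8)]
      S[OF smooth_all(4) Z(9)] _ S[OF smooth_all(4) Z(12)], of "\<lambda>t. (dird D1 (eta D2 Y) (t\<^sup>2 / 2, x) + dird D2 (eta D1 Y) (t\<^sup>2 / 2, x)) / 2"]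
      S[OF e12, of 0] Z(10,11) \<tau> by fastforce
  have "hess_quadratic (\<tau>\<^sup>2) q s 0 0 0 0 0 0 = 0" by (simp add: hess_quadratic_def)
  then show ?thesis
    using jet2_unique(3)[OF J jet2_square_time[OF jet2_t[OF smooth_adapted_density, of x]]] unfolding critical_coefficient by simp
qed

lemma first_variation: "((\<lambda>t. integral cell (\<lambda>x. adapted_density (t, x))) has_real_derivative 0) (at 0)"
proof -
  have "null (\<lambda>x. dird tdir adapted_density (0, x))"
    unfolding adapted_density_first
  proof (intro null_cmult null_hess_linear)
    have p: "slab_periodic \<delta> (arg_deriv tdir \<zeta>)" "slab_periodic \<delta> (arg_deriv tdir \<omega>)" by (rule periodic_facts)+
    have n: "null (\<lambda>x. dird D (arg_deriv tdir \<zeta>) (0, x))" "null (\<lambda>x. dird D (arg_deriv tdir \<omega>) (0, x))" if "fst D = 0" for D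
      using null_dird[OF SP(4) p(1), of "snd D"] null_dird[OF SP(5) p(2), of "snd D"] that
      by (metis prod.collapse)+
    have d: "fst D1 = 0" "fst D2 = 0" by (simp_all add: D1_def D2_def)
    show "null (\<lambda>x. dird tdir (psi D1 Y) (0, x))"
      unfolding time_psi_eta(1)[OF base_in] using null_add[OF n(1)[OF d(1)] null_cmult[OF n(2)[OF d(1)], of "-1"]] by simp
    show "null (\<lambda>x. dird tdir (eta D2 Y) (0, x))"
      unfolding time_psi_eta(2)[OF base_in] base_psi_eta base_angles
      using null_add[OF null_cmult[OF n(1)[OF d(2)]] null_cmult[OF n(2)[OF d(2)]]] by simp
    have r: "null (\<lambda>x. dird tdir (dird D (dird D' h)) (0, x))" if "fst D = 0" for D D'
      unfolding time_commute(2)[OF SP(1) base_in]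
      using null_dird[OF smooth_on_dird[OF smooth_on_dird[OF SP(1)]]
          slab_periodic_dird[OF smooth_on_dird[OF SP(1)] slab_periodic_dird[OF SP(1) periodic_facts(1)]], of "snd D"] that
      by (metis prod.collapse)
    show "null (\<lambda>x. dird tdir (dird D1 (dird D1 h)) (0, x))" "null (\<lambda>x. dird tdir (dird D1 (dird D2 h)) (0, x))"
      "null (\<lambda>x. dird tdir (dird D2 (dird D2 h)) (0, x))" by (rule r[OF d(1)] r[OF d(2)])+
  qed
  then have "integral cell (\<lambda>x. dird tdir adapted_density (0, x)) = 0" unfolding null_def by (rule integral_unique)
  then show ?thesis using integral_time_derivative[OF smooth_adapted_density zero_in] by simp
qed

text \<open>The assumption says that the angular velocities vanish at time \<open>0\<close>, so that \<open>jet_density_jet2\<close> applies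
  with the velocity \<open>ht\<close> of \<open>\<rho>\<close>.\<close>
lemma adapted_density_second:
  assumes A: "\<And>x. arg_deriv tdir \<zeta> (0, x) = 0" "\<And>x. arg_deriv tdir \<omega> (0, x) = 0"
  shows "dird tdir (dird tdir adapted_density) (0, x) = pref * (2 * hess_quadratic (\<tau>\<^sup>2) q s (ht (0, x)) (dird D1 ht (0, x)) (dird D2 ht (0, x))
      (dird D1 (dird D1 ht) (0, x)) (dird D1 (dird D2 ht) (0, x)) (dird D2 (dird D2 ht) (0, x))
    + hess_linear (\<tau>\<^sup>2) q s (dird tdir (dird tdir (psi D1 Y)) (0, x)) (dird tdir (dird tdir (eta D2 Y)) (0, x))
       (dird tdir (dird tdir (dird D1 (dird D1 h))) (0, x)) (dird tdir (dird tdir (dird D1 (dird D2 h))) (0, x))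
       (dird tdir (dird tdir (dird D2 (dird D2 h))) (0, x)))"
proof -
  have S: "jet2 (\<lambda>t. F (t, x)) c d (dird tdir (dird tdir F) (0, x))"
    if "smooth_on (slab \<delta>) F" "F (0, x) = c" "dird tdir F (0, x) = d" for F c d
    using jet2_t[OF that(1), of x] that(2,3) by simp
  have Z: "dird D1 h (0, x) = 0" "dird D2 h (0, x) = 0" "dird D1 (dird D1 h) (0, x) = 0" "dird D1 (dird D2 h) (0, x) = 0"
    "dird D2 (dird D2 h) (0, x) = 0" "dird D1 (psi D1 Y) (0, x) = 0" "dird D1 (psi D2 Y) (0, x) = 0"
    "dird D2 (psi D2 Y) (0, x) = 0" "dird D1 (eta D1 Y) (0, x) = 0" "dird D1 (eta D2 Y) (0, x) = 0"
    "dird D2 (eta D1 Y) (0, x) = 0" "dird D2 (eta D2 Y) (0, x) = 0"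
    using base_derivatives unfolding D1_def D2_def by auto
  have A': "dird (0, v) (arg_deriv tdir \<zeta>) (0, x) = 0" "dird (0, v) (arg_deriv tdir \<omega>) (0, x) = 0" for v x
    by (rule slice_const[OF SP(4) A(1)], rule slice_const[OF SP(5) A(2)])
  have t1: "dird tdir (psi D1 Y) (0, x) = 0" "dird tdir (psi D2 Y) (0, x) = 0" for x
    unfolding time_psi_eta(1)[OF base_in] D1_def D2_def A' by simp_all
  have t2: "dird tdir (eta D1 Y) (0, x) = ht (0, x)" "dird tdir (eta D2 Y) (0, x) = 0" for x
    unfolding time_psi_eta(2)[OF base_in] using base_psi_eta[of x] by (simp_all add: D1_def D2_def A')
  have t3: "dird tdir (dird (0, v) (psi D1 Y)) (0, x) = 0" "dird tdir (dird (0, v) (psi D2 Y)) (0, x) = 0" for v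
    unfolding time_commute(1)[OF SP(2) base_in]
    by (rule slice_const[OF smooth_on_dird[OF SP(2)] t1(1)], rule slice_const[OF smooth_on_dird[OF SP(2)] t1(2)])
  have t4: "dird tdir (dird (0, v) (eta D1 Y)) (0, x) = dird (0, v) ht (0, x)" "dird tdir (dird (0, v) (eta D2 Y)) (0, x) = 0" for v
    unfolding time_commute(1)[OF SP(3) base_in]
    by (rule slice_cong[OF smooth_on_dird[OF SP(3)] smooth_on_dird[OF SP(1)] t2(1)],
        rule slice_const[OF smooth_on_dird[OF SP(3)] t2(2)])
  have t5: "dird tdir (dird v h) (0, x) = dird v ht (0, x)" "dird tdir (dird v (dird w h)) (0, x) = dird v (dird w ht) (0, x)" for v w
    by (rule time_commute(1)[OF SP(1) base_in], rule time_commute(2)[OF SP(1) base_in])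
  have u3: "dird tdir (dird D1 (psi D1 Y)) (0, x) = 0" "dird tdir (dird D1 (psi D2 Y)) (0, x) = 0"
    "dird tdir (dird D2 (psi D2 Y)) (0, x) = 0" "dird tdir (dird D1 (eta D1 Y)) (0, x) = dird D1 ht (0, x)"
    "dird tdir (dird D2 (eta D1 Y)) (0, x) = dird D2 ht (0, x)" "dird tdir (dird D1 (eta D2 Y)) (0, x) = 0"
    "dird tdir (dird D2 (eta D2 Y)) (0, x) = 0"
    using t3 t4 unfolding D1_def D2_def by auto
  obtain E12 where e12: "jet2 (\<lambda>t. (dird D1 (eta D2 Y) (t, x) + dird D2 (eta D1 Y) (t, x)) / 2) 0 (dird D2 ht (0, x) / 2) E12"
  proof
    show "jet2 (\<lambda>t. (dird D1 (eta D2 Y) (t, x) + dird D2 (eta D1 Y) (t, x)) / 2) 0 (dird D2 ht (0, x) / 2)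
      ((dird tdir (dird tdir (dird D1 (eta D2 Y))) (0, x) + dird tdir (dird tdir (dird D2 (eta D1 Y))) (0, x)) / 2)"
      using jet2_divide[OF jet2_add[OF S[OF smooth_all(4) Z(10) u3(6)] S[OF smooth_all(4) Z(11) u3(5)]] jet2_const[of 2]]
      by simp
  qed
  have T: "\<tau>\<^sup>2 > 0" using \<tau> by simp
  note W = jet_density_jet2[OF T a2(1,2) S[OF SP(1) base_angles(1) refl] S[OF smooth_all(1) Z(1) t5(1)] S[OF smooth_all(1) Z(2) t5(1)]
      S[OF SP(2) base_psi_eta(1) t1(1)] S[OF SP(2) base_psi_eta(2) t1(2)]
      S[OF SP(3) base_psi_eta(3) t2(1)] S[OF SP(3) base_psi_eta(4) t2(2)]
      S[OF smooth_all(2) Z(3) t5(2)] S[OF smooth_all(2) Z(4) t5(2)] S[OF smooth_all(2) Z(5) t5(2)]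
      S[OF smooth_all(3) Z(6) u3(1)] S[OF smooth_all(3) Z(7) u3(2)] S[OF smooth_all(3) Z(8) u3(3)]
      S[OF smooth_all(4) Z(9) u3(4)] e12 S[OF smooth_all(4) Z(12) u3(7)]]
  from W obtain k0 k1 where J: "jet2 (\<lambda>t. adapted_density (t, x)) k0 k1
    (pref * (2 * hess_quadratic (\<tau>\<^sup>2) q s (ht (0, x)) (dird D1 ht (0, x)) (dird D2 ht (0, x))
      (dird D1 (dird D1 ht) (0, x)) (dird D1 (dird D2 ht) (0, x)) (dird D2 (dird D2 ht) (0, x))
    + hess_linear (\<tau>\<^sup>2) q s (dird tdir (dird tdir (psi D1 Y)) (0, x)) (dird tdir (dird tdir (eta D2 Y)) (0, x))
       (dird tdir (dird tdir (dird D1 (dird D1 h))) (0, x)) (dird tdir (dird tdir (dird D1 (dird D2 h))) (0, x))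
       (dird tdir (dird tdir (dird D2 (dird D2 h))) (0, x))
     + (\<tau>\<^sup>2) ^ 2 * q * s * (4 * \<tau>\<^sup>2 * q - 8 * q - s ^ 2) * dird tdir (dird tdir h) (0, x)))"
    unfolding adapted_density_def surface_density_def pref_def q_def s_def by blast
  show ?thesis
    using jet2_unique(3)[OF jet2_t[OF smooth_adapted_density] J] unfolding critical_coefficient by simp
qed

text \<open>All accelerations involved are exact at time \<open>0\<close>. For \<open>\<eta>\<^sub>2\<close> this needs \<open>\<psi>\<^sub>2 = 0\<close> and the vanishing of
  the angular velocities, which remove the products of velocities and the acceleration of \<open>\<rho>\<close>.\<close>
lemma null_second:
  assumes A: "\<And>x. arg_deriv tdir \<zeta> (0, x) = 0" "\<And>x. arg_deriv tdir \<omega> (0, x) = 0"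
  shows "null (\<lambda>x. hess_linear (\<tau>\<^sup>2) q s (dird tdir (dird tdir (psi D1 Y)) (0, x)) (dird tdir (dird tdir (eta D2 Y)) (0, x))
       (dird tdir (dird tdir (dird D1 (dird D1 h))) (0, x)) (dird tdir (dird tdir (dird D1 (dird D2 h))) (0, x))
       (dird tdir (dird tdir (dird D2 (dird D2 h))) (0, x)))"
proof (rule null_hess_linear)
  define AA BB where "AA = arg_deriv tdir \<zeta>" and "BB = arg_deriv tdir \<omega>"
  have SA: "smooth_on (slab \<delta>) AA" "smooth_on (slab \<delta>) BB" unfolding AA_def BB_def by (rule SP)+
  have p: "slab_periodic \<delta> (dird tdir AA)" "slab_periodic \<delta> (dird tdir BB)"
    unfolding AA_def BB_def by (rule slab_periodic_dird[OF SP(4) periodic_facts(2)], rule slab_periodic_dird[OF SP(5) periodic_facts(3)])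
  have D: "D1 = (0, snd D1)" "D2 = (0, snd D2)" by (simp_all add: D1_def D2_def)
  have n: "null (\<lambda>x. dird (0, v) (dird tdir AA) (0, x))" "null (\<lambda>x. dird (0, v) (dird tdir BB) (0, x))" for v
    by (rule null_dird[OF smooth_on_dird[OF SA(1)] p(1)], rule null_dird[OF smooth_on_dird[OF SA(2)] p(2)])
  have dA: "(AA has_derivative (\<lambda>v. dird v AA (0, x))) (at (0, x))" "(BB has_derivative (\<lambda>v. dird v BB (0, x))) (at (0, x))"
    "(dird u AA has_derivative (\<lambda>v. dird v (dird u AA) (0, x))) (at (0, x))" "(dird u BB has_derivative (\<lambda>v. dird v (dird u BB) (0, x))) (at (0, x))" for x u
    by (rule smooth_on_has_derivative[OF _ base_in]; intro smooth_on_dird SA)+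
  have t: "dird tdir (dird v AA) (0, x) = dird v (dird tdir AA) (0, x)" "dird tdir (dird v BB) (0, x) = dird v (dird tdir BB) (0, x)" for v x
    by (rule time_commute(1)[OF SA(1) base_in], rule time_commute(1)[OF SA(2) base_in])
  have A': "dird (0, v) AA (0, x) = 0" "dird (0, v) BB (0, x) = 0" for v x
    unfolding AA_def BB_def by (rule slice_const[OF SP(4) A(1)], rule slice_const[OF SP(5) A(2)])
  show "null (\<lambda>x. dird tdir (dird tdir (psi D1 Y)) (0, x))"
  proof -
    have "dird tdir (dird tdir (psi D1 Y)) (0, x) = dird D1 (dird tdir AA) (0, x) - dird D1 (dird tdir BB) (0, x)" for x
    proof -
      have "dird tdir (dird tdir (psi D1 Y)) (0, x) = dird tdir (\<lambda>y. dird D1 AA y - dird D1 BB y) (0, x)"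
        unfolding AA_def BB_def by (rule dird_cong[OF open_slab base_in time_psi_eta(1)])
      also have "\<dots> = dird tdir (dird D1 AA) (0, x) - dird tdir (dird D1 BB) (0, x)"
        by (rule dirdI[OF has_derivative_diff[OF dA(3,4)]])
      finally show ?thesis unfolding t .
    qed
    moreover have "null (\<lambda>x. dird D1 (dird tdir AA) (0, x) + (-1) * dird D1 (dird tdir BB) (0, x))"
      by (subst (1 2) D) (intro null_add null_cmult n)
    ultimately show ?thesis by simp
  qed
  show "null (\<lambda>x. dird tdir (dird tdir (eta D2 Y)) (0, x))"
  proof -
    have "dird tdir (dird tdir (eta D2 Y)) (0, x) = a\<^sup>2 * dird D2 (dird tdir AA) (0, x) + (1 - a\<^sup>2) * dird D2 (dird tdir BB) (0, x)" for x
    proof -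
      have dh: "(h has_derivative (\<lambda>v. dird v h (0, x))) (at (0, x))" "(ht has_derivative (\<lambda>v. dird v ht (0, x))) (at (0, x))"
        "(psi D2 Y has_derivative (\<lambda>v. dird v (psi D2 Y) (0, x))) (at (0, x))"
        by (rule smooth_on_has_derivative[OF _ base_in]; intro smooth_on_dird SP)+
      have "dird tdir (dird tdir (eta D2 Y)) (0, x) =
          dird tdir (\<lambda>y. h y * dird D2 AA y + (1 - h y) * dird D2 BB y + ht y * psi D2 Y y) (0, x)"
        unfolding AA_def BB_def by (rule dird_cong[OF open_slab base_in time_psi_eta(2)])
      also have "\<dots> = (h (0, x) * dird tdir (dird D2 AA) (0, x) + ht (0, x) * dird D2 AA (0, x)
          + ((1 - h (0, x)) * dird tdir (dird D2 BB) (0, x) + (0 - ht (0, x)) * dird D2 BB (0, x)))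
          + (ht (0, x) * dird tdir (psi D2 Y) (0, x) + dird tdir ht (0, x) * psi D2 Y (0, x))"
        by (rule dirdI[OF has_derivative_add[OF has_derivative_add[OF has_derivative_mult[OF dh(1) dA(3)]
               has_derivative_mult[OF has_derivative_diff[OF has_derivative_const dh(1)] dA(4)]]
               has_derivative_mult[OF dh(2,3)]]])
      also have "dird tdir (psi D2 Y) (0, x) = 0"
        unfolding time_psi_eta(1)[OF base_in] AA_def[symmetric] BB_def[symmetric] by (subst (1 2) D) (simp add: A')
      also have "dird D2 AA (0, x) = 0" by (subst D) (rule A')
      also have "dird D2 BB (0, x) = 0" by (subst D) (rule A')
      finally show ?thesis unfolding t base_angles base_psi_eta by simp
    qed
    moreover have "null (\<lambda>x. a\<^sup>2 * dird D2 (dird tdir AA) (0, x) + (1 - a\<^sup>2) * dird D2 (dird tdir BB) (0, x))"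
      by (subst (1 2) D) (intro null_add null_cmult n)
    ultimately show ?thesis by simp
  qed
  have r: "null (\<lambda>x. dird tdir (dird tdir (dird (0, v) (dird w h))) (0, x))" for v w
  proof -
    have "dird tdir (dird tdir (dird (0, v) (dird w h))) (0, x) = dird (0, v) (dird w (dird tdir ht)) (0, x)" for x
    proof -
      have "dird tdir (dird tdir (dird (0, v) (dird w h))) (0, x) = dird tdir (dird (0, v) (dird w ht)) (0, x)"
        by (rule dird_cong[OF open_slab base_in time_commute(2)[OF SP(1)]])
      also have "\<dots> = dird (0, v) (dird w (dird tdir ht)) (0, x)"
        by (rule time_commute(2)[OF smooth_on_dird[OF SP(1)] base_in])
      finally show ?thesis .
    qed
    moreover have "null (\<lambda>x. dird (0, v) (dird w (dird tdir ht)) (0, x))"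
      by (rule null_dird) (intro smooth_on_dird slab_periodic_dird SP periodic_facts)+
    ultimately show ?thesis by simp
  qed
  show "null (\<lambda>x. dird tdir (dird tdir (dird D1 (dird D1 h))) (0, x))"
    "null (\<lambda>x. dird tdir (dird tdir (dird D1 (dird D2 h))) (0, x))"
    "null (\<lambda>x. dird tdir (dird tdir (dird D2 (dird D2 h))) (0, x))"
    using r[of "snd D1" D1] r[of "snd D1" D2] r[of "snd D2" D2] unfolding D[symmetric] .
qed

lemma second_derivative:
  assumes A: "\<And>x. arg_deriv tdir \<zeta> (0, x) = 0" "\<And>x. arg_deriv tdir \<omega> (0, x) = 0"
    and f: "smooth_on UNIV f" "\<And>x. ht (0, x) = k * f x"
  shows "(deriv ^^ 2) (\<lambda>t. integral cell (\<lambda>x. adapted_density (t, x))) 0 =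
    2 * pref * k\<^sup>2 * hessian f"
proof -
  define Q where "Q = (\<lambda>x. hess_quadratic (\<tau>\<^sup>2) q s (f x) (dird d1 f x) (dird d2 f x)
      (dird d1 (dird d1 f) x) (dird d1 (dird d2 f) x) (dird d2 (dird d2 f) x))"
  have sh: "smooth_on (slab \<delta>) ht" by (intro smooth_on_dird SP)
  have lin: "dird v (\<lambda>x. k * F x) x = k * dird v F x" if "smooth_on UNIV F" for F :: "real \<times> real \<Rightarrow> real" and v x
    by (rule dirdI[OF has_derivative_mult_right[OF smooth_on_has_derivative[OF that UNIV_I]]])
  have h1: "dird (0, v) ht (0, x) = k * dird v f x" for v x
    unfolding dird_slice[OF sh zero_in, symmetric] f(2) by (rule lin[OF f(1)])
  have h2: "dird (0, v) (dird (0, w) ht) (0, x) = k * dird v (dird w f) x" for v w x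
    unfolding dird_slice[OF smooth_on_dird[OF sh] zero_in, symmetric] h1 by (rule lin[OF smooth_on_dird[OF f(1)]])
  have hom: "hess_quadratic T q s (k * g) (k * r1) (k * r2) (k * r11) (k * r12) (k * r22) = k\<^sup>2 * hess_quadratic T q s g r1 r2 r11 r12 r22"
    for T q s g r1 r2 r11 r12 r22
    unfolding hess_quadratic_def by (simp add: power_mult_distrib power2_eq_square algebra_simps)
  have e2: "dird tdir (dird tdir adapted_density) (0, x) = (2 * pref * k\<^sup>2) * Q x + pref * hess_linear (\<tau>\<^sup>2) q s (dird tdir (dird tdir (psi D1 Y)) (0, x)) (dird tdir (dird tdir (eta D2 Y)) (0, x))
       (dird tdir (dird tdir (dird D1 (dird D1 h))) (0, x)) (dird tdir (dird tdir (dird D1 (dird D2 h))) (0, x))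
       (dird tdir (dird tdir (dird D2 (dird D2 h))) (0, x))" (is "_ = _ + pref * ?L x") for x
    unfolding adapted_density_second[OF A] unfolding D1_def D2_def h1 h2 f(2) hom Q_def
    by (simp add: algebra_simps)
  have "smooth_on UNIV Q" unfolding Q_def hess_quadratic_def
    by (intro smooth_intros f) simp_all
  then have "Q integrable_on cell"
    by (intro integrable_continuous continuous_on_subset[OF smooth_on_continuous]) auto
  then have "((\<lambda>x. (2 * pref * k\<^sup>2) * Q x + pref * ?L x) has_integral (2 * pref * k\<^sup>2) * integral cell Q + 0) cell"
    using null_cmult[OF null_second[OF A], of pref] unfolding null_def
    by (intro has_integral_add has_integral_mult_right integrable_integral)
  then have I: "integral cell (\<lambda>x. dird tdir (dird tdir adapted_density) (0, x)) = 2 * pref * k\<^sup>2 * integral cell Q"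
    unfolding e2 by (simp add: integral_unique)
  have "\<forall>\<^sub>F t in nhds 0. t \<in> {-\<delta><..<\<delta>}"
    by (rule eventually_nhds_in_open) (use \<delta> in auto)
  then have "\<forall>\<^sub>F t in nhds 0. deriv (\<lambda>t. integral cell (\<lambda>x. adapted_density (t, x))) t = integral cell (\<lambda>x. dird tdir adapted_density (t, x))"
    by eventually_elim (rule DERIV_imp_deriv[OF integral_time_derivative[OF smooth_adapted_density]])
  then have "deriv (deriv (\<lambda>t. integral cell (\<lambda>x. adapted_density (t, x)))) 0 = deriv (\<lambda>t. integral cell (\<lambda>x. dird tdir adapted_density (t, x))) 0"
    by (rule deriv_cong_ev) simp
  also have "\<dots> = integral cell (\<lambda>x. dird tdir (dird tdir adapted_density) (0, x))"
    by (rule DERIV_imp_deriv[OF integral_time_derivative[OF smooth_on_dird[OF smooth_adapted_density] zero_in]])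
  finally show ?thesis unfolding I Q_def hessian_def by (simp add: numeral_2_eq_2)
qed

end

section \<open>Arbitrary variations in polar coordinates\<close>

lemma cis_has_derivative:
  assumes "(f has_derivative f') (at x)"
  shows "((\<lambda>x. cis (f x)) has_derivative (\<lambda>d. of_real (f' d) * (\<i> * cis (f x)))) (at x)"
proof -
  have "(\<lambda>x. cis (f x)) = (\<lambda>x. of_real (cos (f x)) + \<i> * of_real (sin (f x)))"
    by (simp add: fun_eq_iff complex_eq_iff)
  moreover have "((\<lambda>x. of_real (cos (f x)) + \<i> * of_real (sin (f x))) has_derivative
      (\<lambda>d. of_real (- f' d * sin (f x)) + \<i> * of_real (f' d * cos (f x)))) (at x)"
    using has_derivative_cos[OF assms] has_derivative_sin[OF assms]
    by (intro has_derivative_add has_derivative_mult_right has_derivative_of_real) (simp_all add: mult.commute)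
  moreover have "of_real (- f' d * sin (f x)) + \<i> * of_real (f' d * cos (f x)) = of_real (f' d) * (\<i> * cis (f x))" for d
    by (simp add: complex_eq_iff)
  ultimately show ?thesis by simp
qed

text \<open>Vectors of \<open>C2\<close> in the orthonormal frame that rotates with the parameters \<open>u\<close> and \<open>v\<close>.\<close>
definition frame_vec :: "real \<Rightarrow> real \<Rightarrow> real \<Rightarrow> real \<Rightarrow> real \<Rightarrow> real \<Rightarrow> C2" where
  "frame_vec u v a b a' b' = (cis u * Complex a b, cis v * Complex a' b')"

lemma inner_frame_vec: "frame_vec u v a b a' b' \<bullet> frame_vec u v c d c' d' = a * c + b * d + (a' * c' + b' * d')"
  unfolding frame_vec_def inner_prod_def fst_conv snd_conv inner_polar by simp

lemma hopf_frame_vec: "hopf_field (frame_vec u v a b a' b') = frame_vec u v (- b) a (- b') a'"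
  by (simp add: hopf_field_def frame_vec_def complex_eq_iff algebra_simps)

lemma scaleR_frame_vec: "r *\<^sub>R frame_vec u v a b a' b' = frame_vec u v (r * a) (r * b) (r * a') (r * b')"
  by (simp add: frame_vec_def complex_eq_iff algebra_simps)

lemma frame_vec_cases: "\<exists>a b a' b'. p = frame_vec u v a b a' b'"
proof -
  have "z = cis t * Complex (Re (cnj (cis t) * z)) (Im (cnj (cis t) * z))" for z t
  proof -
    have "cis t * cnj (cis t) = 1" by (simp add: complex_eq_iff power2_eq_square[symmetric])
    then have "cis t * (cnj (cis t) * z) = z" by (simp only: mult.assoc[symmetric] mult_1)
    then show ?thesis by (simp only: complex.collapse)
  qed
  then show ?thesis unfolding frame_vec_def by (metis prod.collapse)
qed

lemma clifford_frame_vec: "clifford_torus a b (u, v) = frame_vec u v a 0 b 0"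
  by (simp add: clifford_torus_def frame_vec_def complex_eq_iff)

lemma frame_vec_has_derivative:
  fixes c s :: "real \<times> real \<Rightarrow> real"
  assumes "(c has_derivative c') (at (u, v))" "(s has_derivative s') (at (u, v))"
  shows "((\<lambda>x. frame_vec (fst x) (snd x) (c x) 0 (s x) 0) has_derivative
     (\<lambda>d. frame_vec u v (c' d) (c (u, v) * fst d) (s' d) (s (u, v) * snd d))) (at (u, v))"
proof -
  have f: "((\<lambda>x. cis (fst x)) has_derivative (\<lambda>d. of_real (fst d) * (\<i> * cis u))) (at (u, v))"
    using cis_has_derivative[OF has_derivative_fst[OF has_derivative_ident], where x = "(u, v)"] by simp
  have g: "((\<lambda>x. cis (snd x)) has_derivative (\<lambda>d. of_real (snd d) * (\<i> * cis v))) (at (u, v))"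
    using cis_has_derivative[OF has_derivative_snd[OF has_derivative_ident], where x = "(u, v)"] by simp
  have C: "(\<lambda>x. frame_vec (fst x) (snd x) (c x) 0 (s x) 0) = (\<lambda>x. (cis (fst x) * of_real (c x), cis (snd x) * of_real (s x)))"
    by (simp add: frame_vec_def complex_eq_iff fun_eq_iff)
  show ?thesis
    unfolding C
    by (rule has_derivative_eq_rhs[OF has_derivative_Pair[OF has_derivative_mult[OF f has_derivative_of_real[OF assms(1)]]
          has_derivative_mult[OF g has_derivative_of_real[OF assms(2)]]]])
      (simp add: fun_eq_iff frame_vec_def complex_eq_iff algebra_simps)
qed

lemma deriv2_cong:
  assumes "\<delta> > (0::real)" "\<And>t. t \<in> {-\<delta><..<\<delta>} \<Longrightarrow> F t = G t"
  shows "(deriv ^^ 2) F 0 = (deriv ^^ 2) G (0::real)"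
proof -
  have "deriv F t = deriv G t" if "t \<in> {-\<delta><..<\<delta>}" for t
  proof (rule deriv_cong_ev)
    have "\<forall>\<^sub>F t in nhds t. t \<in> {-\<delta><..<\<delta>}" by (rule eventually_nhds_in_open) (use that in auto)
    then show "\<forall>\<^sub>F t in nhds t. F t = G t" by eventually_elim (rule assms(2))
  qed simp
  moreover have "\<forall>\<^sub>F t in nhds 0. t \<in> {-\<delta><..<\<delta>}" by (rule eventually_nhds_in_open) (use assms(1) in auto)
  ultimately have "\<forall>\<^sub>F t in nhds 0. deriv F t = deriv G t" by (auto elim: eventually_mono)
  then have "deriv (deriv F) 0 = deriv (deriv G) 0" by (rule deriv_cong_ev) simp
  then show ?thesis by (simp add: numeral_2_eq_2)
qed

context critical_torus
begin

lemma clifford_dird: "dird d (clifford_torus a b) (u, v) = frame_vec u v 0 (a * fst d) 0 (b * snd d)"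
proof -
  have "clifford_torus a b = (\<lambda>x. frame_vec (fst x) (snd x) a 0 b 0)"
    by (rule ext) (use clifford_frame_vec in \<open>simp add: split_paired_all\<close>)
  then show ?thesis
    using dirdI[OF frame_vec_has_derivative[where u = u and v = v and c = "\<lambda>_. a" and s = "\<lambda>_. b",
          OF has_derivative_const has_derivative_const]] by simp
qed

text \<open>Orthogonality to both circles and to the position forces the stated form with a sign at every
  point; the sign is continuous and the plane is connected.\<close>
lemma clifford_unit_normal:
  assumes N: "unit_normal \<tau> (clifford_torus a b) N"
  shows "\<exists>\<sigma>. \<sigma>\<^sup>2 = 1 \<and> (\<forall>u v. N (u, v) = frame_vec u v (- b * \<sigma>) 0 (a * \<sigma>) 0)"
proof -
  \<comment> \<open>the component along the unit normal pointing towards smaller \<open>|z|\<close>\<close>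
  define S where "S = (\<lambda>x. N x \<bullet> frame_vec (fst x) (snd x) (- b) 0 a 0)"
  have pt: "(S (u, v))\<^sup>2 = 1 \<and> N (u, v) = frame_vec u v (- b * S (u, v)) 0 (a * S (u, v)) 0" for u v
  proof -
    obtain n1 n2 n3 n4 where n: "N (u, v) = frame_vec u v n1 n2 n3 n4" using frame_vec_cases by blast
    define k where "k = \<tau>\<^sup>2 - 1"
    have N1: "N (u, v) \<bullet> clifford_torus a b (u, v) = 0"
      and N2: "berger_metric \<tau> (clifford_torus a b (u, v)) (N (u, v)) (N (u, v)) = 1"
      and N3: "\<And>i. berger_metric \<tau> (clifford_torus a b (u, v)) (N (u, v)) (pd i (clifford_torus a b) (u, v)) = 0"
      using N unfolding unit_normal_def tangent_S3_def by blast+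
    have t: "n1 * a + n3 * b = 0" using N1 unfolding n clifford_frame_vec inner_frame_vec by simp
    have "n2 * a + k * (n2 * a + n4 * b) * (a * a) = 0"
      using N3[of 1] unfolding n pd_eq_dird clifford_dird unfolding berger_metric_def clifford_frame_vec hopf_frame_vec inner_frame_vec
      by (simp add: coord_dir_def k_def)
    moreover have "n4 * b + k * (n2 * a + n4 * b) * (b * b) = 0"
      using N3[of 2] unfolding n pd_eq_dird clifford_dird unfolding berger_metric_def clifford_frame_vec hopf_frame_vec inner_frame_vec
      by (simp add: coord_dir_def k_def)
    moreover have "(n2 * a + k * (n2 * a + n4 * b) * (a * a)) + (n4 * b + k * (n2 * a + n4 * b) * (b * b)) =
        (n2 * a + n4 * b) * (1 + k * (a\<^sup>2 + b\<^sup>2))" by (simp add: power2_eq_square algebra_simps)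
    ultimately have "(n2 * a + n4 * b) * \<tau>\<^sup>2 = 0" unfolding ab(3) k_def by simp
    then have z: "n2 * a + n4 * b = 0" using \<tau> by simp
    with \<open>n2 * a + k * (n2 * a + n4 * b) * (a * a) = 0\<close> \<open>n4 * b + k * (n2 * a + n4 * b) * (b * b) = 0\<close>
    have n24: "n2 = 0" "n4 = 0" using ab by simp_all
    have u1: "n1\<^sup>2 + n3\<^sup>2 = 1"
      using N2 unfolding n berger_metric_def clifford_frame_vec hopf_frame_vec inner_frame_vec n24 by (simp add: power2_eq_square)
    have S: "S (u, v) = a * n3 - b * n1" unfolding S_def n by (simp add: inner_frame_vec algebra_simps)
    have "n1 * (a\<^sup>2 + b\<^sup>2) = - b * S (u, v) + a * (n1 * a + n3 * b)" "n3 * (a\<^sup>2 + b\<^sup>2) = a * S (u, v) + b * (n1 * a + n3 * b)"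
      unfolding S by (simp_all add: power2_eq_square algebra_simps)
    then have n13: "n1 = - b * S (u, v)" "n3 = a * S (u, v)" unfolding ab(3) t by simp_all
    have "(S (u, v))\<^sup>2 * (a\<^sup>2 + b\<^sup>2) = n1\<^sup>2 + n3\<^sup>2" unfolding n13 by (simp add: power_mult_distrib algebra_simps)
    then have "(S (u, v))\<^sup>2 = 1" unfolding ab(3) u1 by simp
    then show ?thesis using n n13 n24 by simp
  qed
  have "continuous_on UNIV S"
  proof -
    have "continuous_on UNIV N" using N smooth_on_continuous unfolding unit_normal_def by blast
    moreover have "continuous_on UNIV (\<lambda>x :: real \<times> real. frame_vec (fst x) (snd x) (- b) 0 a 0)"
      unfolding frame_vec_def by (intro continuous_intros)
    ultimately show ?thesis unfolding S_def by (rule continuous_on_inner)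
  qed
  moreover have "S ` UNIV \<subseteq> {1, -1}"
    using pt by (auto simp: power2_eq_1_iff)
  then have "finite (S ` UNIV)" by (rule finite_subset) simp
  moreover have "connected (UNIV :: (real \<times> real) set)" by (rule convex_connected) simp
  ultimately have "S constant_on UNIV" by (intro continuous_finite_range_constant)
  then obtain \<sigma> where "\<And>x. S x = \<sigma>" unfolding constant_on_def by blast
  then show ?thesis using pt by metis
qed

text \<open>By uniform continuity on a compact set of times and one fundamental cell, for small times the
  surface stays closer to the torus than the smaller of the two radii, so neither coordinate
  vanishes.\<close>
lemma variation_torus_family:
  assumes V: "variation \<tau> (clifford_torus a b) X N"
  obtains \<delta> where "torus_family \<tau> a b \<delta> (\<lambda>(t, x). X t x)" "\<And>t. t \<in> {-\<delta><..<\<delta>} \<Longrightarrow> unit_normal \<tau> (X t) (N t)"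
proof -
  obtain \<epsilon> where \<epsilon>: "\<epsilon> > 0" "smooth_on (slab \<epsilon>) (\<lambda>(t, x). X t x)"
    and im: "\<And>t. t \<in> {-\<epsilon><..<\<epsilon>} \<Longrightarrow> immersed_torus (X t) \<and> unit_normal \<tau> (X t) (N t)"
    and X0: "X 0 = clifford_torus a b"
    using V unfolding variation_def by blast
  define Y where "Y = (\<lambda>(t, x). X t x)"
  define K where "K = {-\<epsilon>/2..\<epsilon>/2} \<times> cell"
  have "compact K" unfolding K_def by (intro compact_Times) auto
  moreover have "K \<subseteq> slab \<epsilon>" using \<epsilon>(1) unfolding K_def by auto
  then have "continuous_on K Y"
    using smooth_on_continuous[OF \<epsilon>(2)] continuous_on_subset unfolding Y_def by blast
  ultimately have uc: "uniformly_continuous_on K Y" by (rule compact_uniformly_continuous[rotated])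
  define \<mu> where "\<mu> = min a b"
  have "\<mu> > 0" using ab by (simp add: \<mu>_def)
  then obtain d where d: "d > 0" "\<And>y y'. y \<in> K \<Longrightarrow> y' \<in> K \<Longrightarrow> dist y' y < d \<Longrightarrow> dist (Y y') (Y y) < \<mu>"
    using uc unfolding uniformly_continuous_on_def by metis
  define \<delta> where "\<delta> = min (\<epsilon> / 2) d"
  have \<delta>: "\<delta> > 0" "\<delta> \<le> \<epsilon> / 2" "\<delta> \<le> d" using \<epsilon>(1) d(1) by (simp_all add: \<delta>_def)
  have sub: "t \<in> {-\<epsilon><..<\<epsilon>}" if "t \<in> {-\<delta><..<\<delta>}" for t using that \<delta> \<epsilon>(1) by auto
  have nz: "fst (X t x) \<noteq> 0 \<and> snd (X t x) \<noteq> 0" if t: "t \<in> {-\<delta><..<\<delta>}" for t x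
  proof -
    obtain x' where x': "x' \<in> cell" "\<And>F :: real \<times> real \<Rightarrow> C2. doubly_periodic F \<Longrightarrow> F x = F x'"
      using doubly_periodic_reduce[where 'b = C2, of x] by blast
    have "X t x = X t x'" using x'(2) im[OF sub[OF t]] unfolding immersed_torus_def by blast
    moreover have "dist (Y (t, x')) (Y (0, x')) < \<mu>"
    proof (rule d(2))
      show "(0, x') \<in> K" "(t, x') \<in> K" using x'(1) t \<delta> \<epsilon>(1) by (auto simp: K_def)
      show "dist (t, x') (0, x') < d" using t \<delta>(3) by (auto simp: dist_prod_def)
    qed
    ultimately have "dist (X t x) (clifford_torus a b x') < \<mu>" by (simp add: Y_def X0)
    then have "dist (fst (X t x)) (fst (clifford_torus a b x')) < a" "dist (snd (X t x)) (snd (clifford_torus a b x')) < b"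
      using dist_fst_le[of "X t x" "clifford_torus a b x'"] dist_snd_le[of "X t x" "clifford_torus a b x'"]
      unfolding \<mu>_def by linarith+
    moreover have "cmod (fst (clifford_torus a b x')) = a" "cmod (snd (clifford_torus a b x')) = b"
      using ab by (cases x'; simp add: clifford_torus_def norm_mult)+
    ultimately show ?thesis by (auto simp: dist_norm)
  qed
  have "torus_family \<tau> a b \<delta> Y"
  proof unfold_locales
    show "polar_map (slab \<delta>) Y"
      unfolding polar_map_def
    proof (intro conjI ballI open_slab)
      have "slab \<delta> \<subseteq> slab \<epsilon>" using sub by blast
      then show "smooth_on (slab \<delta>) Y" using smooth_on_subset[OF \<epsilon>(2)] unfolding Y_def by blast
      fix y assume "y \<in> slab \<delta>"
      then obtain t x where y: "y = (t, x)" and t: "t \<in> {-\<delta><..<\<delta>}" by blast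
      show "Y y \<in> S3" using im[OF sub[OF t]] unfolding y Y_def immersed_torus_def prod.case by blast
      show "fst (Y y) \<noteq> 0" "snd (Y y) \<noteq> 0" using nz[OF t] unfolding y Y_def by simp_all
    qed
    show "slab_periodic \<delta> Y"
      unfolding slab_periodic_def Y_def using im[OF sub] unfolding immersed_torus_def by simp
    show "inj (frechet_derivative (\<lambda>x. Y (t, x)) (at x))" if "t \<in> {-\<delta><..<\<delta>}" for t x
      using im[OF sub[OF that]] unfolding immersed_torus_def Y_def prod.case by blast
    show "Y (0, x) = clifford_torus a b x" for x by (simp add: Y_def X0)
  qed (use \<delta> in auto)
  then show thesis using that im sub unfolding Y_def by blast
qed

lemma first_variation_zero:
  assumes V: "variation \<tau> (clifford_torus a b) X N"
  shows "((\<lambda>t. willmore_energy \<tau> (X t) (N t)) has_real_derivative 0) (at 0)"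
proof -
  obtain \<delta> where F: "torus_family \<tau> a b \<delta> (\<lambda>(t, x). X t x)" and N: "\<And>t. t \<in> {-\<delta><..<\<delta>} \<Longrightarrow> unit_normal \<tau> (X t) (N t)"
    using variation_torus_family[OF V] by blast
  interpret torus_family \<tau> a b \<delta> "\<lambda>(t, x). X t x" by (rule F)
  show ?thesis
  proof (rule has_field_derivative_transform_within_open[OF first_variation])
    show "integral cell (\<lambda>x. adapted_density (t, x)) = willmore_energy \<tau> (X t) (N t)" if "t \<in> {-\<delta><..<\<delta>}" for t
      using willmore_energy_adapted_density[OF that, of "N t"] N[OF that] by simp
  qed (use \<delta> in auto)
qed

text \<open>Since the unit normal has no component along the circles, the angular velocities vanish and \<open>\<rho>\<close> has
  velocity \<open>- 2 a b \<sigma> f\<close>; the sign \<open>\<sigma>\<close> disappears in the square.\<close>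
lemma second_variation_value:
  assumes V: "variation \<tau> (clifford_torus a b) X N" and f: "initial_normal_velocity X N f" "smooth_on UNIV f"
  shows "(deriv ^^ 2) (\<lambda>t. willmore_energy \<tau> (X t) (N t)) 0 = 8 * q * pref * hessian f"
proof -
  obtain \<delta> where F: "torus_family \<tau> a b \<delta> (\<lambda>(t, x). X t x)" and N: "\<And>t. t \<in> {-\<delta><..<\<delta>} \<Longrightarrow> unit_normal \<tau> (X t) (N t)"
    using variation_torus_family[OF V] by blast
  define Y where "Y = (\<lambda>(t, x). X t x)"
  interpret torus_family \<tau> a b \<delta> Y unfolding Y_def by (rule F)
  have X0: "X 0 = clifford_torus a b" using V unfolding variation_def by blast
  then have "unit_normal \<tau> (clifford_torus a b) (N 0)" using N[OF zero_in] by simp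
  then obtain \<sigma> where \<sigma>: "\<sigma>\<^sup>2 = 1" "\<And>u v. N 0 (u, v) = frame_vec u v (- b * \<sigma>) 0 (a * \<sigma>) 0"
    using clifford_unit_normal by blast
  have dY: "dird tdir Y (0, (u, v)) = frame_vec u v (- b * \<sigma> * f (u, v)) 0 (a * \<sigma> * f (u, v)) 0" for u v
  proof -
    have "((\<lambda>t. (t, u, v)) has_derivative (\<lambda>h. (h, 0))) (at 0)" by (auto intro!: derivative_eq_intros simp: zero_prod_def)
    from has_derivative_compose[OF this smooth_on_has_derivative[OF P(2) base_in]]
    have d1: "((\<lambda>t. Y (t, u, v)) has_derivative (\<lambda>h. dird (h, 0) Y (0, (u, v)))) (at 0)" by simp
    have d2: "((\<lambda>t. Y (t, u, v)) has_derivative (\<lambda>h. h *\<^sub>R (f (u, v) *\<^sub>R N 0 (u, v)))) (at 0)"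
      using f(1) unfolding initial_normal_velocity_def has_vector_derivative_def Y_def by simp
    have "dird (1, 0) Y (0, (u, v)) = 1 *\<^sub>R (f (u, v) *\<^sub>R N 0 (u, v))"
      using has_derivative_unique[OF d1 d2] by meson
    then show ?thesis by (simp add: \<sigma>(2) scaleR_frame_vec mult_ac)
  qed
  have zt: "dird tdir \<zeta> (0, (u, v)) = cis u * of_real (- b * \<sigma> * f (u, v))"
    and wt: "dird tdir \<omega> (0, (u, v)) = cis v * of_real (a * \<sigma> * f (u, v))" for u v
  proof -
    have "dird tdir \<zeta> (0, (u, v)) = fst (dird tdir Y (0, (u, v)))" "dird tdir \<omega> (0, (u, v)) = snd (dird tdir Y (0, (u, v)))"
      by (rule dird_bounded_linear[OF bounded_linear_fst P(2) base_in], rule dird_bounded_linear[OF bounded_linear_snd P(2) base_in])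
    then show "dird tdir \<zeta> (0, (u, v)) = cis u * of_real (- b * \<sigma> * f (u, v))"
      "dird tdir \<omega> (0, (u, v)) = cis v * of_real (a * \<sigma> * f (u, v))"
      unfolding dY by (simp_all add: frame_vec_def complex_eq_iff)
  qed
  have z0: "\<zeta> (0, (u, v)) = of_real a * cis u" and w0: "\<omega> (0, (u, v)) = of_real b * cis v" for u v
    unfolding base by (simp_all add: clifford_torus_def)
  have A: "arg_deriv tdir \<zeta> (0, x) = 0" "arg_deriv tdir \<omega> (0, x) = 0" for x
    by (cases x; simp add: arg_deriv_def zt wt z0 w0)+
  have ht: "ht (0, x) = (- 2 * a * b * \<sigma>) * f x" for x
  proof (cases x)
    case (Pair u v)
    have "ht (0, (u, v)) = 2 * (a * cos u * (cos u * (- b * \<sigma> * f (u, v))) + a * sin u * (sin u * (- b * \<sigma> * f (u, v))))"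
      unfolding height_def dird_modsq[OF P(3) base_in] zt z0 by simp
    also have "\<dots> = - 2 * a * b * \<sigma> * f (u, v) * ((cos u)\<^sup>2 + (sin u)\<^sup>2)"
      by algebra
    also have "(cos u)\<^sup>2 + (sin u)\<^sup>2 = 1" by simp
    finally show ?thesis using Pair by simp
  qed
  have "(deriv ^^ 2) (\<lambda>t. willmore_energy \<tau> (X t) (N t)) 0 = (deriv ^^ 2) (\<lambda>t. integral cell (\<lambda>x. adapted_density (t, x))) 0"
  proof (rule deriv2_cong[OF \<delta>])
    show "willmore_energy \<tau> (X t) (N t) = integral cell (\<lambda>x. adapted_density (t, x))" if "t \<in> {-\<delta><..<\<delta>}" for t
      using willmore_energy_adapted_density[OF that, of "N t"] N[OF that] by (simp add: Y_def)
  qed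
  also have "\<dots> = 2 * pref * (- 2 * a * b * \<sigma>)\<^sup>2 * hessian f"
    by (rule second_derivative[OF A f(2) ht])
  also have "(- 2 * a * b * \<sigma>)\<^sup>2 = 4 * q" unfolding q_def a2(3) by (simp add: power_mult_distrib \<sigma>(1))
  finally show ?thesis by simp
qed

lemma second_variation_eq:
  assumes "variation \<tau> (clifford_torus a b) X N" "initial_normal_velocity X N f" "smooth_on UNIV f"
  shows "second_variation \<tau> (clifford_torus a b) f = 8 * q * pref * hessian f"
  unfolding second_variation_def
proof (rule the_equality)
  show "\<exists>X N. variation \<tau> (clifford_torus a b) X N \<and> initial_normal_velocity X N f \<and>
      8 * q * pref * hessian f = (deriv ^^ 2) (\<lambda>t. willmore_energy \<tau> (X t) (N t)) 0"
    using assms second_variation_value[OF assms] by metis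
next
  fix k assume "\<exists>X N. variation \<tau> (clifford_torus a b) X N \<and> initial_normal_velocity X N f \<and>
      k = (deriv ^^ 2) (\<lambda>t. willmore_energy \<tau> (X t) (N t)) 0"
  then show "k = 8 * q * pref * hessian f" using second_variation_value assms(3) by blast
qed

end

section \<open>Existence of variations with given normal velocity\<close>

lemma smooth_on_snd_compose:
  fixes f :: "'b::euclidean_space \<Rightarrow> 'c::real_normed_vector" and S :: "('a::euclidean_space \<times> 'b) set"
  assumes S: "open S" and f: "smooth_on UNIV f"
  shows "smooth_on S (\<lambda>y. f (snd y))"
  unfolding smooth_on_def
proof
  fix k
  have "Ck_on k S (\<lambda>y. f (snd y))" if "smooth_on UNIV f" for f :: "'b \<Rightarrow> 'c"
    using that
  proof (induction k arbitrary: f)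
    case 0
    have "continuous_on S (\<lambda>y. f (snd y))"
      by (rule continuous_on_compose2[OF smooth_on_continuous[OF 0]]) (auto intro: continuous_intros)
    then show ?case by simp
  next
    case (Suc k)
    show ?case
    proof (rule Ck_on_SucI[OF S])
      fix x :: "'a \<times> 'b"
      show "((\<lambda>y. f (snd y)) has_derivative (\<lambda>v. dird (snd v) f (snd x))) (at x)"
        using has_derivative_compose[OF has_derivative_snd[OF has_derivative_ident] smooth_on_has_derivative[OF Suc.prems UNIV_I]] .
      show "Ck_on k S (\<lambda>x. dird (snd v) f (snd x))" for v :: "'a \<times> 'b"
        by (rule Suc.IH[OF smooth_on_dird[OF Suc.prems]])
    qed
  qed
  then show "Ck_on k S (\<lambda>y. f (snd y))" using f by blast
qed

lemma doubly_periodic_dird: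
  fixes f :: "real \<times> real \<Rightarrow> real"
  assumes f: "smooth_on UNIV f" and p: "doubly_periodic f"
  shows "doubly_periodic (dird d f)"
  unfolding doubly_periodic_def
proof (intro allI conjI)
  fix u v
  have "f (y + (2 * pi, 0)) = f y" "f (y + (0, 2 * pi)) = f y" for y
    using p by (cases y; simp add: doubly_periodic_def)+
  then have "dird d f ((u, v) + (2 * pi, 0)) = dird d f (u, v)" "dird d f ((u, v) + (0, 2 * pi)) = dird d f (u, v)"
    by (intro dird_translate[OF open_UNIV UNIV_I _ f UNIV_I]; blast)+
  then show "dird d f (u + 2 * pi, v) = dird d f (u, v)" "dird d f (u, v + 2 * pi) = dird d f (u, v)" by simp_all
qed

lemma doubly_periodic_bounded:
  fixes f :: "real \<times> real \<Rightarrow> real"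
  assumes "continuous_on UNIV f" "doubly_periodic f"
  obtains M where "M > 0" "\<And>x. \<bar>f x\<bar> \<le> M"
proof -
  have "compact (f ` cell)"
    by (rule compact_continuous_image[OF continuous_on_subset[OF assms(1)]]) auto
  then obtain M where M: "\<And>y. y \<in> f ` cell \<Longrightarrow> norm y \<le> M" using compact_imp_bounded bounded_iff by metis
  have "\<bar>f x\<bar> \<le> max M 1" for x
  proof -
    obtain x' where "x' \<in> cell" "f x = f x'"
      using doubly_periodic_reduce[where 'b = real, of x] assms(2) by blast
    then show ?thesis using M[of "f x'"] by auto
  qed
  then show thesis using that[of "max M 1"] by simp
qed

lemma smooth_on_frame_vec:
  assumes "open S" "smooth_on S U" "smooth_on S V" "smooth_on S A" "smooth_on S B" "smooth_on S A'" "smooth_on S B'"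
  shows "smooth_on S (\<lambda>y. frame_vec (U y) (V y) (A y) (B y) (A' y) (B' y))"
proof -
  have "frame_vec u v p r p' r' = (cos u * p - sin u * r) *\<^sub>R (1, 0) + (cos u * r + sin u * p) *\<^sub>R (\<i>, 0)
      + (cos v * p' - sin v * r') *\<^sub>R (0, 1) + (cos v * r' + sin v * p') *\<^sub>R (0, \<i>)" for u v p r p' r'
    by (simp add: frame_vec_def complex_eq_iff)
  then show ?thesis using assms by (simp only:) (intro smooth_intros)
qed

lemma frame_vec_eq_0: "frame_vec u v p r p' r' = 0 \<longleftrightarrow> p = 0 \<and> r = 0 \<and> p' = 0 \<and> r' = 0"
  by (simp add: frame_vec_def zero_prod_def Complex_eq_0)

lemma frame_vec_periodic: "frame_vec (u + 2 * pi) v p r p' r' = frame_vec u v p r p' r'" "frame_vec u (v + 2 * pi) p r p' r' = frame_vec u v p r p' r'"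
  by (simp_all add: frame_vec_def complex_eq_iff)

text \<open>Both radii of the varied torus have this form: the pair \<open>(a, b)\<close> is rotated by the angle
  \<open>arctan (t w)\<close>.\<close>
lemma rotated_has_derivative:
  fixes a b t w :: real
  defines "R \<equiv> inverse (sqrt (1 + (t * w)\<^sup>2))"
  shows "((\<lambda>w. (a - t * w * b) * inverse (sqrt (1 + (t * w)\<^sup>2))) has_real_derivative - ((b + t * w * a) * R) * (t * R\<^sup>2)) (at w)"
proof -
  define D where "D = 1 + (t * w)\<^sup>2"
  have D: "D > 0" unfolding D_def by (simp add: add_pos_nonneg)
  have R2: "R\<^sup>2 * D = 1" using D unfolding R_def D_def[symmetric] by (simp add: power_inverse)
  have "((\<lambda>x. inverse (sqrt x)) has_real_derivative - (1/2) * (R * R * R)) (at D)"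
    using D unfolding R_def D_def[symmetric]
    by (auto intro!: derivative_eq_intros simp: field_simps power2_eq_square)
  moreover have "((\<lambda>w. 1 + (t * w)\<^sup>2) has_real_derivative 2 * (t * w) * t) (at w)"
    by (auto intro!: derivative_eq_intros)
  ultimately have 1: "((\<lambda>w. inverse (sqrt (1 + (t * w)\<^sup>2))) has_real_derivative - (1/2) * (R * R * R) * (2 * (t * w) * t)) (at w)"
    unfolding D_def by (rule DERIV_chain2)
  have 2: "((\<lambda>w. a - t * w * b) has_real_derivative - t * b) (at w)" by (auto intro!: derivative_eq_intros)
  have "(- t * b) * R + (- (1/2) * (R * R * R) * (2 * (t * w) * t)) * (a - t * w * b) = - ((b + t * w * a) * R) * (t * R\<^sup>2)"
    using R2 unfolding D_def by algebra
  then show ?thesis using DERIV_mult[OF 2 1] by (simp add: R_def)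
qed

context critical_torus
begin

text \<open>The angular components of a normal with component \<open>1\<close> along the meridian solve a linear system with
  the metric of the torus as matrix, of determinant \<open>\<tau>\<^sup>2 c\<^sup>2 s\<^sup>2\<close>; this is its solution.\<close>
lemma normal_coefficients:
  fixes c s p r :: real
  assumes c: "c > 0" "s > 0" "c\<^sup>2 + s\<^sup>2 = 1"
  defines "k \<equiv> \<tau>\<^sup>2 - 1"
  defines "n1 \<equiv> - ((1 + k * s\<^sup>2) / c\<^sup>2 * p - k * r) / \<tau>\<^sup>2" and "n2 \<equiv> - ((1 + k * c\<^sup>2) / s\<^sup>2 * r - k * p) / \<tau>\<^sup>2"
  shows "p + c\<^sup>2 * n1 + k * (c\<^sup>2 * n1 + s\<^sup>2 * n2) * c\<^sup>2 = 0" "r + s\<^sup>2 * n2 + k * (c\<^sup>2 * n1 + s\<^sup>2 * n2) * s\<^sup>2 = 0"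
proof -
  define T where "T = \<tau>\<^sup>2"
  have T: "T > 0" "T \<noteq> 0" using \<tau> by (simp_all add: T_def)
  have kT: "T = 1 + k" by (simp add: k_def T_def)
  have 1: "c\<^sup>2 * n1 = - ((1 + k * s\<^sup>2) * p - k * c\<^sup>2 * r) / T" "s\<^sup>2 * n2 = - ((1 + k * c\<^sup>2) * r - k * s\<^sup>2 * p) / T"
    unfolding n1_def n2_def T_def[symmetric] using c T by (simp_all add: field_simps)
  have 2: "c\<^sup>2 * n1 + s\<^sup>2 * n2 = - (p + r) / T"
    unfolding 1 using T by (simp add: field_simps)
  have s2: "s\<^sup>2 = 1 - c\<^sup>2" using c(3) by simp
  show "p + c\<^sup>2 * n1 + k * (c\<^sup>2 * n1 + s\<^sup>2 * n2) * c\<^sup>2 = 0"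
    unfolding 2 unfolding 1(1) unfolding s2 using T unfolding kT by (simp add: field_simps)
  show "r + s\<^sup>2 * n2 + k * (c\<^sup>2 * n1 + s\<^sup>2 * n2) * s\<^sup>2 = 0"
    unfolding 2 unfolding 1(2) unfolding s2 using T unfolding kT by (simp add: field_simps)
qed

text \<open>The radii \<open>(a, b)\<close> are rotated by the angle \<open>arctan (t f)\<close> at every point. This keeps the surface in
  the sphere, involves no trigonometric functions of \<open>f\<close>, and has an explicit unit normal.\<close>
lemma variation_exists:
  assumes f: "smooth_on UNIV f" "doubly_periodic f"
  shows "\<exists>X N. variation \<tau> (clifford_torus a b) X N \<and> initial_normal_velocity X N f"
proof -
  define k where "k = \<tau>\<^sup>2 - 1"
  have k: "k > 0" using \<tau> unfolding k_def by simp
  obtain M where M: "M > 0" "\<And>x. \<bar>f x\<bar> \<le> M"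
    using doubly_periodic_bounded[OF smooth_on_continuous[OF f(1)] f(2)] by blast
  \<comment> \<open>ensures \<open>|t f| < min a b\<close>, and \<open>a, b \<le> 1\<close>, so both rotated radii stay positive\<close>
  define \<epsilon> where "\<epsilon> = min a b / M"
  have \<epsilon>: "\<epsilon> > 0" using ab M by (simp add: \<epsilon>_def)
  define R c s where "R = (\<lambda>y :: real \<times> real \<times> real. inverse (sqrt (1 + (fst y * f (snd y))\<^sup>2)))"
    and "c = (\<lambda>y. (a - fst y * f (snd y) * b) * R y)" and "s = (\<lambda>y. (b + fst y * f (snd y) * a) * R y)"
  \<comment> \<open>the derivatives of the rotation angle; \<open>R\<close> is the inverse of the norm of the rotated pair\<close>
  define \<beta> where "\<beta> = (\<lambda>d (y :: real \<times> real \<times> real). fst y * dird d f (snd y) * (R y)\<^sup>2)"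
  define n1 n2 where "n1 = (\<lambda>y. - ((1 + k * (s y)\<^sup>2) / (c y)\<^sup>2 * \<beta> (1, 0) y - k * \<beta> (0, 1) y) / \<tau>\<^sup>2)"
    and "n2 = (\<lambda>y. - ((1 + k * (c y)\<^sup>2) / (s y)\<^sup>2 * \<beta> (0, 1) y - k * \<beta> (1, 0) y) / \<tau>\<^sup>2)"
  \<comment> \<open>the squared length of the normal before scaling\<close>
  define L where "L = (\<lambda>y. 1 + (c y)\<^sup>2 * (n1 y)\<^sup>2 + (s y)\<^sup>2 * (n2 y)\<^sup>2 + k * ((c y)\<^sup>2 * n1 y + (s y)\<^sup>2 * n2 y)\<^sup>2)"
  define m where "m = (\<lambda>y. inverse (sqrt (L y)))"
  define X where "X = (\<lambda>t x. frame_vec (fst x) (snd x) (c (t, x)) 0 (s (t, x)) 0)"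
  define N where "N = (\<lambda>t x. frame_vec (fst x) (snd x) (- s (t, x) * m (t, x)) (c (t, x) * n1 (t, x) * m (t, x))
      (c (t, x) * m (t, x)) (s (t, x) * n2 (t, x) * m (t, x)))"
  have Rp: "R y > 0" "(R y)\<^sup>2 * (1 + (fst y * f (snd y))\<^sup>2) = 1" for y
  proof -
    have "1 + (fst y * f (snd y))\<^sup>2 > 0" by (simp add: add_pos_nonneg)
    then show "R y > 0" "(R y)\<^sup>2 * (1 + (fst y * f (snd y))\<^sup>2) = 1" unfolding R_def by (simp_all add: power_inverse)
  qed
  have cs: "(c y)\<^sup>2 + (s y)\<^sup>2 = 1" for y
  proof -
    have "(c y)\<^sup>2 + (s y)\<^sup>2 = (a\<^sup>2 + b\<^sup>2) * ((R y)\<^sup>2 * (1 + (fst y * f (snd y))\<^sup>2))"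
      unfolding c_def s_def by algebra
    then show ?thesis unfolding Rp(2) ab(3) by simp
  qed
  have pos: "c y > 0" "s y > 0" if "y \<in> slab \<epsilon>" for y
  proof -
    have "\<bar>fst y\<bar> < \<epsilon>" using that by auto
    then have "\<bar>fst y\<bar> * \<bar>f (snd y)\<bar> < \<epsilon> * M"
    proof -
      have "\<bar>fst y\<bar> * \<bar>f (snd y)\<bar> \<le> \<bar>fst y\<bar> * M" using M(2) by (intro mult_left_mono) auto
      also have "\<dots> < \<epsilon> * M" using \<open>\<bar>fst y\<bar> < \<epsilon>\<close> M(1) by simp
      finally show ?thesis .
    qed
    then have w: "\<bar>fst y * f (snd y)\<bar> < min a b" using M(1) by (simp add: \<epsilon>_def abs_mult)
    have "a\<^sup>2 \<le> 1\<^sup>2" "b\<^sup>2 \<le> 1\<^sup>2" 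
      using ab(3) zero_le_power2[of a] zero_le_power2[of b] unfolding power_one by linarith+
    then have ab1: "a \<le> 1" "b \<le> 1" by (auto intro: power2_le_imp_le)
    have "\<bar>fst y * f (snd y) * b\<bar> \<le> \<bar>fst y * f (snd y)\<bar>" "\<bar>fst y * f (snd y) * a\<bar> \<le> \<bar>fst y * f (snd y)\<bar>"
      using ab1 ab mult_left_mono[OF ab1(2), of "\<bar>fst y * f (snd y)\<bar>"] mult_left_mono[OF ab1(1), of "\<bar>fst y * f (snd y)\<bar>"]
      by (simp_all add: abs_mult)
    then have "a - fst y * f (snd y) * b > 0" "b + fst y * f (snd y) * a > 0" using w by linarith+
    then show "c y > 0" "s y > 0" unfolding c_def s_def using Rp(1) by simp_all
  qed
  have Lp: "L y > 0" for y
    unfolding L_def using k by (intro add_pos_nonneg mult_nonneg_nonneg) auto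
  have sF: "smooth_on (slab \<epsilon>) (\<lambda>y. f (snd y))" "smooth_on (slab \<epsilon>) (\<lambda>y. dird d f (snd y))" for d
    by (intro smooth_on_snd_compose open_slab smooth_on_dird f(1))+
  have st: "smooth_on (slab \<epsilon>) (\<lambda>y. fst y)" "smooth_on (slab \<epsilon>) (\<lambda>y. fst (snd y))" "smooth_on (slab \<epsilon>) (\<lambda>y. snd (snd y))"
    by (intro smooth_on_linear open_slab bounded_linear_intros)+
  have sR: "smooth_on (slab \<epsilon>) R"
    unfolding R_def by (rule smooth_on_inverse_sqrt[OF open_slab]) (intro smooth_intros open_slab sF st, simp add: add_pos_nonneg)
  have sc: "smooth_on (slab \<epsilon>) c" "smooth_on (slab \<epsilon>) s"
    unfolding c_def s_def by (intro smooth_intros open_slab sF st sR)+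
  have sb: "smooth_on (slab \<epsilon>) (\<beta> d)" for d
    unfolding \<beta>_def by (intro smooth_intros open_slab sF st sR)
  have c0: "(c y)\<^sup>2 \<noteq> 0" "(s y)\<^sup>2 \<noteq> 0" if "y \<in> slab \<epsilon>" for y using pos[OF that] by simp_all
  have sn: "smooth_on (slab \<epsilon>) n1" "smooth_on (slab \<epsilon>) n2"
    unfolding n1_def n2_def using \<tau> c0 by (intro smooth_intros open_slab sc sb; simp)+
  have sm: "smooth_on (slab \<epsilon>) m"
    unfolding m_def by (rule smooth_on_inverse_sqrt[OF open_slab _ Lp]) (unfold L_def, intro smooth_intros open_slab sc sn)
  have sX: "smooth_on (slab \<epsilon>) (\<lambda>(t, x). X t x)"
  proof -
    have "smooth_on (slab \<epsilon>) (\<lambda>y. frame_vec (fst (snd y)) (snd (snd y)) (c y) 0 (s y) 0)"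
      by (intro smooth_on_frame_vec st sc smooth_on_const open_slab)
    then show ?thesis by (simp add: X_def case_prod_beta')
  qed
  have sN: "smooth_on (slab \<epsilon>) (\<lambda>(t, x). N t x)"
  proof -
    have "smooth_on (slab \<epsilon>) (\<lambda>y. frame_vec (fst (snd y)) (snd (snd y)) (- s y * m y) (c y * n1 y * m y) (c y * m y) (s y * n2 y * m y))"
      by (intro smooth_on_frame_vec smooth_on_mult smooth_on_minus st sc sm sn open_slab)
    then show ?thesis by (simp add: N_def case_prod_beta')
  qed
  have per: "c (t, u + 2 * pi, v) = c (t, u, v)" "c (t, u, v + 2 * pi) = c (t, u, v)"
    "s (t, u + 2 * pi, v) = s (t, u, v)" "s (t, u, v + 2 * pi) = s (t, u, v)"
    "n1 (t, u + 2 * pi, v) = n1 (t, u, v)" "n1 (t, u, v + 2 * pi) = n1 (t, u, v)"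
    "n2 (t, u + 2 * pi, v) = n2 (t, u, v)" "n2 (t, u, v + 2 * pi) = n2 (t, u, v)" for t u v
    using f(2) doubly_periodic_dird[OF f, of "(1, 0)"] doubly_periodic_dird[OF f, of "(0, 1)"]
    unfolding doubly_periodic_def n1_def n2_def \<beta>_def c_def s_def R_def by simp_all
  have pX: "doubly_periodic (X t)" for t
    unfolding doubly_periodic_def X_def by (simp add: per frame_vec_periodic)
  have pN: "doubly_periodic (N t)" for t
    unfolding doubly_periodic_def N_def m_def L_def by (simp add: per frame_vec_periodic)
  have df: "(f has_derivative (\<lambda>d. dird d f x)) (at x)" for x by (rule smooth_on_has_derivative[OF f(1) UNIV_I])
  have dc: "((\<lambda>x. c (t, x)) has_derivative (\<lambda>d. - s (t, x) * \<beta> d (t, x))) (at x)" for t x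
    using DERIV_compose_FDERIV[OF rotated_has_derivative[of a t b "f x"] df]
    by (simp add: c_def s_def \<beta>_def R_def mult_ac)
  have ds: "((\<lambda>x. s (t, x)) has_derivative (\<lambda>d. c (t, x) * \<beta> d (t, x))) (at x)" for t x
    using DERIV_compose_FDERIV[OF rotated_has_derivative[of b t "- a" "f x"] df]
    by (simp add: c_def s_def \<beta>_def R_def algebra_simps)
  have dX: "(X t has_derivative (\<lambda>d. frame_vec u v (- s (t, u, v) * \<beta> d (t, u, v)) (c (t, u, v) * fst d)
      (c (t, u, v) * \<beta> d (t, u, v)) (s (t, u, v) * snd d))) (at (u, v))" for t u v
    unfolding X_def using frame_vec_has_derivative[OF dc ds] .
  have S3: "X t x \<in> S3" for t x
    unfolding S3_inner X_def inner_frame_vec using cs[of "(t, x)"] by (simp add: power2_eq_square)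
  have imm: "immersed_torus (X t)" if t: "t \<in> {-\<epsilon><..<\<epsilon>}" for t
    unfolding immersed_torus_def
  proof (intro conjI allI S3 pX)
    show "smooth_on UNIV (X t)" using smooth_slice[OF sX t] by simp
    fix x :: "real \<times> real"
    obtain u v where x: "x = (u, v)" by (cases x)
    have "frechet_derivative (X t) (at x) = (\<lambda>d. frame_vec u v (- s (t, u, v) * \<beta> d (t, u, v)) (c (t, u, v) * fst d)
      (c (t, u, v) * \<beta> d (t, u, v)) (s (t, u, v) * snd d))"
      unfolding x by (rule frechet_derivative_at[OF dX, symmetric])
    moreover have "linear (frechet_derivative (X t) (at x))"
      using has_derivative_linear[OF dX] calculation by (simp add: x)
    moreover have "c (t, u, v) \<noteq> 0" "s (t, u, v) \<noteq> 0" using pos[of "(t, u, v)"] t by auto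
    ultimately show "inj (frechet_derivative (X t) (at x))"
      by (auto simp: linear_injective_0 frame_vec_eq_0 intro!: prod_eqI)
  qed
  have un: "unit_normal \<tau> (X t) (N t)" if t: "t \<in> {-\<epsilon><..<\<epsilon>}" for t
    unfolding unit_normal_def
  proof (intro conjI allI pN)
    show "smooth_on UNIV (N t)" using smooth_slice[OF sN t] by simp
    fix x :: "real \<times> real"
    obtain u v where x: "x = (u, v)" by (cases x)
    define y where "y = (t, u, v)"
    have y: "y \<in> slab \<epsilon>" using t by (simp add: y_def)
    have Ny: "N t x = frame_vec u v (- s y * m y) (c y * n1 y * m y) (c y * m y) (s y * n2 y * m y)"
      and Xy: "X t x = frame_vec u v (c y) 0 (s y) 0" by (simp_all add: N_def X_def x y_def)
    have Dy: "pd i (X t) x = frame_vec u v (- s y * \<beta> (coord_dir i) y) (c y * fst (coord_dir i)) (c y * \<beta> (coord_dir i) y) (s y * snd (coord_dir i))" for i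
      unfolding pd_eq_dird x y_def by (rule dirdI[OF dX])
    show "N t x \<in> tangent_S3 (X t x)"
      unfolding tangent_S3_def Ny Xy by (simp add: inner_frame_vec)
    have mL: "(m y)\<^sup>2 * L y = 1" using Lp[of y] unfolding m_def by (simp add: power_inverse)
    have "berger_metric \<tau> (X t x) (N t x) (N t x) =
      (m y)\<^sup>2 * ((c y)\<^sup>2 + (s y)\<^sup>2 + (c y)\<^sup>2 * (n1 y)\<^sup>2 + (s y)\<^sup>2 * (n2 y)\<^sup>2 + k * ((c y)\<^sup>2 * n1 y + (s y)\<^sup>2 * n2 y)\<^sup>2)"
      unfolding berger_metric_def Ny Xy hopf_frame_vec inner_frame_vec k_def by (simp add: power2_eq_square algebra_simps)
    also have "\<dots> = 1" unfolding cs using mL by (simp add: L_def)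
    finally show "berger_metric \<tau> (X t x) (N t x) (N t x) = 1" .
    fix i :: 2
    have g: "berger_metric \<tau> (X t x) (N t x) (pd i (X t) x) =
      m y * (((c y)\<^sup>2 + (s y)\<^sup>2) * \<beta> (coord_dir i) y + (c y)\<^sup>2 * n1 y * fst (coord_dir i) + (s y)\<^sup>2 * n2 y * snd (coord_dir i)
       + k * ((c y)\<^sup>2 * n1 y + (s y)\<^sup>2 * n2 y) * ((c y)\<^sup>2 * fst (coord_dir i) + (s y)\<^sup>2 * snd (coord_dir i)))"
      unfolding berger_metric_def Ny Xy Dy hopf_frame_vec inner_frame_vec k_def by (simp add: power2_eq_square algebra_simps)
    have n: "\<beta> (1, 0) y + (c y)\<^sup>2 * n1 y + k * ((c y)\<^sup>2 * n1 y + (s y)\<^sup>2 * n2 y) * (c y)\<^sup>2 = 0"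
      "\<beta> (0, 1) y + (s y)\<^sup>2 * n2 y + k * ((c y)\<^sup>2 * n1 y + (s y)\<^sup>2 * n2 y) * (s y)\<^sup>2 = 0"
      unfolding n1_def n2_def k_def by (rule normal_coefficients[OF pos(1)[OF y] pos(2)[OF y] cs])+
    show "berger_metric \<tau> (X t x) (N t x) (pd i (X t) x) = 0"
      unfolding g cs using n by (cases "i = 1") (simp_all add: coord_dir_def)
  qed
  have c00: "c (0, x) = a" "s (0, x) = b" "n1 (0, x) = 0" "n2 (0, x) = 0" "m (0, x) = 1" for x
    by (simp_all add: m_def L_def n1_def n2_def \<beta>_def c_def s_def R_def)
  have X0: "X 0 = clifford_torus a b"
  proof
    fix x show "X 0 x = clifford_torus a b x" by (cases x) (simp add: X_def c00 clifford_frame_vec)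
  qed
  have vel: "((\<lambda>t. X t x) has_vector_derivative f x *\<^sub>R N 0 x) (at 0)" for x
  proof -
    have C: "((\<lambda>t. c (t, x)) has_real_derivative - b * f x) (at 0)"
      using rotated_has_derivative[of a "f x" b 0] by (simp add: c_def R_def mult_ac)
    have S: "((\<lambda>t. s (t, x)) has_real_derivative a * f x) (at 0)"
      using rotated_has_derivative[of b "f x" "- a" 0] by (simp add: s_def R_def mult_ac)
    have X: "(\<lambda>t. X t x) = (\<lambda>t. c (t, x) *\<^sub>R frame_vec (fst x) (snd x) 1 0 0 0 + s (t, x) *\<^sub>R frame_vec (fst x) (snd x) 0 0 1 0)"
      unfolding X_def scaleR_frame_vec by (simp add: fun_eq_iff frame_vec_def complex_eq_iff)
    have "((\<lambda>t. X t x) has_vector_derivative (- b * f x) *\<^sub>R frame_vec (fst x) (snd x) 1 0 0 0 + (a * f x) *\<^sub>R frame_vec (fst x) (snd x) 0 0 1 0) (at 0)"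
      unfolding X by (rule has_vector_derivative_eq_rhs[OF has_vector_derivative_add[OF
            has_vector_derivative_scaleR[OF C has_vector_derivative_const] has_vector_derivative_scaleR[OF S has_vector_derivative_const]]]) simp
    moreover have "(- b * f x) *\<^sub>R frame_vec (fst x) (snd x) 1 0 0 0 + (a * f x) *\<^sub>R frame_vec (fst x) (snd x) 0 0 1 0 = f x *\<^sub>R N 0 x"
      unfolding N_def scaleR_frame_vec c00 by (simp add: frame_vec_def complex_eq_iff)
    ultimately show ?thesis by simp
  qed
  have "variation \<tau> (clifford_torus a b) X N"
    unfolding variation_def using \<epsilon> sX sN imm un X0 by blast
  moreover have "initial_normal_velocity X N f"
    unfolding initial_normal_velocity_def using vel by blast
  ultimately show ?thesis by blast
qed

lemma willmore_surface_clifford: "willmore_surface \<tau> (clifford_torus a b)"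
proof -
  have "smooth_on UNIV (\<lambda>x :: real \<times> real. 0 :: real)" by (rule smooth_on_const) simp
  moreover have "doubly_periodic (\<lambda>x :: real \<times> real. 0 :: real)" by (simp add: doubly_periodic_def)
  ultimately obtain X N where V: "variation \<tau> (clifford_torus a b) X N" using variation_exists by blast
  then obtain \<epsilon> where "\<epsilon> > 0" "X 0 = clifford_torus a b" "\<forall>t\<in>{-\<epsilon><..<\<epsilon>}. immersed_torus (X t) \<and> unit_normal \<tau> (X t) (N t)"
    unfolding variation_def by blast
  then have "immersed_torus (clifford_torus a b)" "unit_normal \<tau> (clifford_torus a b) (N 0)" by force+
  then show ?thesis unfolding willmore_surface_def using first_variation_zero by blast
qed

end

section \<open>The second variation on Fourier modes\<close>

definition cos_mode :: "nat \<Rightarrow> real \<times> real \<Rightarrow> real" where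
  "cos_mode m = (\<lambda>x. cos (real m * fst x + snd x))"

definition sin_mode :: "nat \<Rightarrow> real \<times> real \<Rightarrow> real" where
  "sin_mode m = (\<lambda>x. sin (real m * fst x + snd x))"

lemma smooth_on_phase: "smooth_on UNIV (\<lambda>x :: real \<times> real. p * fst x + r * snd x)"
  by (intro smooth_on_linear open_UNIV bounded_linear_intros)

lemma sin_cos_int_period:
  "cos (t + 2 * pi * of_int k) = cos t" "sin (t + 2 * pi * of_int k) = sin t"
  using sin_cos_eq_iff[of "t + 2 * pi * of_int k" t] by auto

text \<open>The integrand is a derivative of a periodic function.\<close>
lemma integral_cos_phase:
  assumes "p \<noteq> 0 \<or> r \<noteq> (0::int)"
  shows "((\<lambda>x. cos (of_int p * fst x + of_int r * snd x)) has_integral 0) cell"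
proof -
  have "\<exists>(k :: real) d. \<forall>x :: real \<times> real. dird d (\<lambda>x. k * sin (of_int p * fst x + of_int r * snd x)) x = cos (of_int p * fst x + of_int r * snd x)"
  proof -
    have d: "dird d (\<lambda>x. k * sin (of_int p * fst x + of_int r * snd x)) x =
        k * (of_int p * fst d + of_int r * snd d) * cos (of_int p * fst x + of_int r * snd x)" for d x :: "real \<times> real" and k
      by (rule dirdI, (rule derivative_eq_intros refl)+) (simp add: algebra_simps)
    show ?thesis
    proof (cases "p = 0")
      case False
      show ?thesis
      proof (intro exI allI)
        show "dird (1, 0) (\<lambda>x :: real \<times> real. 1 / of_int p * sin (of_int p * fst x + of_int r * snd x)) x = cos (of_int p * fst x + of_int r * snd x)" for x
          using False unfolding d by simp
      qed
    next
      case True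
      show ?thesis
      proof (intro exI allI)
        show "dird (0, 1) (\<lambda>x :: real \<times> real. 1 / of_int r * sin (of_int p * fst x + of_int r * snd x)) x = cos (of_int p * fst x + of_int r * snd x)" for x
          using True assms unfolding d by simp
      qed
    qed
  qed
  then obtain k :: real and d where kd: "dird d (\<lambda>x :: real \<times> real. k * sin (of_int p * fst x + of_int r * snd x)) = (\<lambda>x. cos (of_int p * fst x + of_int r * snd x))"
    by blast
  have "doubly_periodic (\<lambda>x. k * sin (of_int p * fst x + of_int r * snd x))"
    unfolding doubly_periodic_def
  proof (intro allI conjI)
    fix u v :: real
    have "of_int p * (u + 2 * pi) + of_int r * v = (of_int p * u + of_int r * v) + 2 * pi * of_int p"
      "of_int p * u + of_int r * (v + 2 * pi) = (of_int p * u + of_int r * v) + 2 * pi * of_int r" by (simp_all add: algebra_simps)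
    then show "k * sin (of_int p * fst (u + 2 * pi, v) + of_int r * snd (u + 2 * pi, v)) = k * sin (of_int p * fst (u, v) + of_int r * snd (u, v))"
      "k * sin (of_int p * fst (u, v + 2 * pi) + of_int r * snd (u, v + 2 * pi)) = k * sin (of_int p * fst (u, v) + of_int r * snd (u, v))"
      unfolding fst_conv snd_conv by (simp_all only: sin_cos_int_period)
  qed
  moreover have "smooth_on UNIV (\<lambda>x :: real \<times> real. k * sin (of_int p * fst x + of_int r * snd x))"
    by (intro smooth_intros open_UNIV smooth_on_phase)
  ultimately show ?thesis using integral_dird_periodic[of _ d] unfolding kd[symmetric] by blast
qed

lemma mode_orthogonal:
  "((\<lambda>x. cos_mode m x * cos_mode n x) has_integral (if m = n then 2 * pi\<^sup>2 else 0)) cell"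
  "((\<lambda>x. sin_mode m x * sin_mode n x) has_integral (if m = n then 2 * pi\<^sup>2 else 0)) cell"
proof -
  have plus: "((\<lambda>x. cos ((real m + real n) * fst x + 2 * snd x)) has_integral 0) cell"
    using integral_cos_phase[of "int m + int n" 2] by simp
  have minus: "((\<lambda>x. cos ((real m - real n) * fst x)) has_integral (if m = n then 4 * pi\<^sup>2 else 0)) cell"
  proof (cases "m = n")
    case True
    show ?thesis
      using True has_integral_const[of "1 :: real" "(0, 0) :: real \<times> real" "(2 * pi, 2 * pi)"]
      by (simp add: content_Pair power2_eq_square)
  next
    case False
    then show ?thesis using integral_cos_phase[of "int m - int n" 0] by simp
  qed
  have e: "cos_mode m x * cos_mode n x = (1/2) * cos ((real m - real n) * fst x) + (1/2) * cos ((real m + real n) * fst x + 2 * snd x)"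
    "sin_mode m x * sin_mode n x = (1/2) * cos ((real m - real n) * fst x) + (-1/2) * cos ((real m + real n) * fst x + 2 * snd x)" for x
    unfolding cos_mode_def sin_mode_def cos_times_cos sin_times_sin by (simp_all add: field_simps)
  have h: "(if m = n then 2 * pi\<^sup>2 else 0) = (1/2) * (if m = n then 4 * pi\<^sup>2 else 0) + k * 0" for k :: real by simp
  show "((\<lambda>x. cos_mode m x * cos_mode n x) has_integral (if m = n then 2 * pi\<^sup>2 else 0)) cell"
    unfolding e h[of "1/2"] by (intro has_integral_add has_integral_mult_right minus plus)
  show "((\<lambda>x. sin_mode m x * sin_mode n x) has_integral (if m = n then 2 * pi\<^sup>2 else 0)) cell"
    unfolding e h[of "-1/2"] by (intro has_integral_add has_integral_mult_right minus plus)
qed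

lemma orthogonal_sum_product:
  fixes g :: "nat \<Rightarrow> real \<times> real \<Rightarrow> real"
  assumes o: "\<And>m n. ((\<lambda>x. g m x * g n x) has_integral (if m = n then k else 0)) cell"
  shows "((\<lambda>x. (\<Sum>m<M. A m * g m x) * (\<Sum>m<M. B m * g m x)) has_integral (k * (\<Sum>m<M. A m * B m))) cell"
proof -
  have "((\<lambda>x. \<Sum>m<M. \<Sum>n<M. (A m * B n) * (g m x * g n x)) has_integral (\<Sum>m<M. \<Sum>n<M. (A m * B n) * (if m = n then k else 0))) cell"
    by (rule has_integral_sum[OF finite_lessThan], rule has_integral_sum[OF finite_lessThan],
        rule has_integral_mult_right[OF o])
  moreover have "(\<Sum>m<M. A m * g m x) * (\<Sum>m<M. B m * g m x) = (\<Sum>m<M. \<Sum>n<M. (A m * B n) * (g m x * g n x))" for x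
    by (simp add: sum_product mult_ac)
  moreover have "(\<Sum>m<M. \<Sum>n<M. (A m * B n) * (if m = n then k else 0)) = k * (\<Sum>m<M. A m * B m)"
  proof -
    have "(\<Sum>n<M. (A m * B n) * (if m = n then k else 0)) = (if m < M then k * (A m * B m) else 0)" for m
      by (simp add: if_distrib[where f = "\<lambda>z. _ * z"] sum.delta' cong: if_cong)
    then have "(\<Sum>m<M. \<Sum>n<M. (A m * B n) * (if m = n then k else 0)) = (\<Sum>m<M. k * (A m * B m))"
      by (intro sum.cong refl) simp
    then show ?thesis unfolding sum_distrib_left .
  qed
  ultimately show ?thesis by simp
qed

definition cos_sum :: "nat \<Rightarrow> (nat \<Rightarrow> real) \<Rightarrow> real \<times> real \<Rightarrow> real" where
  "cos_sum M C = (\<lambda>x. \<Sum>m<M. C m * cos_mode m x)"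

definition sin_sum :: "nat \<Rightarrow> (nat \<Rightarrow> real) \<Rightarrow> real \<times> real \<Rightarrow> real" where
  "sin_sum M C = (\<lambda>x. \<Sum>m<M. C m * sin_mode m x)"

lemma smooth_cos_sum: "smooth_on UNIV (cos_sum M C)" "doubly_periodic (cos_sum M C)"
proof -
  have "smooth_on UNIV (cos_mode m)" for m
    using smooth_on_cos[OF open_UNIV smooth_on_phase[of "real m" 1]] by (simp add: cos_mode_def)
  then show "smooth_on UNIV (cos_sum M C)" unfolding cos_sum_def by (intro smooth_intros open_UNIV)
  have "cos_mode m (u + 2 * pi, v) = cos_mode m (u, v)" "cos_mode m (u, v + 2 * pi) = cos_mode m (u, v)" for m u v
  proof -
    have "real m * (u + 2 * pi) + v = (real m * u + v) + 2 * pi * of_int (int m)"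
      "real m * u + (v + 2 * pi) = (real m * u + v) + 2 * pi * of_int 1" by (simp_all add: algebra_simps)
    then show "cos_mode m (u + 2 * pi, v) = cos_mode m (u, v)" "cos_mode m (u, v + 2 * pi) = cos_mode m (u, v)"
      unfolding cos_mode_def fst_conv snd_conv by (simp_all only: sin_cos_int_period)
  qed
  then show "doubly_periodic (cos_sum M C)" by (simp add: doubly_periodic_def cos_sum_def)
qed

lemma dird_cos_sum:
  "dird d (cos_sum M C) = sin_sum M (\<lambda>m. - C m * (real m * fst d + snd d))"
  "dird d (sin_sum M C) = cos_sum M (\<lambda>m. C m * (real m * fst d + snd d))"
proof -
  have "(cos_mode m has_derivative (\<lambda>d. - (real m * fst d + snd d) * sin_mode m x)) (at x)"
    "(sin_mode m has_derivative (\<lambda>d. (real m * fst d + snd d) * cos_mode m x)) (at x)" for m x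
  proof -
    have ph: "((\<lambda>x. real m * fst x + snd x) has_derivative (\<lambda>d. real m * fst d + snd d)) (at x)"
      by (auto intro!: derivative_eq_intros)
    show "(cos_mode m has_derivative (\<lambda>d. - (real m * fst d + snd d) * sin_mode m x)) (at x)"
      "(sin_mode m has_derivative (\<lambda>d. (real m * fst d + snd d) * cos_mode m x)) (at x)"
      unfolding cos_mode_def sin_mode_def
      by (rule has_derivative_eq_rhs[OF DERIV_compose_FDERIV[OF DERIV_cos ph]], simp add: fun_eq_iff algebra_simps,
          rule DERIV_compose_FDERIV[OF DERIV_sin ph])
  qed
  then have "((\<lambda>x. \<Sum>m<M. C m * cos_mode m x) has_derivative (\<lambda>d. \<Sum>m<M. C m * (- (real m * fst d + snd d) * sin_mode m x))) (at x)"
    "((\<lambda>x. \<Sum>m<M. C m * sin_mode m x) has_derivative (\<lambda>d. \<Sum>m<M. C m * ((real m * fst d + snd d) * cos_mode m x))) (at x)" for x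
    by (intro has_derivative_sum has_derivative_mult_right; blast)+
  from dirdI[OF this(1)] dirdI[OF this(2)]
  show "dird d (cos_sum M C) = sin_sum M (\<lambda>m. - C m * (real m * fst d + snd d))"
    "dird d (sin_sum M C) = cos_sum M (\<lambda>m. C m * (real m * fst d + snd d))"
    unfolding cos_sum_def sin_sum_def by (simp_all add: fun_eq_iff algebra_simps)
qed

text \<open>Collected by products of two arguments, for integration term by term.\<close>
lemma hess_quadratic_products:
  "hess_quadratic T q s g r1 r2 r11 r12 r22 =
    (3 / 4 * T^2 * s^4 + 5 * T^2 * q * s^2 + 8 * T^2 * q^2 - T^3 * q * s^2 - 4 * T^3 * q^2) * (g * g)
    + ((4 * T^2 * q + 3 * T^2 * s^2) * (g * r11) + (8 * T^2 * q * s * (g * r12)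
    + ((8 * T^2 * q^2 - T * q * s^2 - 4 * T * q^2) * (g * r22) + ((7 / 4 * T^2 * s^2 + T^3 * q) * (r1 * r1)
    + (6 * T^2 * q * s * (r1 * r2) + ((T^2 * q^2 - 5 / 4 * T * q * s^2) * (r2 * r2)
    + (T^2 / 2 * (r11 * r11) + (- T * q * (r11 * r22) + (2 * T * q * (r12 * r12) + q^2 / 2 * (r22 * r22))))))))))"
  unfolding hess_quadratic_def by (simp add: power2_eq_square algebra_simps)

context critical_torus
begin

text \<open>On a mode \<open>cos (m u + v)\<close> the derivatives in the directions \<open>d1\<close> and \<open>d2\<close> bring down the frequencies
  \<open>x\<close> and \<open>y\<close>, second derivatives with a minus sign.\<close>
definition symbol :: "nat \<Rightarrow> real" where
  "symbol m = (let x = b\<^sup>2 * real m - a\<^sup>2; y = real m + 1 in hess_quadratic (\<tau>\<^sup>2) q s 1 x y (- x\<^sup>2) (- x * y) (- y\<^sup>2))"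

text \<open>Only products of two cosines or of two sines occur, so distinct modes are orthogonal for the form.\<close>
lemma hessian_cos_sum: "hessian (cos_sum M C) = 2 * pi\<^sup>2 * (\<Sum>m<M. (C m)\<^sup>2 * symbol m)"
proof -
  define x y where "x = (\<lambda>m. b\<^sup>2 * real m - a\<^sup>2)" and "y = (\<lambda>m. real m + 1)"
  have d1: "dird d1 (cos_sum M C) = sin_sum M (\<lambda>m. - C m * x m)"
    and d2: "dird d2 (cos_sum M C) = sin_sum M (\<lambda>m. - C m * y m)"
    unfolding dird_cos_sum x_def y_def by (simp_all add: algebra_simps)
  have d11: "dird d1 (sin_sum M (\<lambda>m. - C m * x m)) = cos_sum M (\<lambda>m. - C m * x m * x m)"
    and d12: "dird d1 (sin_sum M (\<lambda>m. - C m * y m)) = cos_sum M (\<lambda>m. - C m * y m * x m)"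
    and d22: "dird d2 (sin_sum M (\<lambda>m. - C m * y m)) = cos_sum M (\<lambda>m. - C m * y m * y m)"
    unfolding dird_cos_sum x_def y_def by (simp_all add: algebra_simps)
  have cc: "((\<lambda>x. cos_sum M A x * cos_sum M B x) has_integral (2 * pi\<^sup>2 * (\<Sum>m<M. A m * B m))) cell"
    and ss: "((\<lambda>x. sin_sum M A x * sin_sum M B x) has_integral (2 * pi\<^sup>2 * (\<Sum>m<M. A m * B m))) cell" for A B
    unfolding cos_sum_def sin_sum_def by (rule orthogonal_sum_product, rule mode_orthogonal)+
  define T where "T = \<tau>\<^sup>2"
  have "hessian (cos_sum M C) =
    (3 / 4 * T^2 * s^4 + 5 * T^2 * q * s^2 + 8 * T^2 * q^2 - T^3 * q * s^2 - 4 * T^3 * q^2) * (2 * pi\<^sup>2 * (\<Sum>m<M. C m * C m))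
    + ((4 * T^2 * q + 3 * T^2 * s^2) * (2 * pi\<^sup>2 * (\<Sum>m<M. C m * (- C m * x m * x m))) + (8 * T^2 * q * s * (2 * pi\<^sup>2 * (\<Sum>m<M. C m * (- C m * y m * x m)))
    + ((8 * T^2 * q^2 - T * q * s^2 - 4 * T * q^2) * (2 * pi\<^sup>2 * (\<Sum>m<M. C m * (- C m * y m * y m))) + ((7 / 4 * T^2 * s^2 + T^3 * q) * (2 * pi\<^sup>2 * (\<Sum>m<M. (- C m * x m) * (- C m * x m)))
    + (6 * T^2 * q * s * (2 * pi\<^sup>2 * (\<Sum>m<M. (- C m * x m) * (- C m * y m))) + ((T^2 * q^2 - 5 / 4 * T * q * s^2) * (2 * pi\<^sup>2 * (\<Sum>m<M. (- C m * y m) * (- C m * y m)))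
    + (T^2 / 2 * (2 * pi\<^sup>2 * (\<Sum>m<M. (- C m * x m * x m) * (- C m * x m * x m))) + (- T * q * (2 * pi\<^sup>2 * (\<Sum>m<M. (- C m * x m * x m) * (- C m * y m * y m)))
    + (2 * T * q * (2 * pi\<^sup>2 * (\<Sum>m<M. (- C m * y m * x m) * (- C m * y m * x m))) + q^2 / 2 * (2 * pi\<^sup>2 * (\<Sum>m<M. (- C m * y m * y m) * (- C m * y m * y m)))))))))))) "
    unfolding hessian_def d1 d2 d11 d12 d22 hess_quadratic_products T_def
    by (rule integral_unique) (intro has_integral_add has_integral_mult_right cc ss)
  also have "\<dots> = 2 * pi\<^sup>2 * (\<Sum>m<M. (C m)\<^sup>2 * symbol m)"
    unfolding symbol_def Let_def hess_quadratic_products T_def[symmetric] x_def[symmetric] y_def[symmetric]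
    unfolding sum_distrib_left sum.distrib[symmetric]
    by (rule sum.cong[OF refl]) (simp add: x_def y_def power2_eq_square algebra_simps)
  finally show ?thesis .
qed

text \<open>Criticality expresses \<open>T\<close> and \<open>s\<^sup>2\<close> through \<open>q\<close>; after this substitution both sides agree.\<close>
lemma symbol_eq:
  defines "T \<equiv> \<tau>\<^sup>2"
  shows "symbol m = (let x = b\<^sup>2 * real m - a\<^sup>2; y = real m + 1 in T\<^sup>2 / 2 * (x\<^sup>2 - 1) * (x\<^sup>2 - 1 + 4 * q) - 2 * s * q * T\<^sup>2 * x * y
    + q * T * x\<^sup>2 * y\<^sup>2 - 2 * q * T * (1 + q) * y\<^sup>2 + q\<^sup>2 * y ^ 4 / 2)"
proof -
  have q: "q > 0" using ab unfolding q_def a2(3) by simp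
  have s2: "s\<^sup>2 = 1 - 4 * q" unfolding s_def q_def by (simp add: power2_eq_square algebra_simps)
  have s4: "s ^ 4 = (1 - 4 * q)\<^sup>2" unfolding s2[symmetric] by simp
  have "4 * T * q - 8 * q - s\<^sup>2 = 0" unfolding T_def by (rule critical_coefficient)
  then have T: "T = (1 + 4 * q) / (4 * q)" using q unfolding s2 by (simp add: field_simps)
  have "hess_quadratic T q s 1 x y (- x\<^sup>2) (- x * y) (- y\<^sup>2) = T\<^sup>2 / 2 * (x\<^sup>2 - 1) * (x\<^sup>2 - 1 + 4 * q) - 2 * s * q * T\<^sup>2 * x * y
    + q * T * x\<^sup>2 * y\<^sup>2 - 2 * q * T * (1 + q) * y\<^sup>2 + q\<^sup>2 * y ^ 4 / 2" for x y
    unfolding hess_quadratic_products s2 s4 T using q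
    by (simp add: field_simps power2_eq_square power3_eq_cube power4_eq_xxxx)
  then show ?thesis unfolding symbol_def T_def[symmetric] Let_def .
qed

end

section \<open>Negative modes and the index\<close>

lemma sum_neg:
  fixes C :: "nat \<Rightarrow> real"
  assumes "\<And>m. m < M \<Longrightarrow> w m < 0" "m < M" "C m \<noteq> 0"
  shows "(\<Sum>m<M. (C m)\<^sup>2 * w m) < 0"
proof -
  have "0 < (\<Sum>m<M. - ((C m)\<^sup>2 * w m))"
  proof (rule sum_pos2[of _ m])
    show "0 < - ((C m)\<^sup>2 * w m)" using assms by (simp add: mult_pos_neg)
    show "0 \<le> - ((C i)\<^sup>2 * w i)" if "i \<in> {..<M}" for i
      using assms(1)[of i] that by (simp add: mult_nonneg_nonpos)
  qed (use assms in auto)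
  then show ?thesis by (simp add: sum_negf)
qed

text \<open>A mode is orthogonal to the span of the others, but not to itself.\<close>
lemma mode_independent:
  "plane_fun.independent (cos_mode ` {..<M})" "card (cos_mode ` {..<M}) = M"
proof -
  have nz: "2 * pi\<^sup>2 \<noteq> (0 :: real)" by simp
  have ne: "cos_mode m \<noteq> cos_mode n" if "m \<noteq> n" for m n
  proof
    assume "cos_mode m = cos_mode n"
    then have "((\<lambda>x. cos_mode m x * cos_mode m x) has_integral 0) cell" using mode_orthogonal(1)[of m n] that by simp
    then show False using has_integral_unique[OF _ mode_orthogonal(1)[of m m]] nz by fastforce
  qed
  show "card (cos_mode ` {..<M}) = M"
    using card_image[of cos_mode "{..<M}"] ne by (auto simp: inj_on_def)
  show "plane_fun.independent (cos_mode ` {..<M})"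
    unfolding plane_fun.dependent_def
  proof
    assume "\<exists>f\<in>cos_mode ` {..<M}. f \<in> plane_fun.span (cos_mode ` {..<M} - {f})"
    then obtain m where m: "cos_mode m \<in> plane_fun.span (cos_mode ` {..<M} - {cos_mode m})" by blast
    define W where "W = {f. ((\<lambda>x. f x * cos_mode m x) has_integral 0) cell}"
    have "plane_fun.subspace W"
      unfolding plane_fun.subspace_def
    proof (intro conjI ballI allI)
      show "0 \<in> W" by (simp add: W_def)
      show "f + g \<in> W" if "f \<in> W" "g \<in> W" for f g
        using that has_integral_add[of "\<lambda>x. f x * cos_mode m x" 0 cell "\<lambda>x. g x * cos_mode m x" 0] by (simp add: W_def distrib_right)
      show "(\<lambda>x. c * f x) \<in> W" if "f \<in> W" for c f
        using that has_integral_mult_right[of "\<lambda>x. f x * cos_mode m x" 0 cell c] by (simp add: W_def mult.assoc)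
    qed
    moreover have "cos_mode ` {..<M} - {cos_mode m} \<subseteq> W"
    proof
      fix f assume "f \<in> cos_mode ` {..<M} - {cos_mode m}"
      then obtain n where f: "f = cos_mode n" and "n \<noteq> m" by blast
      then show "f \<in> W" using mode_orthogonal(1)[of n m] by (simp add: W_def)
    qed
    ultimately have "cos_mode m \<in> W" using m plane_fun.span_minimal by blast
    then have "((\<lambda>x. cos_mode m x * cos_mode m x) has_integral 0) cell" by (simp add: W_def)
    then show False using has_integral_unique[OF _ mode_orthogonal(1)[of m m]] nz by fastforce
  qed
qed

lemma cos_sums_subspace:
  "plane_fun.subspace (range (cos_sum M))" "range (cos_sum M) \<subseteq> plane_fun.span (cos_mode ` {..<M})"
  "plane_fun.dim (range (cos_sum M)) = M"
proof -
  show "plane_fun.subspace (range (cos_sum M))"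
    unfolding plane_fun.subspace_def
  proof (intro conjI ballI allI)
    have "(0 :: real \<times> real \<Rightarrow> real) = cos_sum M (\<lambda>_. 0)" by (simp add: cos_sum_def fun_eq_iff)
    then show "0 \<in> range (cos_sum M)" by blast
  next
    fix f g assume "f \<in> range (cos_sum M)" "g \<in> range (cos_sum M)"
    then obtain A B where "f = cos_sum M A" "g = cos_sum M B" by blast
    then have "f + g = cos_sum M (\<lambda>m. A m + B m)"
      by (simp add: cos_sum_def fun_eq_iff sum.distrib distrib_right)
    then show "f + g \<in> range (cos_sum M)" by blast
  next
    fix c f assume "f \<in> range (cos_sum M)"
    then obtain A where "f = cos_sum M A" by blast
    then have "(\<lambda>x. c * f x) = cos_sum M (\<lambda>m. c * A m)"
      by (simp add: cos_sum_def fun_eq_iff sum_distrib_left mult.assoc)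
    then show "(\<lambda>x. c * f x) \<in> range (cos_sum M)" by blast
  qed
  have "cos_sum K C \<in> plane_fun.span (cos_mode ` {..<M})" if "K \<le> M" for K C
    using that
  proof (induction K)
    case 0
    have "cos_sum 0 C = 0" by (simp add: cos_sum_def fun_eq_iff)
    then show ?case by (simp only: plane_fun.span_zero)
  next
    case (Suc K)
    have eq: "cos_sum (Suc K) C = cos_sum K C + (\<lambda>x. C K * cos_mode K x)" by (simp add: cos_sum_def fun_eq_iff)
    have "cos_sum K C \<in> plane_fun.span (cos_mode ` {..<M})" using Suc by simp
    moreover have "(\<lambda>x. C K * cos_mode K x) \<in> plane_fun.span (cos_mode ` {..<M})"
      using Suc.prems by (intro plane_fun.span_scale plane_fun.span_base) auto
    ultimately show ?case unfolding eq by (rule plane_fun.span_add)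
  qed
  then show sp: "range (cos_sum M) \<subseteq> plane_fun.span (cos_mode ` {..<M})" by blast
  have "cos_mode m \<in> range (cos_sum M)" if "m < M" for m
  proof -
    have "cos_mode m = cos_sum M (\<lambda>n. if n = m then 1 else 0)"
      using that by (simp add: cos_sum_def fun_eq_iff if_distrib[where f = "\<lambda>z. z * _"] sum.delta cong: if_cong)
    then show ?thesis by blast
  qed
  then have "cos_mode ` {..<M} \<subseteq> range (cos_sum M)" by blast
  then show "plane_fun.dim (range (cos_sum M)) = M"
    using sp mode_independent by (rule plane_fun.dim_unique)
qed

context critical_torus
begin

text \<open>The span of the first \<open>M\<close> modes is a space of dimension \<open>M\<close> on which the second variation is
  negative.\<close>
lemma index_lower_bound:
  assumes "\<And>m. m < M \<Longrightarrow> symbol m < 0"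
  shows "enat M \<le> willmore_index \<tau> (clifford_torus a b)"
proof -
  have q: "q > 0" using ab unfolding q_def a2(3) by simp
  have pref: "pref > 0" unfolding pref_def using \<tau> q by simp
  have neg: "second_variation \<tau> (clifford_torus a b) f < 0" if "f \<in> range (cos_sum M)" "f \<noteq> 0" for f
  proof -
    obtain C where C: "f = cos_sum M C" using \<open>f \<in> range (cos_sum M)\<close> by blast
    have "\<exists>m<M. C m \<noteq> 0"
    proof (rule ccontr)
      assume "\<not> ?thesis"
      then have "f = 0" unfolding C by (simp add: cos_sum_def fun_eq_iff)
      then show False using that(2) by simp
    qed
    then obtain m where m: "m < M" "C m \<noteq> 0" by blast
    obtain X N where "variation \<tau> (clifford_torus a b) X N" "initial_normal_velocity X N f"
      using variation_exists smooth_cos_sum unfolding C by blast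
    then have "second_variation \<tau> (clifford_torus a b) f = 8 * q * pref * (2 * pi\<^sup>2 * (\<Sum>m<M. (C m)\<^sup>2 * symbol m))"
      using second_variation_eq smooth_cos_sum(1) hessian_cos_sum unfolding C by metis
    moreover have "(\<Sum>m<M. (C m)\<^sup>2 * symbol m) < 0" using sum_neg[of M symbol m C] assms m by blast
    ultimately show ?thesis using q pref by (simp add: mult_pos_neg)
  qed
  have "range (cos_sum M) \<in> {U. plane_fun.subspace U \<and> (\<exists>B. finite B \<and> U \<subseteq> plane_fun.span B) \<and>
       U \<subseteq> torus_functions \<and> (\<forall>f\<in>U. f \<noteq> 0 \<longrightarrow> second_variation \<tau> (clifford_torus a b) f < 0)}"
  proof (intro CollectI conjI)
    show "\<exists>B. finite B \<and> range (cos_sum M) \<subseteq> plane_fun.span B"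
      using cos_sums_subspace(2)[of M] by blast
    show "range (cos_sum M) \<subseteq> torus_functions" using smooth_cos_sum by (auto simp: torus_functions_def)
  qed (use cos_sums_subspace(1) neg in blast)+
  then have "enat (plane_fun.dim (range (cos_sum M))) \<le> willmore_index \<tau> (clifford_torus a b)"
    unfolding willmore_index_def by (rule SUP_upper)
  then show ?thesis unfolding cos_sums_subspace(3) .
qed

text \<open>Here \<open>x = - a\<^sup>2\<close>. The first term is \<open>\<le> 0\<close> since \<open>x\<^sup>2 < 1\<close> and \<open>x\<^sup>2 - 1 + 4 q = b\<^sup>2 (3 a\<^sup>2 - 1) > 0\<close>,
  the second since \<open>s < 0\<close>, and the remaining ones are dominated by \<open>- 2 q T\<close>.\<close>
lemma symbol_0_neg:
  assumes "a\<^sup>2 > 1 / 2"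
  shows "symbol 0 < 0"
proof -
  define T A where "T = \<tau>\<^sup>2" and "A = a\<^sup>2"
  have T: "T > 1" unfolding T_def using \<tau> by simp
  have q: "q > 0" using ab unfolding q_def a2(3) by simp
  have A: "1 / 2 < A" "A < 1" using assms a2 by (simp_all add: A_def)
  have qA: "q = A * (1 - A)" and sA: "s = 1 - 2 * A" by (simp_all add: q_def s_def A_def)
  have "symbol 0 = T\<^sup>2 / 2 * (A\<^sup>2 - 1) * (A\<^sup>2 - 1 + 4 * q) - 2 * s * q * T\<^sup>2 * (- A)
    + q * T * A\<^sup>2 - 2 * q * T * (1 + q) + q\<^sup>2 / 2"
    unfolding symbol_eq Let_def T_def A_def by simp
  also have "\<dots> < 0"
  proof -
    have "A\<^sup>2 - 1 + 4 * q = (1 - A) * (3 * A - 1)" unfolding qA by (simp add: power2_eq_square algebra_simps)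
    then have "A\<^sup>2 - 1 + 4 * q \<ge> 0" using A by simp
    moreover have A2: "A\<^sup>2 \<le> 1" using A by (simp add: power_le_one)
    ultimately have 1: "T\<^sup>2 / 2 * (A\<^sup>2 - 1) * (A\<^sup>2 - 1 + 4 * q) \<le> 0"
      by (intro mult_nonpos_nonneg mult_nonneg_nonpos) auto
    have 2: "- 2 * s * q * T\<^sup>2 * (- A) \<le> 0"
    proof -
      have "- 2 * s * q * T\<^sup>2 * (- A) = (2 * q * T\<^sup>2 * A) * s" by simp
      moreover have "(2 * q * T\<^sup>2 * A) * s \<le> 0" using q A sA by (intro mult_nonneg_nonpos) auto
      ultimately show ?thesis by simp
    qed
    have 3: "q * T * A\<^sup>2 \<le> q * T" using A2 q T by (simp add: mult_left_le)
    have 4: "q\<^sup>2 < q * T * q" using q T by (simp add: power2_eq_square)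
    have 5: "2 * q * T * (1 + q) = 2 * (q * T) + 2 * (q * T * q)" by (simp add: algebra_simps)
    have 6: "q * T > 0" using q T by simp
    then have 7: "q * T * q > 0" using q by simp
    show ?thesis using 1 2 3 4 5 6 7 by linarith
  qed
  finally show ?thesis .
qed

text \<open>With \<open>B = b\<^sup>2 \<le> 2 q \<le> 1 / T\<close> one has \<open>x = B y - 1\<close> close to \<open>- 1\<close>. After division by \<open>q\<close> the
  cross term is at most \<open>- T\<^sup>2 y / 2\<close>, while the positive contributions are at most
  \<open>4 T y\<^sup>2 + y\<^sup>4 / 2\<close>; the assumption on \<open>\<tau>\<close> makes the former win.\<close>
lemma symbol_neg:
  assumes A: "a\<^sup>2 > 1 / 2" and T: "\<tau>\<^sup>2 \<ge> 16 * real M ^ 3" and m: "m < M"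
  shows "symbol m < 0"
proof -
  define T A B y x where "T = \<tau>\<^sup>2" and "A = a\<^sup>2" and "B = b\<^sup>2" and "y = real m + 1" and "x = B * real m - A"
  have AB: "A = 1 - B" "A > 1 / 2" "B > 0" using A ab by (simp_all add: A_def B_def)
  have q: "q > 0" "q = A * B" using ab unfolding q_def a2(3) A_def B_def by simp_all
  have y: "1 \<le> y" "y \<le> real M" using m by (simp_all add: y_def)
  have Ty: "T \<ge> 16 * y ^ 3"
  proof -
    have "y ^ 3 \<le> real M ^ 3" using y by (intro power_mono) auto
    then show ?thesis using T unfolding T_def by linarith
  qed
  have "y * 1 \<le> y * y\<^sup>2" using y(1) by (intro mult_left_mono) (simp_all add: one_le_power)
  then have y3: "y \<le> y ^ 3" by (simp add: power3_eq_cube power2_eq_square)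
  have T16: "T \<ge> 16 * y" "T \<ge> 16" using Ty y3 y(1) by linarith+
  have crit: "4 * q * (T - 1) = 1" using critical unfolding q_def a2(3) T_def .
  then have qT: "q * (2 * T) \<le> 1"
  proof -
    have "q * (2 * T) \<le> q * (4 * (T - 1))" using q(1) T16 by (intro mult_left_mono) auto
    then show ?thesis using crit by (simp add: algebra_simps)
  qed
  have q32: "q \<le> 1 / 32"
  proof -
    have "q * 32 \<le> q * (2 * T)" using q(1) T16 by (intro mult_left_mono) auto
    then show ?thesis using qT by linarith
  qed
  have Bq: "B \<le> 2 * q"
  proof -
    have "1 / 2 * B \<le> A * B" using AB by (intro mult_right_mono) auto
    then show ?thesis unfolding q(2) by simp
  qed
  have By: "B * y \<le> 1 / 2" "B * y \<ge> 0"
  proof -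
    have "B * y \<le> (2 * q) * (T / 16)" using Bq T16 y q AB by (intro mult_mono) auto
    then show "B * y \<le> 1 / 2" using qT by linarith
    show "B * y \<ge> 0" using AB y by simp
  qed
  have xy: "x = B * y - 1" unfolding x_def y_def AB(1) by (simp add: algebra_simps)
  have x: "x \<le> - 1 / 2" "x \<ge> - 1" using By xy by simp_all
  have s: "s \<le> - 1 / 2"
  proof -
    have "s = 1 - 2 * A" by (simp add: s_def A_def)
    moreover have "1 - A \<le> 2 * q" using Bq AB(1) by simp
    ultimately show ?thesis using q32 by linarith
  qed
  have t1: "T\<^sup>2 / 2 * (x\<^sup>2 - 1) * (x\<^sup>2 - 1 + 4 * q) \<le> q * (4 * T * y\<^sup>2)"
  proof -
    have e: "(x\<^sup>2 - 1) * (x\<^sup>2 - 1 + 4 * q) = B * (y * (2 - B * y)) * (B * (2 * y - (4 * A + B * y * y)))"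
      unfolding xy q(2) by (simp add: power2_eq_square algebra_simps)
    \<comment> \<open>this factor is nonnegative, so the other one may be replaced by an upper bound even where it is negative\<close>
    have n: "B * (y * (2 - B * y)) \<ge> 0" using AB y By by simp
    have "B * y * y \<ge> 0" using By(2) y(1) by simp
    then have "2 * y - (4 * A + B * y * y) \<le> 2 * y" using AB(2) by linarith
    then have "B * (2 * y - (4 * A + B * y * y)) \<le> B * (2 * y)" by (rule mult_left_mono) (use AB(3) in simp)
    then have "(x\<^sup>2 - 1) * (x\<^sup>2 - 1 + 4 * q) \<le> B * (y * (2 - B * y)) * (B * (2 * y))"
      unfolding e by (rule mult_left_mono[OF _ n])
    also have "\<dots> \<le> B * (y * 2) * (B * (2 * y))"
      using AB y By by (intro mult_right_mono mult_left_mono) auto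
    also have "\<dots> = 4 * (B * B) * y\<^sup>2" by (simp add: power2_eq_square)
    also have "\<dots> \<le> 4 * ((2 * q) * (2 * q)) * y\<^sup>2"
      using Bq AB by (intro mult_right_mono mult_left_mono mult_mono) auto
    finally have "T\<^sup>2 / 2 * ((x\<^sup>2 - 1) * (x\<^sup>2 - 1 + 4 * q)) \<le> T\<^sup>2 / 2 * (4 * ((2 * q) * (2 * q)) * y\<^sup>2)"
      by (intro mult_left_mono) auto
    also have "\<dots> = (q * (2 * T)) * (q * (4 * T * y\<^sup>2))" by (simp add: power2_eq_square)
    also have "\<dots> \<le> 1 * (q * (4 * T * y\<^sup>2))" using qT q T16 by (intro mult_right_mono) auto
    finally show ?thesis by (simp add: mult.assoc)
  qed
  have t2: "- 2 * s * q * T\<^sup>2 * x * y \<le> - q * (T\<^sup>2 * y / 2)"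
  proof -
    have "(- s) * (- x) \<ge> (1 / 2) * (1 / 2)" using s x by (intro mult_mono) auto
    then have "(2 * q * T\<^sup>2 * y) * (1 / 4) \<le> (2 * q * T\<^sup>2 * y) * (s * x)" using q y by (intro mult_left_mono) auto
    then show ?thesis by (simp add: algebra_simps)
  qed
  have t3: "q * T * x\<^sup>2 * y\<^sup>2 \<le> q * T * y\<^sup>2"
  proof -
    have "x\<^sup>2 \<le> 1" using x by (simp add: abs_square_le_1)
    then have "q * T * y\<^sup>2 * x\<^sup>2 \<le> q * T * y\<^sup>2 * 1" using q T16 by (intro mult_left_mono) auto
    then show ?thesis by (simp add: mult_ac)
  qed
  have t4: "2 * q * T * (1 + q) * y\<^sup>2 \<ge> 2 * (q * T * y\<^sup>2)"
  proof -
    have "2 * q * T * (1 + q) * y\<^sup>2 = 2 * (q * T * y\<^sup>2) + 2 * (q * q * T * y\<^sup>2)" by (simp add: algebra_simps)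
    moreover have "q * q * T * y\<^sup>2 \<ge> 0" using q T16 by simp
    ultimately show ?thesis by linarith
  qed
  have t5: "q\<^sup>2 * y ^ 4 / 2 \<le> q * (y ^ 4 / 2)"
  proof -
    have "q * q \<le> q * 1" using q q32 by (intro mult_left_mono) auto
    then have "q\<^sup>2 * (y ^ 4 / 2) \<le> q * (y ^ 4 / 2)" unfolding power2_eq_square by (intro mult_right_mono) auto
    then show ?thesis by simp
  qed
  have f: "4 * T * y\<^sup>2 + y ^ 4 / 2 < T\<^sup>2 * y / 2"
  proof -
    have "(16 * y) * (T * y) \<le> T * (T * y)" using T16 y by (intro mult_right_mono) auto
    then have 1: "4 * T * y\<^sup>2 \<le> T\<^sup>2 * y / 4" by (simp add: power2_eq_square algebra_simps)
    have "(16 * y ^ 3) * y \<le> T * y" using Ty y by (intro mult_right_mono) auto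
    then have 2: "y ^ 4 / 2 \<le> T * y / 32" by (simp add: power4_eq_xxxx power3_eq_cube mult_ac)
    have "16 * (T * y) \<le> T * (T * y)" using T16 y by (intro mult_right_mono) auto
    then have 3: "T * y / 32 \<le> T\<^sup>2 * y / 512" by (simp add: power2_eq_square algebra_simps)
    have "T\<^sup>2 * y > 0" using T16 y by simp
    then show ?thesis using 1 2 3 by linarith
  qed
  have e: "q * (4 * T * y\<^sup>2 + y ^ 4 / 2 - T\<^sup>2 * y / 2) - q * T * y\<^sup>2 =
      q * (4 * T * y\<^sup>2) + q * (y ^ 4 / 2) - q * (T\<^sup>2 * y / 2) - q * T * y\<^sup>2"
    by (simp only: right_diff_distrib distrib_left)
  have "symbol m \<le> q * (4 * T * y\<^sup>2 + y ^ 4 / 2 - T\<^sup>2 * y / 2) - q * T * y\<^sup>2"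
    unfolding symbol_eq Let_def T_def[symmetric] A_def[symmetric] B_def[symmetric] y_def[symmetric] x_def[symmetric]
    unfolding e using t1 t2 t3 t4 t5 by linarith
  also have "\<dots> < 0"
  proof -
    have "q * (4 * T * y\<^sup>2 + y ^ 4 / 2 - T\<^sup>2 * y / 2) < 0" using q f by (simp add: mult_pos_neg)
    moreover have "q * T * y\<^sup>2 \<ge> 0" using q T16 by simp
    ultimately show ?thesis by linarith
  qed
  finally show ?thesis .
qed

end

lemma critical_willmore_torus:
  assumes "\<tau> > sqrt 2"
  shows "critical_torus \<tau> (a_par \<tau>) (b_par \<tau>)" "(a_par \<tau>)\<^sup>2 > 1 / 2"
proof -
  define T c where "T = \<tau>\<^sup>2" and "c = c_par \<tau>"
  have T: "T > 2" unfolding T_def proof -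
    have "sqrt 2 * sqrt 2 < \<tau> * \<tau>" using assms by (intro mult_strict_mono) (auto intro: less_trans[of 0 "sqrt 2"])
    then show "\<tau>\<^sup>2 > 2" by (simp add: power2_eq_square)
  qed
  have "sqrt 2 > 1" by simp
  then have tau: "\<tau> > 1" using assms by linarith
  have r: "(T - 2) / (T - 1) > 0" "(T - 2) / (T - 1) < 1" using T by simp_all
  have c: "c = sqrt ((T - 2) / (T - 1)) / 2" by (simp add: c_def c_par_def T_def)
  have c0: "c > 0" "c < 1 / 2" using r unfolding c by (simp_all add: real_sqrt_lt_1_iff)
  have c2: "4 * c\<^sup>2 = (T - 2) / (T - 1)" 
  proof -
    have "c\<^sup>2 = (sqrt ((T - 2) / (T - 1)))\<^sup>2 / 4" unfolding c power_divide by simp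
    also have "(sqrt ((T - 2) / (T - 1)))\<^sup>2 = (T - 2) / (T - 1)" by (rule real_sqrt_pow2) (use r in linarith)
    finally have e: "c\<^sup>2 = (T - 2) / (T - 1) / 4" .
    have "4 * (r / 4) = r" for r :: real by simp
    then show ?thesis unfolding e .
  qed
  have ab: "(a_par \<tau>)\<^sup>2 = 1 / 2 + c" "(b_par \<tau>)\<^sup>2 = 1 / 2 - c" "a_par \<tau> > 0" "b_par \<tau> > 0"
    using c0 by (simp_all add: a_par_def b_par_def c_def[symmetric])
  show "(a_par \<tau>)\<^sup>2 > 1 / 2" using ab c0 by simp
  have "4 * ((1 / 2 + c) * (1 / 2 - c)) * (T - 1) = (1 - 4 * c\<^sup>2) * (T - 1)" by (simp add: power2_eq_square algebra_simps)
  also have "\<dots> = 1" unfolding c2 using T by (simp add: field_simps)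
  finally show "critical_torus \<tau> (a_par \<tau>) (b_par \<tau>)"
    by unfold_locales (use tau ab in \<open>simp_all add: T_def\<close>)
qed

theorem theorem2:
  shows "(\<forall>\<tau>>sqrt 2. willmore_surface \<tau> (willmore_torus \<tau>) \<and> willmore_unstable \<tau> (willmore_torus \<tau>)) \<and>
    ((\<lambda>\<tau>. willmore_index \<tau> (willmore_torus \<tau>)) \<longlongrightarrow> \<infinity>) at_top"
proof (intro conjI allI impI)
  fix \<tau> :: real assume "\<tau> > sqrt 2"
  then interpret critical_torus \<tau> "a_par \<tau>" "b_par \<tau>" by (rule critical_willmore_torus)
  show "willmore_surface \<tau> (willmore_torus \<tau>)"
    unfolding willmore_torus_def by (rule willmore_surface_clifford)
  have "symbol 0 < 0" by (rule symbol_0_neg[OF critical_willmore_torus(2)[OF \<open>\<tau> > sqrt 2\<close>]])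
  then have "enat 1 \<le> willmore_index \<tau> (willmore_torus \<tau>)"
    unfolding willmore_torus_def by (intro index_lower_bound) (simp add: less_Suc0)
  then show "willmore_unstable \<tau> (willmore_torus \<tau>)"
    unfolding willmore_stable_def by (auto simp: enat_0_iff)
next
  show "((\<lambda>\<tau>. willmore_index \<tau> (willmore_torus \<tau>)) \<longlongrightarrow> \<infinity>) at_top"
  proof (rule order_tendstoI)
    fix n :: enat assume "n < \<infinity>"
    then obtain N where N: "n = enat N" by (cases n) auto
    define M where "M = Suc N"
    have "\<forall>\<^sub>F \<tau>::real in at_top. \<tau> > sqrt 2" "\<forall>\<^sub>F \<tau>::real in at_top. \<tau> \<ge> 16 * real M ^ 3"
      by (rule eventually_gt_at_top, rule eventually_ge_at_top)
    then show "\<forall>\<^sub>F \<tau> in at_top. n < willmore_index \<tau> (willmore_torus \<tau>)"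
    proof eventually_elim
      case (elim \<tau>)
      interpret critical_torus \<tau> "a_par \<tau>" "b_par \<tau>" using elim(1) by (rule critical_willmore_torus)
      have "\<tau> * 1 \<le> \<tau> * \<tau>" using \<tau> by (intro mult_left_mono) auto
      then have "\<tau>\<^sup>2 \<ge> 16 * real M ^ 3" using elim(2) by (simp add: power2_eq_square)
      then have "enat M \<le> willmore_index \<tau> (willmore_torus \<tau>)"
        unfolding willmore_torus_def
        by (intro index_lower_bound symbol_neg[OF critical_willmore_torus(2)[OF elim(1)]])
      moreover have "n < enat M" by (simp add: N M_def)
      ultimately show ?case by (rule less_le_trans[rotated])
    qed
  qed simp
qed

end
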